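(* Let $\alpha>-1$ and let $\kappa=\sqrt[3]{2}$. For fixed $t>0$, the sub-leading coefficient $\mathrm p(n,t)$ of the monic orthogonal polynomials has the following asymptotic expansion as $n\to\infty$: $$\begin{aligned}\mathrm p(n,t)=\;&-n^2-\alpha n-\frac{3t^{2/3}n^{2/3}}{2\kappa}+\frac{\alpha t^{1/3}n^{1/3}}{\kappa^2}-\frac{6\alpha^2-18t-1}{36}+\frac{\alpha(\alpha^2-27t-1)}{54\kappa t^{1/3}n^{1/3}}\\&+\frac{\alpha^4+\alpha^2(54t-1)-81t^2}{324\kappa^2t^{2/3}n^{2/3}}+\frac{\alpha(\alpha^2+81t^2-1)}{972tn}+O(n^{-4/3}).\end{aligned}$$
   Context: For $\alpha>-1$, $t\ge0$, let $w(x;t,\alpha)=x^\alpha e^{-x-t/x}$ on $(0,\infty)$, and let $P_n(x;t,\alpha)$, $n=0,1,2,\dots$, be the monic orthogonal polynomials of degree $n$ with respect to $w$: $\int_0^\infty P_jP_kw\,dx=h_j\delta_{jk}$, $h_j>0$. The sub-leading coefficient $\mathrm p(n,t)$ (depending also on $\alpha$) is the coefficient of $x^{n-1}$ in $P_n$: $P_n(x;t,\alpha)=x^n+\mathrm p(n,t)x^{n-1}+\cdots+P_n(0;t,\alpha)$, with $\mathrm p(0,t)=0$. *)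

theory Defs
  imports "HOL-Analysis.Analysis" "HOL-Computational_Algebra.Polynomial" "HOL-Library.Landau_Symbols"
begin

definition sing_laguerre_weight :: "real \<Rightarrow> real \<Rightarrow> real \<Rightarrow> real" where
  "sing_laguerre_weight t \<alpha> x = x powr \<alpha> * exp (- x - t / x)"

(* Integrability is stated separately, since the library's Lebesgue integral of a
   non-integrable function is 0. *)
definition monic_orthogonal_polys :: "real \<Rightarrow> real \<Rightarrow> (nat \<Rightarrow> real poly) \<Rightarrow> bool" where
  "monic_orthogonal_polys t \<alpha> P \<longleftrightarrow>
     (\<forall>n. degree (P n) = n \<and> lead_coeff (P n) = 1) \<and>
     (\<exists>h :: nat \<Rightarrow> real. (\<forall>j. h j > 0) \<and>
        (\<forall>j k.
           set_integrable lborel {0<..}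
             (\<lambda>x. poly (P j) x * poly (P k) x * sing_laguerre_weight t \<alpha> x) \<and>
           (LINT x:{0<..}|lborel. poly (P j) x * poly (P k) x * sing_laguerre_weight t \<alpha> x)
             = (if j = k then h j else 0)))"

definition subleading_coeff :: "(nat \<Rightarrow> real poly) \<Rightarrow> nat \<Rightarrow> real" where
  "subleading_coeff P n = (if n = 0 then 0 else coeff (P n) (n - 1))"

end

theory Submission
  imports Defs "HOL-Real_Asymp.Real_Asymp"
begin

text \<open>
  Integration by parts turns \<open>R\<^sub>n = t \<langle>1/x\<rangle>\<^sub>n\<close> and
  \<open>r\<^sub>n = t \<integral> P\<^sub>n P\<^sub>n\<^sub>-\<^sub>1 w/x / h\<^sub>n\<^sub>-\<^sub>1\<close> into a positive solution of a first-order
  discrete system, and gives \<open>p(n) = r\<^sub>n - \<beta>\<^sub>n\<close>, so that no summation constant has to be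
  determined. After centring, both right-hand sides of the system, as functions of one unknown, satisfy
  \<open>\<lambda> F(\<lambda> y) < F(y)\<close> for \<open>\<lambda> > 1\<close>; hence the ratio of two solutions, taken alternately up and
  down, obeys a maximum principle. A truncated formal solution in powers of \<open>n\<^sup>-\<^sup>1\<^sup>/\<^sup>3\<close>,
  multiplied or divided by \<open>1 + D u\<^sup>-\<^sup>7\<^sup>/\<^sup>3 + \<delta> u\<close>, is a barrier from above or below. Crude polynomial bounds, which follow from
  \<open>\<langle>1/x\<rangle>\<^sup>2 \<le> \<langle>1/x\<^sup>2\<rangle>\<close>, let \<open>\<delta> u\<close> dominate at infinity; \<open>\<delta> \<rightarrow> 0\<close> then shows that the formal
  solution approximates the true one with relative error \<open>O(n\<^sup>-\<^sup>7\<^sup>/\<^sup>3)\<close>.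
\<close>

section \<open>Integration by parts for the singular weight\<close>

text \<open>The obstacle is a degeneracy. At leading order the two equations of the system read S =
  u / \<eta> and \<eta> = u / S, the same equation twice: only the product of the unknowns is
  determined, and both right-hand sides are homogeneous of degree -1, so that scaling gives no
  strict inequality. Strictness comes from the terms with G^2, which are smaller by a relative order
  u^(-4/3). This loss fixes the orders used everywhere. A relative residual u^(-11/3) of the formal
  solution yields only the accuracy u^(-7/3), and a barrier is admissible because its variation
  between neighbouring sites, after centring, costs u^(-2), less than the gain u^(-4/3). The
  accuracy is just sufficient. The error u^(-2) of \<eta> enters the subleading coefficient through
  the square of the increment of \<eta>, of size u^(-2/3), times S^2, of size u^(4/3), which gives
  u^(-4/3). A formula containing \<beta>_n itself would amplify the same relative error u^(-7/3) by
  u^2.\<close>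

lemma set_integrable_powr_exp:
  fixes a t :: real
  assumes "t > 0"
  shows "set_integrable lborel {0<..} (\<lambda>x. x powr a * exp (- x - t / x))"
proof -
  \<comment> \<open>Half of the exponential decay is held back. \<open>?g\<close> tends to 0 at both
    ends of the half-line for every real \<open>a\<close>, hence is bounded, and
    \<open>exp (- x / 2)\<close> is left as an integrable majorant.\<close>
  let ?g = "\<lambda>x::real. x powr a * exp (- x / 2 - t / x)"
  have cont: "continuous_on {0<..} ?g"
    by (intro continuous_intros) auto
  have lim0: "(?g \<longlongrightarrow> 0) (at_right 0)" using assms by real_asymp
  have limtop: "(?g \<longlongrightarrow> 0) at_top" using assms by real_asymp
  have "eventually (\<lambda>x. ?g x < 1) (at_right 0)"
    using order_tendstoD(2)[OF lim0, of 1] by simp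
  then obtain b where b: "b > 0" "\<And>x. 0 < x \<Longrightarrow> x < b \<Longrightarrow> ?g x < 1"
    by (auto simp: eventually_at_right_field)
  have "eventually (\<lambda>x. ?g x < 1) at_top"
    using order_tendstoD(2)[OF limtop, of 1] by simp
  then obtain c where c: "\<And>x. x \<ge> c \<Longrightarrow> ?g x < 1"
    by (auto simp: eventually_at_top_linorder)
  have "compact {b..max b c}" "{b..max b c} \<noteq> {}" by auto
  moreover have "continuous_on {b..max b c} ?g"
    by (rule continuous_on_subset[OF cont]) (use b(1) in auto)
  ultimately obtain z where z: "\<And>x. x \<in> {b..max b c} \<Longrightarrow> ?g x \<le> ?g z"
    using continuous_attains_sup[of "{b..max b c}" ?g] by blast
  define K where "K = max 1 (?g z)"
  have K: "?g x \<le> K" if "x > 0" for x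
  proof -
    consider "x < b" | "x \<ge> c" | "x \<in> {b..max b c}" by fastforce
    then show ?thesis
      using b(2)[of x] c[of x] z[of x] that unfolding K_def by cases linarith+
  qed
  have "(\<lambda>x::real. exp (- (1/2) * x)) absolutely_integrable_on {0..}"
  proof (rule nonnegative_absolutely_integrable_1)
    show "(\<lambda>x::real. exp (- (1/2) * x)) integrable_on {0..}"
      using has_integral_exp_minus_to_infinity[of "1/2" 0] by (auto simp: integrable_on_def)
  qed auto
  then have "set_integrable lebesgue {0..} (\<lambda>x::real. exp (- x / 2))"
    by (simp add: field_simps)
  then have "set_integrable lborel {0..} (\<lambda>x::real. exp (- x / 2))"
    unfolding set_integrable_def
    by (subst (asm) integrable_completion) auto
  then have "set_integrable lborel {0<..} (\<lambda>x::real. exp (- x / 2))"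
    by (rule set_integrable_subset) auto
  then have int: "set_integrable lborel {0<..} (\<lambda>x::real. K * exp (- x / 2))"
    by simp
  show ?thesis
  proof (rule set_integrable_bound[OF int])
    show "set_borel_measurable lborel {0<..} (\<lambda>x. x powr a * exp (- x - t / x))"
      unfolding set_borel_measurable_def by measurable
    show "AE x in lborel. x \<in> {0<..} \<longrightarrow>
        norm (x powr a * exp (- x - t / x)) \<le> norm (K * exp (- x / 2))"
    proof (intro always_eventually allI impI)
      fix x :: real assume "x \<in> {0<..}"
      then have x: "x > 0" by simp
      have "x powr a * exp (- x - t / x) = ?g x * exp (- x / 2)"
        by (simp add: mult.assoc flip: exp_add)
      also have "\<dots> \<le> K * exp (- x / 2)"
        using K[OF x] by (intro mult_right_mono) auto
      finally show "norm (x powr a * exp (- x - t / x)) \<le> norm (K * exp (- x / 2))"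
        by (auto simp: abs_mult K_def)
    qed
  qed
qed

lemma poly_powr_eq:
  fixes x a :: real
  assumes "x > 0"
  shows "poly p x * x powr a = (\<Sum>i\<le>degree p. coeff p i * x powr (a + real i))"
  using assms by (simp add: poly_altdef sum_distrib_left powr_add powr_realpow mult_ac)

lemma set_integrable_poly_powr_exp:
  fixes a t :: real
  assumes "t > 0"
  shows "set_integrable lborel {0<..} (\<lambda>x. poly p x * x powr a * exp (- x - t / x))"
proof -
  have "set_integrable lborel {0<..}
     (\<lambda>x. \<Sum>i\<le>degree p. coeff p i * (x powr (a + real i) * exp (- x - t / x)))"
    unfolding set_integrable_def scaleR_sum_right
    by (intro Bochner_Integration.integrable_sum set_integrable_mult_right[unfolded
        set_integrable_def]
        set_integrable_powr_exp[OF assms, unfolded set_integrable_def])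
  also have "?this \<longleftrightarrow> ?thesis"
  proof (intro set_integrable_cong refl)
    fix x :: real assume "x \<in> {0<..}"
    then show "(\<Sum>i\<le>degree p. coeff p i * (x powr (a + real i) * exp (- x - t / x))) =
        poly p x * x powr a * exp (- x - t / x)"
      using poly_powr_eq[of x p a] by (simp add: sum_distrib_right mult.assoc)
  qed
  finally show ?thesis .
qed

text \<open>The exponent is lowered by 2 so that one functional on polynomials covers three
  integrals: with w the weight, \<open>[:0,0,1:] * p\<close>, \<open>[:0,1:] * p\<close> and
  \<open>p\<close> give the integrals of p w, p w / x and p w / x^2.\<close>

definition sl_functional :: "real \<Rightarrow> real \<Rightarrow> real poly \<Rightarrow> real" where
  "sl_functional t \<alpha> p = (LINT x:{0<..}|lborel. poly p x * x powr (\<alpha> - 2) * exp (- x - t / x))"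

lemma sl_functional_add:
  assumes "t > 0"
  shows "sl_functional t \<alpha> (p + q) = sl_functional t \<alpha> p + sl_functional t \<alpha> q"
  unfolding sl_functional_def using set_integrable_poly_powr_exp[OF assms]
  by (simp add: ring_distribs set_integral_add)

lemma sl_functional_smult: "sl_functional t \<alpha> (smult c p) = c * sl_functional t \<alpha> p"
  unfolding sl_functional_def by (simp add: mult.assoc)

lemma sl_functional_diff:
  assumes "t > 0"
  shows "sl_functional t \<alpha> (p - q) = sl_functional t \<alpha> p - sl_functional t \<alpha> q"
proof -
  have "sl_functional t \<alpha> (- q) = - sl_functional t \<alpha> q"
    using sl_functional_smult[of t \<alpha> "-1" q] by simp
  then show ?thesis using sl_functional_add[OF assms, of \<alpha> p "- q"] by simp
qed

lemma sl_functional_weight: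
  "sl_functional t \<alpha> ([:0,0,1:] * p) = (LINT x:{0<..}|lborel. poly p x
      * sing_laguerre_weight t \<alpha> x)"
  unfolding sl_functional_def sing_laguerre_weight_def
proof (intro set_lebesgue_integral_cong allI impI)
  fix x :: real assume "x \<in> {0<..}"
  then have "x * x * x powr (\<alpha> - 2) = x powr \<alpha>"
    by (simp add: powr_diff powr_numeral power2_eq_square)
  then show "poly ([:0, 0, 1:] * p) x * x powr (\<alpha> - 2) * exp (- x - t / x) =
         poly p x * (x powr \<alpha> * exp (- x - t / x))"
    by simp
qed auto

lemma sl_functional_nonneg:
  assumes "\<And>x. x > 0 \<Longrightarrow> poly p x \<ge> 0"
  shows "sl_functional t \<alpha> p \<ge> 0"
  unfolding sl_functional_def set_lebesgue_integral_def
  using assms by (intro integral_nonneg_AE) (auto simp: indicator_def)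

lemma sl_functional_pos:
  assumes "t > 0" "\<And>x. x > 0 \<Longrightarrow> poly p x \<ge> 0" "p \<noteq> 0"
  shows "sl_functional t \<alpha> p > 0"
proof (rule ccontr)
  assume "\<not> ?thesis"
  moreover have "sl_functional t \<alpha> p \<ge> 0" by (rule sl_functional_nonneg) (rule assms(2))
  ultimately have eq0: "sl_functional t \<alpha> p = 0" by simp
  let ?f = "\<lambda>x. indicator {0<..} x *\<^sub>R (poly p x * x powr (\<alpha> - 2) * exp (- x - t / x))"
  have "AE x in lborel. ?f x = 0"
  proof (subst integral_nonneg_eq_0_iff_AE[symmetric])
    show "integrable lborel ?f"
      using set_integrable_poly_powr_exp[OF assms(1)] unfolding set_integrable_def .
    show "AE x in lborel. 0 \<le> ?f x" using assms(2) by (auto simp: indicator_def)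
    show "integral\<^sup>L lborel ?f = 0"
      using eq0 unfolding sl_functional_def set_lebesgue_integral_def .
  qed
  \<comment> \<open>A nonzero polynomial has finitely many zeros, so a vanishing integral would make
    the unit interval a null set.\<close>
  moreover have "AE x in lborel. x \<notin> {x. poly p x = 0}"
    by (intro AE_not_in finite_imp_null_set_lborel poly_roots_finite assms(3))
  ultimately have "AE x in lborel. x \<notin> {0<..<(1::real)}"
    by eventually_elim (auto simp: indicator_def)
  then have "emeasure lborel {0<..<(1::real)} = 0"
    by (subst (asm) AE_iff_measurable[OF _ refl]) (auto simp: greaterThanLessThan_def
        greaterThan_def lessThan_def Int_def)
  then show False by simp
qed

lemma tendsto_poly_powr_exp:
  fixes a t :: real
  assumes "t > 0"
  shows "((\<lambda>x. poly p x * x powr a * exp (- x - t / x)) \<longlongrightarrow> 0) (at_right 0)"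
    and "((\<lambda>x. poly p x * x powr a * exp (- x - t / x)) \<longlongrightarrow> 0) at_top"
proof -
  let ?s = "\<lambda>x. \<Sum>i\<le>degree p. coeff p i * (x powr (a + real i) * exp (- x - t / x))"
  have eq: "?s x = poly p x * x powr a * exp (- x - t / x)" if "x > 0" for x
    using poly_powr_eq[OF that, of p a] by (simp add: sum_distrib_right mult.assoc)
  have "((\<lambda>x. x powr b * exp (- x - t / x)) \<longlongrightarrow> 0) (at_right 0)" for b
    using assms by real_asymp
  then have "(?s \<longlongrightarrow> (\<Sum>i\<le>degree p. coeff p i * 0)) (at_right 0)"
    by (intro tendsto_intros)
  then have "(?s \<longlongrightarrow> 0) (at_right 0)" by simp
  then show "((\<lambda>x. poly p x * x powr a * exp (- x - t / x)) \<longlongrightarrow> 0) (at_right 0)"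
    by (rule Lim_transform_eventually)
       (use eq in \<open>auto simp: eventually_at_right_field intro!: exI[of _ 1]\<close>)
  have "((\<lambda>x. x powr b * exp (- x - t / x)) \<longlongrightarrow> 0) at_top" for b
    using assms by real_asymp
  then have "(?s \<longlongrightarrow> (\<Sum>i\<le>degree p. coeff p i * 0)) at_top"
    by (intro tendsto_intros)
  then have "(?s \<longlongrightarrow> 0) at_top" by simp
  then show "((\<lambda>x. poly p x * x powr a * exp (- x - t / x)) \<longlongrightarrow> 0) at_top"
    by (rule Lim_transform_eventually)
       (rule eventually_mono[OF eventually_gt_at_top[of 0] eq])
qed

text \<open>The weight satisfies x^2 w' = (-x^2 + \<alpha> x + t) w, so the difference of the two
  sides is the integral of the derivative of p w. The boundary terms vanish at both ends, at 0
  because of \<open>exp (- t / x)\<close>.\<close>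

lemma sl_functional_pearson:
  assumes "t > 0"
  shows "sl_functional t \<alpha> ([:0,0,1:] * pderiv p) = sl_functional t \<alpha> ([:-t, -\<alpha>, 1:] * p)"
proof -
  let ?F = "\<lambda>x. poly p x * x powr \<alpha> * exp (- x - t / x)"
  let ?q = "[:0,0,1:] * pderiv p - [:-t, -\<alpha>, 1:] * p"
  let ?f = "\<lambda>x. poly ?q x * x powr (\<alpha> - 2) * exp (- x - t / x)"
  have "(LBINT x=0..\<infinity>. ?f x) = 0 - 0"
  proof (rule interval_integral_FTC_integrable[where F = ?F])
    fix x :: real assume "0 < ereal x"
    then have x: "x > 0" by simp
    have pw: "x powr (\<alpha> - 1) = x * x powr (\<alpha> - 2)" "x powr \<alpha> = x * x * x powr (\<alpha> - 2)"
      using x by (simp_all add: powr_diff powr_numeral power2_eq_square)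
    have "(?F has_real_derivative
        (poly (pderiv p) x * x powr \<alpha> + poly p x * (\<alpha> * x powr (\<alpha> - 1)) +
         poly p x * x powr \<alpha> * (- 1 + t / (x * x))) * exp (- x - t / x)) (at x)"
      using x by (auto intro!: derivative_eq_intros simp: algebra_simps)
    also have "poly (pderiv p) x * x powr \<alpha> + poly p x * (\<alpha> * x powr (\<alpha> - 1)) +
         poly p x * x powr \<alpha> * (- 1 + t / (x * x)) = poly ?q x * x powr (\<alpha> - 2)"
      using x unfolding pw by (simp add: algebra_simps)
    finally have "(?F has_real_derivative ?f x) (at x)" .
    then show "(?F has_vector_derivative ?f x) (at x)"
      by (simp add: has_real_derivative_iff_has_vector_derivative)
    show "isCont ?f x" using x by (intro continuous_intros) auto
  next
    show "set_integrable lborel (einterval 0 \<infinity>) ?f"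
      using set_integrable_poly_powr_exp[OF assms, of ?q "\<alpha> - 2"]
      by (simp add: einterval_def greaterThan_def)
    show "((?F \<circ> real_of_ereal) \<longlongrightarrow> 0) (at_right 0)"
      using tendsto_poly_powr_exp(1)[OF assms, of p \<alpha>]
      by (simp add: ereal_tendsto_simps zero_ereal_def)
    show "((?F \<circ> real_of_ereal) \<longlongrightarrow> 0) (at_left \<infinity>)"
      using tendsto_poly_powr_exp(2)[OF assms, of p \<alpha>] by (simp add: ereal_tendsto_simps)
  qed simp
  then have "sl_functional t \<alpha> ?q = 0"
    unfolding sl_functional_def interval_lebesgue_integral_def
    by (simp add: einterval_def greaterThan_def)
  then show ?thesis by (simp only: sl_functional_diff[OF assms] right_minus_eq)
qed

section \<open>Recurrence coefficients and ladder quantities\<close>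

locale sing_laguerre_polys =
  fixes t \<alpha> :: real and P :: "nat \<Rightarrow> real poly" and h :: "nat \<Rightarrow> real"
  assumes t_pos: "t > 0"
    and degree_P: "degree (P n) = n"
    and lead_P: "coeff (P n) n = 1"
    and h_pos: "h n > 0"
    and orth: "sl_functional t \<alpha> ([:0,0,1:] * (P j * P k)) = (if j = k then h j else 0)"
begin

abbreviation M :: "real poly \<Rightarrow> real" where "M \<equiv> sl_functional t \<alpha>"

lemmas M_add = sl_functional_add[OF t_pos, of \<alpha>]
lemmas M_diff = sl_functional_diff[OF t_pos, of \<alpha>]

lemma M_const: "M ([:c:] * p) = c * M p"
  using sl_functional_smult[of t \<alpha> c p] by simp

lemma P_nonzero: "P n \<noteq> 0"
  using lead_P[of n] by auto

text \<open>Subtracting the multiple of \<open>P (degree q)\<close> with the same leading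
  coefficient lowers the degree; the part removed contributes only when
  \<open>degree q = n\<close>.\<close>

lemma M_orth_below: "degree q \<le> n \<Longrightarrow> M ([:0,0,1:] * (P n * q)) = coeff q n * h n"
proof (induction "degree q" arbitrary: q rule: less_induct)
  case less
  let ?d = "degree q"
  let ?r = "q - [:lead_coeff q:] * P ?d"
  have deg: "degree ?r < ?d \<or> ?r = 0"
  proof (cases "?d = 0")
    case True
    then have "P 0 = 1"
      using degree_P[of 0] lead_P[of 0] by (auto elim!: degree_eq_zeroE simp: one_pCons)
    with True show ?thesis by (auto elim!: degree_eq_zeroE)
  next
    case False
    have "degree ?r \<le> ?d"
      by (intro degree_diff_le) (auto simp: degree_P intro: order.trans[OF degree_smult_le])
    moreover have "coeff ?r ?d = 0" by (simp add: lead_P)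
    ultimately show ?thesis
      using False eq_zero_or_degree_less[of ?r ?d] by blast
  qed
  have split: "[:0,0,1:] * (P n * q) =
      [:0,0,1:] * (P n * ?r) + [:lead_coeff q:] * ([:0,0,1:] * (P n * P ?d))"
    by (simp add: algebra_simps del: mult_pCons_left mult_pCons_right)
  have "M ([:0,0,1:] * (P n * ?r)) = coeff ?r n * h n"
  proof (cases "?r = 0")
    case False
    with deg less show ?thesis by auto
  qed (simp add: sl_functional_def)
  moreover have "coeff (P ?d) n = (if ?d = n then 1 else 0)"
    using less.prems lead_P[of n] by (auto simp: degree_P intro!: coeff_eq_0)
  ultimately show ?case
    unfolding split M_add M_const orth by (auto simp: algebra_simps)
qed

text \<open>The quantities \<open>b n\<close>, \<open>r n\<close> belong to the pair \<open>(n + 1, n)\<close>; in the usual notation they are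
  \<open>\<beta>\<^sub>n\<^sub>+\<^sub>1\<close> and \<open>r\<^sub>n\<^sub>+\<^sub>1\<close>. This avoids the index \<open>-1\<close>.\<close>

definition "Ax n = M ([:0,1:] * (P n * P n))"
definition "Bx n = M ([:0,1:] * (P (Suc n) * P n))"
definition "p1 n = subleading_coeff P n"
definition "a n = M ([:0,0,0,1:] * (P n * P n)) / h n"
definition "b n = h (Suc n) / h n"
definition "R n = t * Ax n / h n"
definition "r n = t * Bx n / h n"

text \<open>Tested against \<open>P (degree q)\<close>, the polynomial returns its leading
  coefficient times a positive norm.\<close>

lemma poly_eq_0_of_orth:
  assumes "degree q \<le> n" "\<And>j. j \<le> n \<Longrightarrow> M ([:0,0,1:] * (P j * q)) = 0"
  shows "q = 0"
  using M_orth_below[of q "degree q"] assms h_pos[of "degree q"] by auto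

lemma M_shift: "M ([:0,0,0,1:] * (P j * P k)) = M ([:0,0,1:] * (P j * ([:0,1:] * P k)))"
  by (rule arg_cong[of _ _ M]) (simp add: algebra_simps)

lemma degree_xP: "degree ([:0,1:] * P n) = Suc n"
  using P_nonzero[of n] by (simp add: degree_P)

lemma M_shift_Suc: "M ([:0,0,0,1:] * (P (Suc n) * P n)) = h (Suc n)"
  unfolding M_shift by (subst M_orth_below) (simp_all add: degree_P lead_P)

lemma M_shift_far:
  assumes "Suc k < j"
  shows "M ([:0,0,0,1:] * (P j * P k)) = 0"
  unfolding M_shift using assms degree_xP[of k]
  by (subst M_orth_below) (auto simp: coeff_eq_0)

lemma M_swap: "M (p * (P j * P k)) = M (p * (P k * P j))"
  by (simp add: mult.commute)

lemma recurrence_0: "[:0,1:] * P 0 = P 1 + [:a 0:] * P 0"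
proof -
  let ?q = "[:0,1:] * P 0 - P 1 - [:a 0:] * P 0"
  have "?q = 0"
  proof (rule poly_eq_0_of_orth)
    have "degree ?q \<le> 1"
      by (intro degree_diff_le) (simp_all add: degree_P degree_xP)
    moreover have "coeff ?q 1 = 0" using lead_P[of 0] lead_P[of 1]
        by (simp add: coeff_eq_0 degree_P)
    ultimately show "degree ?q \<le> 0"
      by (metis One_nat_def degree_0 eq_zero_or_degree_less le_SucE less_Suc_eq_le order_refl
          zero_le)
    fix j :: nat assume "j \<le> 0"
    then have j: "j = 0" by simp
    have "[:0,0,1:] * (P 0 * ?q) = [:0,0,0,1:] * (P 0 * P 0)
       - [:0,0,1:] * (P 0 * P 1) - [:a 0:] * ([:0,0,1:] * (P 0 * P 0))"
      by (simp add: algebra_simps)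
    then show "M ([:0,0,1:] * (P j * ?q)) = 0"
      unfolding j by (simp only: M_diff M_const orth) (use h_pos[of 0] in \<open>simp add: a_def\<close>)
  qed
  then show ?thesis by (simp add: algebra_simps)
qed

text \<open>The leading terms cancel in the remainder \<open>?q\<close>, and \<open>a\<close> and
  \<open>b\<close> are exactly the values that make it orthogonal to every \<open>P j\<close> up to
  its degree.\<close>

lemma recurrence: "[:0,1:] * P (Suc n) = P (Suc (Suc n)) + [:a (Suc n):] * P (Suc n) + [:b n:]
    * P n"
proof -
  let ?N = "Suc n"
  let ?q = "[:0,1:] * P ?N - P (Suc ?N) - [:a ?N:] * P ?N - [:b n:] * P n"
  have "?q = 0"
  proof (rule poly_eq_0_of_orth)
    have "degree ?q \<le> Suc ?N"
      by (intro degree_diff_le) (simp_all add: degree_P degree_xP)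
    moreover have "coeff ?q (Suc ?N) = 0"
      using lead_P[of ?N] lead_P[of "Suc ?N"] by (simp add: coeff_eq_0 degree_P)
    ultimately show "degree ?q \<le> ?N"
      by (metis degree_0 eq_zero_or_degree_less less_Suc_eq_le zero_le)
    fix j :: nat assume j: "j \<le> ?N"
    have "[:0,0,1:] * (P j * ?q) = [:0,0,0,1:] * (P j * P ?N)
       - [:0,0,1:] * (P j * P (Suc ?N)) - [:a ?N:] * ([:0,0,1:] * (P j * P ?N))
       - [:b n:] * ([:0,0,1:] * (P j * P n))"
      by (simp add: algebra_simps)
    then have *: "M ([:0,0,1:] * (P j * ?q)) = M ([:0,0,0,1:] * (P j * P ?N))
       - (if j = ?N then a ?N * h j else 0) - (if j = n then b n * h j else 0)"
      using j by (simp only: M_diff M_const orth) auto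
    consider "j = ?N" | "j = n" | "j < n" using j by linarith
    then show "M ([:0,0,1:] * (P j * ?q)) = 0"
    proof cases
      case 1 then show ?thesis unfolding * using h_pos[of ?N] by (simp add: a_def)
    next
      case 2
      have "M ([:0,0,0,1:] * (P n * P ?N)) = h ?N" by (subst M_swap) (rule M_shift_Suc)
      with 2 show ?thesis unfolding * using h_pos[of n] by (simp add: b_def)
    next
      case 3
      then have "M ([:0,0,0,1:] * (P j * P ?N)) = 0" by (subst M_swap) (rule M_shift_far, simp)
      with 3 show ?thesis unfolding * by simp
    qed
  qed
  then show ?thesis by (simp add: algebra_simps)
qed

section \<open>Consequences of integration by parts\<close>

lemmas pearson = sl_functional_pearson[OF t_pos, of \<alpha>]

lemma pearson3: "M ([:0,0,1:] * pderiv p) = M ([:0,0,1:] * p) - \<alpha> * M ([:0,1:] * p) - t * M p"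
proof -
  have "[:-t, -\<alpha>, 1:] * p = [:0,0,1:] * p - [:\<alpha>:] * ([:0,1:] * p) - [:t:] * p"
    by (simp add: algebra_simps)
  then show ?thesis unfolding pearson by (simp only: M_diff M_const)
qed

lemma coeff_pderiv_P: "coeff (pderiv (P n)) k = real (Suc k) * coeff (P n) (Suc k)"
  by (simp add: coeff_pderiv)

lemma degree_pderiv_P: "degree (pderiv (P n)) \<le> n - 1"
  by (simp add: degree_pderiv degree_P)

lemma M_pderiv_self: "M ([:0,0,1:] * (P n * pderiv (P n))) = 0"
  using degree_pderiv_P[of n]
  by (subst M_orth_below) (auto simp: coeff_pderiv_P coeff_eq_0 degree_P)

lemma M_xpderiv_self: "M ([:0,0,1:] * (P n * ([:0,1:] * pderiv (P n)))) = real n * h n"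
proof (cases n)
  case 0
  then have "pderiv (P n) = 0" using degree_P[of n] by (simp add: pderiv_eq_0_iff)
  with 0 show ?thesis by (simp add: sl_functional_def)
next
  case (Suc m)
  have "degree ([:0,1:] * pderiv (P n)) \<le> n"
    using degree_pderiv_P[of n] Suc by (auto simp: degree_pCons_eq_if)
  then show ?thesis
    by (subst M_orth_below) (use Suc lead_P[of "Suc m"] in \<open>auto simp: coeff_pderiv_P\<close>)
qed

text \<open>Integration by parts for x P_n^2: the derivative contributes (2 n + 1) h_n, and the term
  with \<open>t\<close> is \<open>R n\<close> times h_n.\<close>

lemma coeff_eq_scaled: "a n = 2 * real n + 1 + \<alpha> + R n"
proof -
  have e1: "[:0,0,1:] * pderiv ([:0,1:] * (P n * P n)) =
      [:0,0,1:] * (P n * P n) + [:2:] * ([:0,0,1:] * (P n * ([:0,1:] * pderiv (P n))))"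
    by (simp add: pderiv_mult pderiv_pCons algebra_simps numeral_poly)
  have e2: "[:0,0,1:] * ([:0,1:] * (P n * P n)) = [:0,0,0,1:] * (P n * P n)"
    "[:0,1:] * ([:0,1:] * (P n * P n)) = [:0,0,1:] * (P n * P n)"
    by (simp_all add: algebra_simps)
  have "h n + 2 * (real n * h n) = a n * h n - \<alpha> * h n - t * Ax n"
    using pearson3[of "[:0,1:] * (P n * P n)"] h_pos[of n]
    unfolding e1 e2 M_add M_const M_xpderiv_self orth by (simp add: a_def Ax_def)
  then show ?thesis using h_pos[of n] by (simp add: R_def field_simps)
qed

lemma R_pos: "R n > 0"
proof -
  have "Ax n > 0"
    unfolding Ax_def
    by (rule sl_functional_pos[OF t_pos]) (use P_nonzero[of n] in \<open>auto\<close>)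
  then show ?thesis using t_pos h_pos[of n] by (simp add: R_def)
qed

text \<open>Let < > be the mean with density P_n^2 w / h_n. Integration by parts for P_n^2 receives
  nothing from the derivative and gives t <1/x^2> = 1 - \<alpha> <1/x>; since \<open>R n\<close> is
  t <1/x>, the bound is <1/x>^2 \<le> <1/x^2> multiplied by t^2.\<close>

lemma R_bound: "(R n)\<^sup>2 + \<alpha> * R n \<le> t"
proof -
  define m where "m = Ax n / h n"
  \<comment> \<open>The variance of 1/x in polynomial form: x^2 (1/x - m)^2 = (1 - m x)^2, where
    \<open>m\<close> is the mean of 1/x.\<close>
  have "M ((1 - [:0, m:])\<^sup>2 * (P n * P n)) \<ge> 0"
    by (rule sl_functional_nonneg) (auto intro!: mult_nonneg_nonneg)
  also have "(1 - [:0, m:])\<^sup>2 * (P n * P n) = P n * P n - [:2 * m:] * ([:0,1:] * (P n * P n))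
     + [:m * m:] * ([:0,0,1:] * (P n * P n))"
    by (simp add: algebra_simps power2_eq_square one_pCons)
  finally have "M (P n * P n) - 2 * m * Ax n + m * m * h n \<ge> 0"
    unfolding M_add M_diff M_const orth by (simp add: Ax_def)
  moreover have "Ax n = m * h n" using h_pos[of n] by (simp add: m_def)
  ultimately have C: "M (P n * P n) \<ge> m * m * h n" by (simp add: algebra_simps)
  have e1: "[:0,0,1:] * pderiv (P n * P n) = [:2:] * ([:0,0,1:] * (P n * pderiv (P n)))"
    by (simp add: pderiv_mult algebra_simps numeral_poly)
  have "0 = h n - \<alpha> * Ax n - t * M (P n * P n)"
    using pearson3[of "P n * P n"] unfolding e1 M_const M_pderiv_self orth by (simp add: Ax_def)
  then have "t * (m * m * h n) \<le> h n - \<alpha> * (m * h n)"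
    using C t_pos \<open>Ax n = m * h n\<close> by (simp add: mult_left_mono)
  then have "t * (m * m) * h n \<le> (1 - \<alpha> * m) * h n" by (simp add: algebra_simps)
  then have "t * (m * m) \<le> 1 - \<alpha> * m" using h_pos[of n] by (simp only: mult_le_cancel_right_pos)
  then have "t * (t * (m * m)) \<le> t * (1 - \<alpha> * m)" using t_pos by (simp add: mult_left_mono)
  then show ?thesis by (simp add: R_def m_def power2_eq_square algebra_simps)
qed

lemma b_pos: "b n > 0" using h_pos by (simp add: b_def)

section \<open>Compatibility of the recurrence with the integrals against w / x\<close>

lemma M_x: "M ([:0,1:] * (P j * ([:0,1:] * P k))) = M ([:0,0,1:] * (P j * P k))"
  by (rule arg_cong[of _ _ M]) (simp add: algebra_simps)

lemma r_sum_0: "r 0 = t - a 0 * R 0"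
proof -
  have "h 0 = M ([:0,1:] * (P 0 * ([:0,1:] * P 0)))" unfolding M_x orth by simp
  also have "[:0,1:] * (P 0 * ([:0,1:] * P 0)) =
      [:0,1:] * (P (Suc 0) * P 0) + [:a 0:] * ([:0,1:] * (P 0 * P 0))"
    unfolding recurrence_0 by (simp add: algebra_simps)
  finally have "h 0 = Bx 0 + a 0 * Ax 0" unfolding M_add M_const by (simp add: Ax_def Bx_def)
  then show ?thesis using h_pos[of 0] by (simp add: r_def R_def field_simps)
qed

text \<open>The norm is the integral of P_N (x P_N) w / x; expanding the factor x P_N by the
  recurrence turns it into integrals of the type \<open>Ax\<close> and \<open>Bx\<close>.\<close>

lemma r_sum: "r (Suc n) + r n = t - a (Suc n) * R (Suc n)"
proof -
  let ?N = "Suc n"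
  have "h ?N = M ([:0,1:] * (P ?N * ([:0,1:] * P ?N)))" unfolding M_x orth by simp
  also have "[:0,1:] * (P ?N * ([:0,1:] * P ?N)) =
      [:0,1:] * (P (Suc ?N) * P ?N) + [:a ?N:] * ([:0,1:] * (P ?N * P ?N)) + [:b n:] * ([:0,1:]
          * (P ?N * P n))"
    unfolding recurrence by (simp add: algebra_simps)
  finally have *: "h ?N = Bx ?N + a ?N * Ax ?N + b n * Bx n"
    unfolding M_add M_const by (simp add: Ax_def Bx_def)
  have "t = t * h ?N / h ?N" using h_pos[of ?N] by simp
  also have "\<dots> = r ?N + a ?N * R ?N + t * (b n / h ?N) * Bx n"
    unfolding * [THEN arg_cong, of "\<lambda>x. t * x"]
    by (simp add: r_def R_def add_divide_distrib distrib_left mult_ac)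
  also have "t * (b n / h ?N) * Bx n = r n" using h_pos[of ?N] by (simp add: r_def b_def)
  finally show ?thesis by simp
qed

lemma bR_0: "b 0 * R 1 = - a 0 * r 0"
proof -
  have "0 = M ([:0,1:] * (P 1 * ([:0,1:] * P 0)))" unfolding M_x orth by simp
  also have "[:0,1:] * (P 1 * ([:0,1:] * P 0)) =
      [:0,1:] * (P 1 * P 1) + [:a 0:] * ([:0,1:] * (P (Suc 0) * P 0))"
    unfolding recurrence_0 by (simp add: algebra_simps)
  finally have "0 = Ax 1 + a 0 * Bx 0" unfolding M_add M_const by (simp add: Ax_def Bx_def)
  then have "Ax 1 = - a 0 * Bx 0" by simp
  then show ?thesis using h_pos[of 0] h_pos[of 1] by (simp add: r_def R_def b_def field_simps)
qed

text \<open>Orthogonality of P_(n+1) to P_(n+2) and to P_n is written with the factor x P_(n+1)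
  against w / x and expanded by the recurrence. Both expansions contain the integral of P_(n+2) P_n
  w / x, which is then eliminated.\<close>

lemma bR: "b (Suc n) * R (Suc (Suc n)) - b n * R n = - a (Suc n) * (r (Suc n) - r n)"
proof -
  let ?N = "Suc n"
  have "0 = M ([:0,1:] * (P (Suc ?N) * ([:0,1:] * P ?N)))" unfolding M_x orth by simp
  also have "[:0,1:] * (P (Suc ?N) * ([:0,1:] * P ?N)) =
      [:0,1:] * (P (Suc ?N) * P (Suc ?N)) + [:a ?N:] * ([:0,1:] * (P (Suc ?N) * P ?N))
      + [:b n:] * ([:0,1:] * (P (Suc ?N) * P n))"
    unfolding recurrence by (simp add: algebra_simps)
  finally have e1: "0 = Ax (Suc ?N) + a ?N * Bx ?N + b n * M ([:0,1:] * (P (Suc ?N) * P n))"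
    unfolding M_add M_const by (simp add: Ax_def Bx_def)
  have "0 = M ([:0,1:] * (P n * ([:0,1:] * P ?N)))" unfolding M_x orth by simp
  also have "[:0,1:] * (P n * ([:0,1:] * P ?N)) =
      [:0,1:] * (P (Suc ?N) * P n) + [:a ?N:] * ([:0,1:] * (P ?N * P n))
      + [:b n:] * ([:0,1:] * (P n * P n))"
    unfolding recurrence by (simp add: algebra_simps)
  finally have e2: "0 = M ([:0,1:] * (P (Suc ?N) * P n)) + a ?N * Bx n + b n * Ax n"
    unfolding M_add M_const by (simp add: Ax_def Bx_def)
  have e: "Ax (Suc ?N) + a ?N * Bx ?N = b n * (a ?N * Bx n + b n * Ax n)"
    using e1 e2 by algebra
  have "h ?N * (b ?N * R (Suc ?N) - b n * R n + a ?N * (r ?N - r n)) =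
      t * (Ax (Suc ?N) + a ?N * Bx ?N - b n * (a ?N * Bx n + b n * Ax n))"
    using h_pos[of n] h_pos[of ?N] h_pos[of "Suc ?N"] by (simp add: r_def R_def b_def field_simps)
  also have "\<dots> = 0" using e by simp
  finally show ?thesis using h_pos[of ?N] by simp
qed

text \<open>Integration by parts for x P_(n+1) P_n. The subleading coefficient enters through the
  derivative of P_(n+1), while the term with \<open>t\<close> is \<open>r n\<close>.\<close>

lemma p1_Suc: "p1 (Suc n) = r n - b n"
proof -
  let ?N = "Suc n"
  have e1: "[:0,0,1:] * pderiv ([:0,1:] * (P ?N * P n)) =
      [:0,0,1:] * (P ?N * P n) + [:0,0,1:] * (P n * ([:0,1:] * pderiv (P ?N)))
      + [:0,0,1:] * (P ?N * ([:0,1:] * pderiv (P n)))"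
    by (simp add: pderiv_mult pderiv_pCons algebra_simps)
  have e2: "[:0,0,1:] * ([:0,1:] * (P ?N * P n)) = [:0,0,0,1:] * (P ?N * P n)"
    "[:0,1:] * ([:0,1:] * (P ?N * P n)) = [:0,0,1:] * (P ?N * P n)"
    by (simp_all add: algebra_simps)
  have z: "M ([:0,0,1:] * (P ?N * ([:0,1:] * pderiv (P n)))) = 0"
  proof (subst M_orth_below)
    have "degree ([:0,1:] * pderiv (P n)) \<le> Suc (n - 1)"
      using degree_pderiv_P[of n] by (auto simp: degree_pCons_eq_if)
    then show "degree ([:0,1:] * pderiv (P n)) \<le> ?N" by simp
    show "coeff ([:0,1:] * pderiv (P n)) ?N * h ?N = 0"
      by (simp add: coeff_pderiv_P coeff_eq_0 degree_P)
  qed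
  \<comment> \<open>The Euler operator multiplies x^j by j, so subtracting \<open>?N\<close> times
    the polynomial removes the leading term and leaves -1 times the subleading coefficient in degree
    n.\<close>
  let ?q = "[:0,1:] * pderiv (P ?N) - [:real ?N:] * P ?N"
  have dq: "degree ?q \<le> n"
  proof -
    have "degree ([:0,1:] * pderiv (P ?N)) \<le> ?N"
      using degree_pderiv_P[of ?N] by (auto simp: degree_pCons_eq_if)
    then have "degree ?q \<le> ?N"
      by (intro degree_diff_le) (auto simp: degree_P intro: order.trans[OF degree_smult_le])
    moreover have "coeff ?q ?N = 0" using lead_P[of ?N] by (simp add: coeff_pderiv_P)
    ultimately show ?thesis by (metis degree_0 eq_zero_or_degree_less less_Suc_eq_le zero_le)
  qed
  have cq: "coeff ?q n = - p1 ?N"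
    by (cases n) (simp_all add: p1_def subleading_coeff_def coeff_pderiv_P algebra_simps)
  have e3: "[:0,0,1:] * (P n * ([:0,1:] * pderiv (P ?N))) =
      [:0,0,1:] * (P n * ?q) + [:real ?N:] * ([:0,0,1:] * (P n * P ?N))"
    by (simp add: algebra_simps)
  have y: "M ([:0,0,1:] * (P n * ([:0,1:] * pderiv (P ?N)))) = - p1 ?N * h n"
    unfolding e3 M_add M_const M_orth_below[OF dq] cq orth by simp
  have "- p1 ?N * h n = h ?N - t * Bx n"
    using pearson3[of "[:0,1:] * (P ?N * P n)"]
    unfolding e1 e2 M_add y z orth M_shift_Suc by (simp add: Bx_def)
  then show ?thesis using h_pos[of n] by (simp add: r_def b_def field_simps)
qed

section \<open>Summed relations and the sign of r\<close>

lemma p1_step: "p1 (Suc (Suc n)) = p1 (Suc n) - a (Suc n)"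
proof -
  have "coeff ([:0,1:] * P (Suc n)) (Suc n) =
      coeff (P (Suc (Suc n)) + [:a (Suc n):] * P (Suc n) + [:b n:] * P n) (Suc n)"
    by (simp only: recurrence)
  then have "coeff (P (Suc n)) n = coeff (P (Suc (Suc n))) (Suc n) + a (Suc n)"
    using lead_P[of "Suc n"] by (simp add: coeff_eq_0[of "P n"] degree_P)
  then show ?thesis by (simp add: p1_def subleading_coeff_def)
qed

lemma p1_1: "p1 1 = - a 0"
proof -
  have "coeff ([:0,1:] * P 0) 0 = coeff (P 1 + [:a 0:] * P 0) 0"
    by (simp only: recurrence_0)
  then show ?thesis using lead_P[of 0] by (simp add: p1_def subleading_coeff_def)
qed

text \<open>A first integral. Multiplying \<open>bR\<close> by \<open>R (Suc n)\<close> and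
  replacing \<open>a (Suc n) * R (Suc n)\<close> by means of \<open>r_sum\<close> makes the
  right-hand side the increment of r (r - t), so the relation telescopes.\<close>

lemma b_RR: "b n * R (Suc n) * R n = r n * (r n - t)"
proof (induction n)
  case 0
  then show ?case using r_sum_0 bR_0 by simp
next
  case (Suc n)
  then show ?case using r_sum[of n] bR[of n] by algebra
qed

text \<open>Another telescoping relation. The increment of \<open>b\<close> comes from comparing
  \<open>p1_Suc\<close> at two consecutive indices with \<open>p1_step\<close>.\<close>

lemma b_R_add: "b n * (R (Suc n) + R n) = t * real (Suc n) - (2 * real (Suc n) + \<alpha>) * r n"
proof (induction n)
  case 0
  have "r 0 - b 0 = - a 0" using p1_Suc[of 0] p1_1 by simp
  moreover have "a 0 = 1 + \<alpha> + R 0" using coeff_eq_scaled[of 0] by simp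
  ultimately show ?case using r_sum_0 bR_0 by simp algebra
next
  case (Suc n)
  have "b (Suc n) = b n + r (Suc n) - r n + a (Suc n)"
    using p1_Suc[of n] p1_Suc[of "Suc n"] p1_step[of n] by simp
  moreover have "a (Suc n) = 2 * real n + 3 + \<alpha> + R (Suc n)"
    using coeff_eq_scaled[of "Suc n"] by simp
  ultimately show ?case using Suc r_sum[of n] bR[of n] by (simp only: of_nat_Suc) algebra
qed

text \<open>Positivity of \<open>b\<close> and \<open>R\<close> in \<open>b_RR\<close> leaves r < 0
  or r > t. The second case contradicts positivity in \<open>b_R_add\<close>, because N + \<alpha> >
  0 for N \<ge> 1.\<close>

lemma r_neg: 
  assumes "\<alpha> > -1"
  shows "r n < 0"
proof -
  let ?N = "real (Suc n)"
  have prod: "r n * (r n - t) > 0"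
    using b_RR[of n] b_pos[of n] R_pos[of n] R_pos[of "Suc n"] by (metis mult_pos_pos)
  have lin: "t * ?N - (2 * ?N + \<alpha>) * r n > 0"
    using b_R_add[of n] b_pos[of n] R_pos[of n] R_pos[of "Suc n"]
    by (metis add_pos_pos mult_pos_pos)
  have "\<not> r n > t"
  proof
    assume "r n > t"
    moreover have "2 * ?N + \<alpha> > 0" using assms by simp
    ultimately have "(2 * ?N + \<alpha>) * r n > (2 * ?N + \<alpha>) * t" by simp
    moreover have "(?N + \<alpha>) * t > 0" using assms t_pos by simp
    ultimately show False using lin by (simp add: algebra_simps)
  qed
  then show ?thesis using prod by (auto simp: zero_less_mult_iff)
qed

end

section \<open>The discrete system\<close>

text \<open>Here \<open>G = t/4\<close>, \<open>S n = (t/2 - r\<^sub>n\<^sub>+\<^sub>1)/2\<close> and \<open>\<eta> n = t/(2 R\<^sub>n\<^sub>+\<^sub>1)\<close>. The shift of \<open>-r\<close> by \<open>t/2\<close>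
  makes both right-hand sides fall faster than \<open>1/\<lambda>\<close> under scaling by \<open>\<lambda> > 1\<close>, and in terms of
  \<open>U\<close> both equations are centred:
  \<open>S n\<close> sits at \<open>U n\<close> and \<open>\<eta> n\<close> at \<open>U n + G/2\<close>.\<close>

locale positive_discrete_system =
  fixes G \<alpha> :: real and U S \<eta> :: "nat \<Rightarrow> real"
  assumes G_pos: "G > 0" and \<alpha>_gt: "\<alpha> > -1"
    and U_def: "U n = G * (real n + 1 + \<alpha> / 2)"
    and S_gt: "S n > G"
    and \<eta>_pos: "\<eta> n > 0"
    and \<eta>_quadratic: "(\<eta> n)\<^sup>2 \<ge> \<alpha> / 2 * \<eta> n + G"
    and S_add: "S (Suc n) + S n = 2 * (U n + G / 2) / \<eta> n + 2 * G\<^sup>2 / (\<eta> n)\<^sup>2"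
    and \<eta>_add: "(\<eta> (Suc n) + \<eta> n) * ((S (Suc n))\<^sup>2 - G\<^sup>2) = 2 * U (Suc n) * S (Suc n) - \<alpha> * G\<^sup>2"

context sing_laguerre_polys
begin

lemma S_add_from_R:
  fixes x A y :: real
  assumes "2 * x = (A + 2 * G / y) * (2 * G / y)"
  shows "x = (A * G) / y + 2 * G\<^sup>2 / y\<^sup>2"
  using assms by (simp add: divide_inverse algebra_simps power2_eq_square)

lemma inverse_sum_scale:
  fixes y z c :: real
  assumes "y \<noteq> 0" "z \<noteq> 0"
  shows "(y + z) * (c * ((2 * G / y) * (2 * G / z))) = 2 * G * (c * (2 * G / y + 2 * G / z))"
  using assms by (simp add: divide_simps) (simp add: algebra_simps)

lemma b_from_inverse_product:
  fixes y z c :: real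
  assumes "c * ((2 * G / y) * (2 * G / z)) = 4 * v" "y \<noteq> 0" "z \<noteq> 0" "G \<noteq> 0"
  shows "c = v * y * z / G\<^sup>2"
proof -
  have "c = (c * ((2 * G / y) * (2 * G / z))) * (y * z) / (4 * G\<^sup>2)"
    using assms(2-) by (simp add: power2_eq_square)
  also have "\<dots> = (4 * v) * (y * z) / (4 * G\<^sup>2)" by (simp only: assms(1))
  finally show ?thesis by simp
qed

text \<open>The shift by t/2 turns r (r - t) into 4 (S^2 - G^2), symmetric in S. The equation for
  \<eta> is \<open>b_R_add\<close> divided by \<open>b_RR\<close>, which eliminates
  \<open>b\<close>; the equation for S is \<open>r_sum\<close> with \<open>a\<close> expressed
  through \<open>R\<close>.\<close>

lemma positive_discrete_system:
  assumes "\<alpha> > -1"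
  defines "G \<equiv> t / 4" and "S \<equiv> (\<lambda>n. t / 4 - r n / 2)" and "\<eta> \<equiv> (\<lambda>n. t / (2 * R (Suc n)))"
  shows "positive_discrete_system G \<alpha> (\<lambda>n. G * (real n + 1 + \<alpha> / 2)) S \<eta>"
    and "p1 (Suc (Suc n)) = 2 * G - 2 * S (Suc n) - ((S (Suc n))\<^sup>2 - G\<^sup>2) * \<eta> (Suc n) * \<eta> n / G\<^sup>2"
proof -
  have G: "G > 0" "t = 4 * G" using t_pos by (simp_all add: G_def)
  have \<eta>: "\<eta> n > 0" "R (Suc n) = 2 * G / \<eta> n" for n
    using R_pos[of "Suc n"] t_pos by (simp_all add: \<eta>_def G_def field_simps)
  have r: "r n = 2 * G - 2 * S n" for n by (simp add: S_def G_def)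
  have S: "S n > G" for n using r_neg[OF assms(1), of n] r[of n] by simp
  show "positive_discrete_system G \<alpha> (\<lambda>n. G * (real n + 1 + \<alpha> / 2)) S \<eta>"
  proof
    fix n
    have "(2 * G / \<eta> n)\<^sup>2 + \<alpha> * (2 * G / \<eta> n) \<le> 4 * G"
      using R_bound[of "Suc n"] G(2) unfolding \<eta>(2) by linarith
    then have "G * (4 * G + \<alpha> * 2 * \<eta> n) \<le> G * (4 * (\<eta> n)\<^sup>2)"
      using \<eta>(1)[of n] by (simp add: field_simps power2_eq_square)
    then have "4 * G + \<alpha> * 2 * \<eta> n \<le> 4 * (\<eta> n)\<^sup>2"
      using G(1) by (simp only: mult_le_cancel_left_pos)
    then show "\<alpha> / 2 * \<eta> n + G \<le> (\<eta> n)\<^sup>2" by simp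
    have a: "a (Suc n) = 2 * real n + 3 + \<alpha> + 2 * G / \<eta> n"
      using coeff_eq_scaled[of "Suc n"] \<eta>(2)[of n] by simp
    have "2 * (S (Suc n) + S n) = a (Suc n) * R (Suc n)"
      using r_sum[of n] G(2) unfolding r by simp
    then have "2 * (S (Suc n) + S n) = (2 * real n + 3 + \<alpha> + 2 * G / \<eta> n) * (2 * G / \<eta> n)"
      unfolding a \<eta>(2) .
    then have "S (Suc n) + S n = ((2 * real n + 3 + \<alpha>) * G) / \<eta> n + 2 * G\<^sup>2 / (\<eta> n)\<^sup>2"
      by (rule S_add_from_R)
    also have "(2 * real n + 3 + \<alpha>) * G = 2 * (G * (real n + 1 + \<alpha> / 2) + G / 2)"
      by (simp add: algebra_simps)
    finally show "S (Suc n) + S n = 2 * (G * (real n + 1 + \<alpha> / 2) + G / 2) / \<eta> n + 2 * G\<^sup>2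
        / (\<eta> n)\<^sup>2" .
    let ?N = "Suc n"
    let ?s = "S ?N"
    have e1: "b ?N * ((2 * G / \<eta> ?N) * (2 * G / \<eta> n)) = 4 * (?s - G) * (?s + G)"
      using b_RR[of ?N] unfolding \<eta>(2) r by (simp add: algebra_simps G_def)
    have e2: "b ?N * (2 * G / \<eta> ?N + 2 * G / \<eta> n)
        = 4 * G * (real n + 2) + (2 * real n + 4 + \<alpha>) * (2 * ?s - 2 * G)"
      using b_R_add[of ?N] unfolding \<eta>(2) r by (simp add: algebra_simps G_def)
    \<comment> \<open>The identity (1/R + 1/R') R R' = R + R', scaled so that both known values of
      the products with \<open>b\<close> can be inserted.\<close>
    have e3: "(\<eta> ?N + \<eta> n) * (b ?N * ((2 * G / \<eta> ?N) * (2 * G / \<eta> n))) =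
        2 * G * (b ?N * (2 * G / \<eta> ?N + 2 * G / \<eta> n))"
      by (rule inverse_sum_scale) (use \<eta>(1) in \<open>auto simp: less_imp_neq[symmetric]\<close>)
    show "(\<eta> ?N + \<eta> n) * (?s\<^sup>2 - G\<^sup>2) = 2 * (G * (real ?N + 1 + \<alpha> / 2)) * ?s - \<alpha> * G\<^sup>2"
      using e3 unfolding e1 e2 by (simp add: algebra_simps power2_eq_square)
  qed (use G(1) S \<eta>(1) assms(1) in auto)
  have "b (Suc n) * ((2 * G / \<eta> (Suc n)) * (2 * G / \<eta> n)) = 4 * ((S (Suc n))\<^sup>2 - G\<^sup>2)"
    using b_RR[of "Suc n"] unfolding \<eta>(2) r by (simp add: algebra_simps power2_eq_square G_def)
  then have "b (Suc n) = ((S (Suc n))\<^sup>2 - G\<^sup>2) * \<eta> (Suc n) * \<eta> n / G\<^sup>2"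
    by (rule b_from_inverse_product) (use G(1) \<eta>(1) in \<open>auto simp: less_imp_neq[symmetric]\<close>)
  then show "p1 (Suc (Suc n)) = 2 * G - 2 * S (Suc n) - ((S (Suc n))\<^sup>2 - G\<^sup>2) * \<eta> (Suc n) * \<eta> n
      / G\<^sup>2"
    using p1_Suc[of "Suc n"] r[of "Suc n"] by simp
qed

end

lemma monic_orthogonal_polys_imp_system:
  assumes "monic_orthogonal_polys t \<alpha> P" "t > 0" "\<alpha> > -1"
  obtains S \<eta> where
    "positive_discrete_system (t / 4) \<alpha> (\<lambda>n. t / 4 * (real n + 1 + \<alpha> / 2)) S \<eta>"
    "\<And>n. subleading_coeff P (Suc (Suc n)) = 2 * (t / 4) - 2 * S (Suc n)
       - ((S (Suc n))\<^sup>2 - (t / 4)\<^sup>2) * \<eta> (Suc n) * \<eta> n / (t / 4)\<^sup>2"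
proof -
  from assms(1) obtain h where h: "\<And>n. degree (P n) = n" "\<And>n. lead_coeff (P n) = 1" "\<And>j. h j > 0"
    "\<And>j k. (LINT x:{0<..}|lborel. poly (P j) x * poly (P k) x * sing_laguerre_weight t \<alpha> x)
             = (if j = k then h j else 0)"
    unfolding monic_orthogonal_polys_def by blast
  interpret sing_laguerre_polys t \<alpha> P h
  proof
    fix n show "coeff (P n) n = 1" using h(1,2)[of n] by simp
  next
    fix j k show "sl_functional t \<alpha> ([:0,0,1:] * (P j * P k)) = (if j = k then h j else 0)"
      using h(4)[of j k] unfolding sl_functional_weight by simp
  qed (use h assms in auto)
  show thesis
    using that[OF positive_discrete_system(1)[OF assms(3)]] positive_discrete_system(2)[OF assms(3)]
    by (simp add: p1_def)
qed

section \<open>Comparison of positive solutions\<close>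

text \<open>The system is viewed on a chain: \<open>S\<close> lives on the nodes \<open>U n\<close>,
  \<eta> on the links \<open>U n + G / 2\<close>. This is the sum of the two adjacent values of
  \<eta> as a function of \<open>S\<close> at a node.\<close>

definition node_rhs :: "real \<Rightarrow> real \<Rightarrow> real \<Rightarrow> real \<Rightarrow> real" where
  "node_rhs G \<alpha> u s = (2 * u * s - \<alpha> * G\<^sup>2) / (s\<^sup>2 - G\<^sup>2)"

text \<open>For \<sigma> = G / l the second fraction is
  \<open>l * node_rhs G \<alpha> u (l * s)\<close>. The gap therefore carries the factor G -
  \<sigma>, and the sign of the remaining bracket decides the scaling inequality.\<close>

lemma node_rhs_gap_eq:
  fixes G \<alpha> u s \<sigma> :: real
  assumes "s\<^sup>2 \<noteq> G\<^sup>2" "s\<^sup>2 \<noteq> \<sigma>\<^sup>2"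
  shows "node_rhs G \<alpha> u s - (2 * u * s - \<alpha> * G * \<sigma>) / (s\<^sup>2 - \<sigma>\<^sup>2) =
    (G - \<sigma>) * (2 * u * s * (G + \<sigma>) - \<alpha> * G * (s\<^sup>2 + G * \<sigma>)) / ((s\<^sup>2 - G\<^sup>2) * (s\<^sup>2 - \<sigma>\<^sup>2))"
proof -
  have ne: "s\<^sup>2 - G\<^sup>2 \<noteq> 0" "s\<^sup>2 - \<sigma>\<^sup>2 \<noteq> 0" using assms by auto
  have "(2 * u * s - \<alpha> * G\<^sup>2) * (s\<^sup>2 - \<sigma>\<^sup>2) - (2 * u * s - \<alpha> * G * \<sigma>) * (s\<^sup>2 - G\<^sup>2) =
    (G - \<sigma>) * (2 * u * s * (G + \<sigma>) - \<alpha> * G * (s\<^sup>2 + G * \<sigma>))"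
    by (simp add: algebra_simps power2_eq_square)
  then show ?thesis unfolding node_rhs_def diff_frac_eq[OF ne] by simp
qed

lemma node_rhs_scale:
  fixes l :: real
  assumes "l \<noteq> 0"
  shows "l * node_rhs G \<alpha> u (l * s) = (2 * u * s - \<alpha> * G * (G / l)) / (s\<^sup>2 - (G / l)\<^sup>2)"
proof -
  have "(l * (2 * u * (l * s) - \<alpha> * G\<^sup>2)) = l\<^sup>2 * (2 * u * s - \<alpha> * G * (G / l))"
    using assms by (simp add: right_diff_distrib power2_eq_square)
  moreover have "(l * s)\<^sup>2 - G\<^sup>2 = l\<^sup>2 * (s\<^sup>2 - (G / l)\<^sup>2)"
    using assms by (simp add: right_diff_distrib power_mult_distrib power_divide)
  ultimately show ?thesis using assms by (simp add: node_rhs_def power2_eq_square)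
qed

text \<open>The bracket in the gap formula is positive: for \<alpha> > 0 it is at least (2 u -
  \<alpha> s) s (G + \<sigma>), since \<sigma> < G < s. The premise on \<alpha> s is what makes this
  positive.\<close>

lemma node_rhs_scale_less:
  fixes G \<alpha> u s l :: real
  assumes "G > 0" "u > 0" "s > G" "\<alpha> * s < 2 * u" "l > 1"
  shows "l * node_rhs G \<alpha> u (l * s) < node_rhs G \<alpha> u s"
proof -
  define \<sigma> where "\<sigma> = G / l"
  have \<sigma>: "0 < \<sigma>" "\<sigma> < G" using assms by (simp_all add: \<sigma>_def field_simps)
  have sq: "s\<^sup>2 > G\<^sup>2" "s\<^sup>2 > \<sigma>\<^sup>2" using assms \<sigma> by (auto intro!: power_strict_mono)
  have "\<alpha> * G * (s\<^sup>2 + G * \<sigma>) < 2 * u * s * (G + \<sigma>)"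
  proof (cases "\<alpha> > 0")
    case True
    have "\<alpha> * s * (s * G) < 2 * u * (s * G)"
      using assms by (intro mult_strict_right_mono) auto
    moreover have "\<alpha> * (G * G * \<sigma>) \<le> \<alpha> * (s * s * \<sigma>)"
      using True assms \<sigma> by (intro mult_left_mono mult_right_mono mult_mono) auto
    moreover have "\<alpha> * s * (s * \<sigma>) < 2 * u * (s * \<sigma>)"
      using assms \<sigma> by (intro mult_strict_right_mono) auto
    ultimately show ?thesis by (simp add: algebra_simps power2_eq_square)
  next
    case False
    then have "\<alpha> * G * (s\<^sup>2 + G * \<sigma>) \<le> 0"
      using assms \<sigma> by (simp add: mult_nonpos_nonneg)
    moreover have "2 * u * s * (G + \<sigma>) > 0" using assms \<sigma> by simp
    ultimately show ?thesis by linarith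
  qed
  then have "(G - \<sigma>) * (2 * u * s * (G + \<sigma>) - \<alpha> * G * (s\<^sup>2 + G * \<sigma>)) /
      ((s\<^sup>2 - G\<^sup>2) * (s\<^sup>2 - \<sigma>\<^sup>2)) > 0"
    using sq \<sigma> by simp
  then have "node_rhs G \<alpha> u s - (2 * u * s - \<alpha> * G * \<sigma>) / (s\<^sup>2 - \<sigma>\<^sup>2) > 0"
    using sq by (subst node_rhs_gap_eq) auto
  then show ?thesis using assms(5) by (subst node_rhs_scale) (auto simp: \<sigma>_def)
qed

definition link_rhs :: "real \<Rightarrow> real \<Rightarrow> real \<Rightarrow> real" where
  "link_rhs G u y = 2 * u / y + 2 * G\<^sup>2 / y\<^sup>2"

text \<open>The term 2 u / y is exactly scale invariant here; the strict inequality comes from the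
  inverse square alone.\<close>

lemma link_rhs_scale_less:
  fixes l :: real
  assumes "G > 0" "y > 0" "l > 1"
  shows "l * link_rhs G u (l * y) < link_rhs G u y"
proof -
  have "l * link_rhs G u (l * y) = 2 * u / y + 2 * G\<^sup>2 / (l * y\<^sup>2)"
    using assms by (simp add: link_rhs_def distrib_left power2_eq_square)
  moreover have "2 * G\<^sup>2 / (l * y\<^sup>2) < 2 * G\<^sup>2 / y\<^sup>2"
    using assms by (intro divide_strict_left_mono) auto
  ultimately show ?thesis by (simp add: link_rhs_def)
qed

section \<open>A priori bounds and the maximum principle\<close>

context positive_discrete_system
begin

lemma U_pos: "U n > 0"
  using G_pos \<alpha>_gt by (simp add: U_def)

lemma S_add': "S (Suc n) + S n = link_rhs G (U n + G / 2) (\<eta> n)"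
  by (simp add: S_add link_rhs_def)

lemma S_sq_gt: "(S n)\<^sup>2 > G\<^sup>2"
  using S_gt[of n] G_pos by (intro power_strict_mono) auto

lemma \<eta>_add': "\<eta> (Suc n) + \<eta> n = node_rhs G \<alpha> (U (Suc n)) (S (Suc n))"
  using \<eta>_add[of n] S_sq_gt[of "Suc n"] by (simp add: node_rhs_def field_simps)

lemma S_pos: "S n > 0"
  using S_gt[of n] G_pos by simp

lemma \<eta>_lower: obtains c where "c > 0" "\<And>n. \<eta> n \<ge> c"
proof -
  define c where "c = min 1 (G / (1 + \<bar>\<alpha>\<bar> / 2))"
  have "\<eta> n \<ge> c" for n
  proof (cases "\<eta> n \<ge> 1")
    case False
    have "G \<le> (\<eta> n)\<^sup>2 - \<alpha> / 2 * \<eta> n" using \<eta>_quadratic[of n] by simp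
    also have "\<dots> \<le> 1 * \<eta> n + \<bar>\<alpha>\<bar> / 2 * \<eta> n"
    proof -
      have "(\<eta> n)\<^sup>2 \<le> 1 * \<eta> n" unfolding power2_eq_square
        using False \<eta>_pos[of n] by (intro mult_right_mono) auto
      moreover have "- \<alpha> / 2 * \<eta> n \<le> \<bar>\<alpha>\<bar> / 2 * \<eta> n"
        using \<eta>_pos[of n] by (intro mult_right_mono) auto
      ultimately show ?thesis by simp
    qed
    finally have "G \<le> \<eta> n * (1 + \<bar>\<alpha>\<bar> / 2)" by (simp add: algebra_simps)
    moreover have "1 + \<bar>\<alpha>\<bar> / 2 > 0" by simp
    ultimately have "G / (1 + \<bar>\<alpha>\<bar> / 2) \<le> \<eta> n" by (simp only: pos_divide_le_eq)
    then show ?thesis by (simp add: c_def)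
  qed (simp add: c_def)
  moreover have "c > 0" using G_pos by (auto simp: c_def)
  ultimately show ?thesis using that by blast
qed

text \<open>For positive \<open>\<alpha>\<close> the quadratic bound gives \<open>\<eta> > \<alpha>/2\<close>, and this is exactly what keeps \<open>S\<close>
  in the range where \<^const>\<open>node_rhs\<close> falls faster than the reciprocal under scaling.\<close>

lemma S_less: "\<alpha> * S (Suc n) < 2 * U (Suc n)"
proof (cases "\<alpha> > 0")
  case True
  have "\<eta> m > \<alpha> / 2" for m
  proof -
    have "\<eta> m * \<eta> m > \<alpha> / 2 * \<eta> m"
      using \<eta>_quadratic[of m] G_pos by (simp add: power2_eq_square)
    then show ?thesis using \<eta>_pos[of m] by (simp only: mult_less_cancel_right_pos)
  qed
  from this[of n] this[of "Suc n"] have "\<alpha> < \<eta> (Suc n) + \<eta> n" by simp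
  then have "\<alpha> * ((S (Suc n))\<^sup>2 - G\<^sup>2) < (\<eta> (Suc n) + \<eta> n) * ((S (Suc n))\<^sup>2 - G\<^sup>2)"
    using S_sq_gt[of "Suc n"] by (intro mult_strict_right_mono) auto
  then have "(\<alpha> * S (Suc n)) * S (Suc n) < (2 * U (Suc n)) * S (Suc n)"
    unfolding \<eta>_add by (simp add: algebra_simps power2_eq_square)
  then show ?thesis using S_pos[of "Suc n"] by (simp only: mult_less_cancel_right_pos)
next
  case False
  then have "\<alpha> * S (Suc n) \<le> 0" using S_pos[of "Suc n"] by (simp add: mult_nonpos_nonneg)
  then show ?thesis using U_pos[of "Suc n"] by simp
qed

text \<open>A positive lower bound for \<eta> makes \<open>\<eta>_add\<close> a quadratic inequality
  in \<open>S\<close> whose linear term has a coefficient of size \<open>U\<close>, so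
  \<open>S\<close> grows at most linearly.\<close>

lemma S_growth: obtains C where "C > 0" "\<And>n. S (Suc n) \<le> C * (U (Suc n) + 1)"
proof -
  obtain c where c: "c > 0" "\<And>n. \<eta> n \<ge> c" using \<eta>_lower by blast
  define C where "C = 1 / c + (\<bar>\<alpha>\<bar> * G + 2 * c * G) / (2 * c)"
  have "S (Suc n) \<le> C * (U (Suc n) + 1)" for n
  proof -
    let ?s = "S (Suc n)" and ?u = "U (Suc n)"
    have "2 * c * (?s\<^sup>2 - G\<^sup>2) \<le> (\<eta> (Suc n) + \<eta> n) * (?s\<^sup>2 - G\<^sup>2)"
      using c(2)[of n] c(2)[of "Suc n"] S_sq_gt[of "Suc n"] by (intro mult_right_mono) auto
    also have "\<dots> = 2 * ?u * ?s - \<alpha> * G\<^sup>2" by (rule \<eta>_add)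
    also have "\<dots> \<le> 2 * ?u * ?s + \<bar>\<alpha>\<bar> * G\<^sup>2"
    proof -
      have "- \<alpha> * G\<^sup>2 \<le> \<bar>\<alpha>\<bar> * G\<^sup>2" by (intro mult_right_mono) auto
      then show ?thesis by simp
    qed
    finally have "2 * c * ?s\<^sup>2 \<le> 2 * ?u * ?s + (\<bar>\<alpha>\<bar> + 2 * c) * G\<^sup>2" by (simp add: algebra_simps)
    also have "(\<bar>\<alpha>\<bar> + 2 * c) * G\<^sup>2 \<le> (\<bar>\<alpha>\<bar> + 2 * c) * (G * ?s)"
      unfolding power2_eq_square using c G_pos S_gt[of "Suc n"] by (intro mult_left_mono) auto
    finally have "(2 * c * ?s) * ?s \<le> (2 * ?u + (\<bar>\<alpha>\<bar> + 2 * c) * G) * ?s"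
      by (simp add: algebra_simps power2_eq_square)
    then have "2 * c * ?s \<le> 2 * ?u + (\<bar>\<alpha>\<bar> + 2 * c) * G"
      using S_pos[of "Suc n"] by (simp only: mult_le_cancel_right_pos)
    then have "?s \<le> (2 * ?u + (\<bar>\<alpha>\<bar> + 2 * c) * G) / (2 * c)"
      using c(1) by (simp add: pos_le_divide_eq mult_ac)
    also have "\<dots> = 1 / c * ?u + (\<bar>\<alpha>\<bar> * G + 2 * c * G) / (2 * c) * 1"
      using c(1) by (simp add: field_simps)
    also have "\<dots> \<le> C * ?u + C * 1"
      using c(1) G_pos U_pos[of "Suc n"]
      by (intro add_mono mult_right_mono) (auto simp: C_def)
    finally show ?thesis by (simp add: algebra_simps)
  qed
  moreover have "C > 0" using c(1) G_pos by (auto simp: C_def intro!: add_pos_nonneg)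
  ultimately show ?thesis using that by blast
qed

text \<open>An upper barrier \<open>B\<close> for \<open>S\<close> goes with a lower barrier
  \<open>Y\<close> for \<eta>, because each right-hand side reverses order; hence the inverted ratio
  Y / \<eta> in \<open>Q\<close>. If the largest ratio exceeds 1, the equation at the site where it
  is attained bounds it by the neighbouring ratios, against the strict scaling inequality. The
  boundary data exclude the end nodes, and every link has both its nodes in the range.\<close>

lemma upper_comparison:
  assumes B: "\<And>n. m \<le> n \<Longrightarrow> n \<le> N \<Longrightarrow> B n > G"
    and Y: "\<And>n. m \<le> n \<Longrightarrow> n < N \<Longrightarrow> Y n > 0"
    and link: "\<And>n. m \<le> n \<Longrightarrow> n < N \<Longrightarrow> B (Suc n) + B n \<le> link_rhs G (U n + G / 2) (Y n)"
    and node: "\<And>n. m \<le> n \<Longrightarrow> Suc n < N \<Longrightarrow> node_rhs G \<alpha> (U (Suc n)) (B (Suc n)) \<le> Y (Suc n) + Y n"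
    and bd: "S m \<le> B m" "S N \<le> B N" and mN: "m \<le> N"
  shows "(\<forall>n\<in>{m..N}. S n \<le> B n) \<and> (\<forall>n\<in>{m..<N}. Y n \<le> \<eta> n)"
proof -
  define Q where "Q = (\<lambda>n. S n / B n) ` {m..N} \<union> (\<lambda>n. Y n / \<eta> n) ` {m..<N}"
  define l where "l = Max Q"
  have fin: "finite Q" "Q \<noteq> {}" using mN by (auto simp: Q_def)
  have B0: "B n > 0" if "m \<le> n" "n \<le> N" for n using B[OF that] G_pos by simp
  have Sl: "S n \<le> l * B n" if "m \<le> n" "n \<le> N" for n
  proof -
    have "S n / B n \<le> l" unfolding l_def using fin that by (intro Max_ge) (auto simp: Q_def)
    then show ?thesis using B0[OF that] by (simp add: pos_divide_le_eq)
  qed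
  have Yl: "Y n \<le> l * \<eta> n" if "m \<le> n" "n < N" for n
  proof -
    have "Y n / \<eta> n \<le> l" unfolding l_def using fin that by (intro Max_ge) (auto simp: Q_def)
    then show ?thesis using \<eta>_pos[of n] by (simp add: pos_divide_le_eq)
  qed
  have "l \<le> 1"
  proof (rule ccontr)
    assume "\<not> l \<le> 1"
    then have l: "l > 1" by simp
    have "l \<in> Q" unfolding l_def using fin by (rule Max_in)
    then consider n where "m \<le> n" "n \<le> N" "l = S n / B n"
      | n where "m \<le> n" "n < N" "l = Y n / \<eta> n" unfolding Q_def by auto
    then show False
    proof cases
      case (1 n)
      have Sn: "S n = l * B n" using 1(3) B0[OF 1(1,2)] by simp
      have "1 * B n < l * B n" using l B0[OF 1(1,2)] by (rule mult_strict_right_mono)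
      then have "B n < S n" using Sn by simp
      then have "n \<noteq> m" "n \<noteq> N" using bd by auto
      then have "m < n" "n < N" using 1 by auto
      then obtain j where j: "n = Suc j" "m \<le> j" "Suc j < N" by (cases n) auto
      \<comment> \<open>The range condition is known for \<open>S\<close> and passes down to
        \<open>B\<close>, since \<open>S n = l * B n\<close> exceeds \<open>B n\<close> at this
        node.\<close>
      have "\<alpha> * B n < 2 * U n"
      proof (cases "\<alpha> > 0")
        case True
        have "\<alpha> * B n \<le> \<alpha> * (l * B n)"
          using True \<open>1 * B n < l * B n\<close> by (intro mult_left_mono) auto
        also have "\<dots> < 2 * U n" using S_less[of j] Sn j by simp
        finally show ?thesis .
      next
        case False
        then have "\<alpha> * B n \<le> 0" using B0[OF 1(1,2)] by (simp add: mult_nonpos_nonneg)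
        then show ?thesis using U_pos[of n] by simp
      qed
      then have "l * node_rhs G \<alpha> (U n) (l * B n) < node_rhs G \<alpha> (U n) (B n)"
        using G_pos U_pos[of n] B[OF 1(1,2)] l \<open>\<alpha> * B n < 2 * U n\<close>
            by (intro node_rhs_scale_less) auto
      also have "\<dots> \<le> Y n + Y j" using node[of j] j by simp
      also have "\<dots> \<le> l * \<eta> n + l * \<eta> j" using Yl[of n] Yl[of j] j by simp
      also have "\<dots> = l * node_rhs G \<alpha> (U n) (l * B n)"
        unfolding distrib_left[symmetric] using \<eta>_add'[of j] j Sn by simp
      finally show False by simp
    next
      case (2 n)
      have Yn: "Y n = l * \<eta> n" using 2(3) \<eta>_pos[of n] by simp
      have "B (Suc n) + B n \<le> link_rhs G (U n + G / 2) (l * \<eta> n)" using link[OF 2(1,2)] Yn by simp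
      then have "l * (B (Suc n) + B n) \<le> l * link_rhs G (U n + G / 2) (l * \<eta> n)"
        using l by simp
      also have "\<dots> < link_rhs G (U n + G / 2) (\<eta> n)"
        using G_pos \<eta>_pos l by (rule link_rhs_scale_less)
      also have "\<dots> = S (Suc n) + S n" by (rule S_add'[symmetric])
      also have "\<dots> \<le> l * (B (Suc n) + B n)"
        using Sl[of n] Sl[of "Suc n"] 2(1,2) by (simp add: algebra_simps)
      finally show False by simp
    qed
  qed
  have "S n \<le> B n" if "m \<le> n" "n \<le> N" for n
    using Sl[OF that] mult_right_mono[OF \<open>l \<le> 1\<close>, of "B n"] B0[OF that] by linarith
  moreover have "Y n \<le> \<eta> n" if "m \<le> n" "n < N" for n
    using Yl[OF that] mult_right_mono[OF \<open>l \<le> 1\<close>, of "\<eta> n"] \<eta>_pos[of n] by linarith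
  ultimately show ?thesis by auto
qed

text \<open>The mirror image, with the scaling inequality now applied to the true \<open>S\<close>
  at nodes. A lower barrier may fall below \<open>G\<close>; the node inequality is required only
  above \<open>G\<close>, and a node with B = l S and l > 1 lies there because S > G.\<close>

lemma lower_comparison:
  assumes B: "\<And>n. m \<le> n \<Longrightarrow> n \<le> N \<Longrightarrow> B n > 0"
    and Y: "\<And>n. m \<le> n \<Longrightarrow> n < N \<Longrightarrow> Y n > 0"
    and link: "\<And>n. m \<le> n \<Longrightarrow> n < N \<Longrightarrow> link_rhs G (U n + G / 2) (Y n) \<le> B (Suc n) + B n"
    and node: "\<And>n. m \<le> n \<Longrightarrow> Suc n < N \<Longrightarrow> B (Suc n) > G \<Longrightarrow>
      Y (Suc n) + Y n \<le> node_rhs G \<alpha> (U (Suc n)) (B (Suc n))"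
    and bd: "B m \<le> S m" "B N \<le> S N" and mN: "m \<le> N"
  shows "(\<forall>n\<in>{m..N}. B n \<le> S n) \<and> (\<forall>n\<in>{m..<N}. \<eta> n \<le> Y n)"
proof -
  define Q where "Q = (\<lambda>n. B n / S n) ` {m..N} \<union> (\<lambda>n. \<eta> n / Y n) ` {m..<N}"
  define l where "l = Max Q"
  have fin: "finite Q" "Q \<noteq> {}" using mN by (auto simp: Q_def)
  have Sl: "B n \<le> l * S n" if "m \<le> n" "n \<le> N" for n
  proof -
    have "B n / S n \<le> l" unfolding l_def using fin that by (intro Max_ge) (auto simp: Q_def)
    then show ?thesis using S_pos[of n] by (simp add: pos_divide_le_eq)
  qed
  have Yl: "\<eta> n \<le> l * Y n" if "m \<le> n" "n < N" for n
  proof -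
    have "\<eta> n / Y n \<le> l" unfolding l_def using fin that by (intro Max_ge) (auto simp: Q_def)
    then show ?thesis using Y[OF that] by (simp add: pos_divide_le_eq)
  qed
  have "l \<le> 1"
  proof (rule ccontr)
    assume "\<not> l \<le> 1"
    then have l: "l > 1" by simp
    have "l \<in> Q" unfolding l_def using fin by (rule Max_in)
    then consider n where "m \<le> n" "n \<le> N" "l = B n / S n"
      | n where "m \<le> n" "n < N" "l = \<eta> n / Y n" unfolding Q_def by auto
    then show False
    proof cases
      case (1 n)
      have Bn: "B n = l * S n" using 1(3) S_pos[of n] by simp
      have Sl': "1 * S n < l * S n" using l S_pos by (rule mult_strict_right_mono)
      then have "S n < B n" using Bn by simp
      then have "n \<noteq> m" "n \<noteq> N" using bd by auto
      then have "m < n" "n < N" using 1 by auto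
      then obtain j where j: "n = Suc j" "m \<le> j" "Suc j < N" by (cases n) auto
      have BG: "B n > G" using S_gt[of n] Bn Sl' by linarith
      have "l * (Y n + Y j) \<le> l * node_rhs G \<alpha> (U n) (l * S n)"
        using node[of j] j BG Bn l by simp
      also have "\<dots> < node_rhs G \<alpha> (U n) (S n)"
        using G_pos U_pos[of n] S_gt[of n] S_less[of j] j l by (intro node_rhs_scale_less) auto
      also have "\<dots> = \<eta> n + \<eta> j" using \<eta>_add'[of j] j by simp
      also have "\<dots> \<le> l * (Y n + Y j)" using Yl[of n] Yl[of j] j by (simp add: algebra_simps)
      finally show False by simp
    next
      case (2 n)
      have Yn: "\<eta> n = l * Y n" using 2(3) Y[OF 2(1,2)] by simp
      have "S (Suc n) + S n = link_rhs G (U n + G / 2) (l * Y n)" using S_add'[of n] Yn by simp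
      then have "l * (S (Suc n) + S n) = l * link_rhs G (U n + G / 2) (l * Y n)" by simp
      also have "\<dots> < link_rhs G (U n + G / 2) (Y n)"
        using G_pos Y[OF 2(1,2)] l by (intro link_rhs_scale_less) auto
      also have "\<dots> \<le> B (Suc n) + B n" using link[OF 2(1,2)] by simp
      also have "\<dots> \<le> l * (S (Suc n) + S n)"
        using Sl[of n] Sl[of "Suc n"] 2(1,2) by (simp add: algebra_simps)
      finally show False by simp
    qed
  qed
  have "B n \<le> S n" if "m \<le> n" "n \<le> N" for n
    using Sl[OF that] mult_right_mono[OF \<open>l \<le> 1\<close>, of "S n"] S_pos[of n] by linarith
  moreover have "\<eta> n \<le> Y n" if "m \<le> n" "n < N" for n
    using Yl[OF that] mult_right_mono[OF \<open>l \<le> 1\<close>, of "Y n"] Y[OF that] by linarith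
  ultimately show ?thesis by auto
qed

end

section \<open>Inequalities for barriers\<close>

text \<open>\<open>W\<close>, \<open>W1\<close>, \<open>W2\<close> are the values of a slowly varying weight at \<open>x\<^sup>3\<close> and at its two neighbours.
  The scaling behaviour of the right-hand sides gains a relative amount of order \<open>x\<^sup>-\<^sup>4\<close> times \<open>W\<close>, whereas the variation of the
  weight costs only \<open>x\<^sup>-\<^sup>6\<close> times \<open>W\<close>.\<close>

locale slow_weight =
  fixes c x W W1 W2 :: real
  assumes c_ge: "c \<ge> 1" and x_pos: "x > 0" and x_cube: "x ^ 3 \<ge> 2 * c" and W_pos: "W > 0"
    and W1: "\<bar>W1 - W\<bar> \<le> c * W / x ^ 3" and W2: "\<bar>W2 - W\<bar> \<le> c * W / x ^ 3"
    and W_second: "\<bar>W1 + W2 - 2 * W\<bar> \<le> c * W / x ^ 6"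
begin

lemma c_le_sq: "c \<le> c\<^sup>2"
  using mult_right_mono[of 1 c c] c_ge by (simp add: power2_eq_square)

lemma V_half: "1 + W1 \<ge> (1 + W) / 2" "1 + W2 \<ge> (1 + W) / 2"
proof -
  define z where "z = c * W / x ^ 3"
  have "(2 * c) * W \<le> x ^ 3 * W" using x_cube W_pos by (intro mult_right_mono) auto
  then have "z \<le> W / 2" using x_pos by (simp add: z_def pos_divide_le_eq mult.commute)
  then show "1 + W1 \<ge> (1 + W) / 2" "1 + W2 \<ge> (1 + W) / 2"
    using W1 W2 W_pos unfolding z_def[symmetric] abs_le_iff by (simp_all add: field_simps)
qed

text \<open>Writing a weighted sum of two nearly equal terms in terms of their mean and difference exposes
  the second difference of the weight.\<close>

lemma sum_diff_bound:
  fixes f1 f2 a b A p q :: real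
  assumes f: "0 \<le> f1" "0 \<le> f2" "f1 \<le> A" "f2 \<le> A" "\<bar>f1 - f2\<bar> \<le> A / x ^ 3"
    and "\<bar>a + b\<bar> \<le> p" "\<bar>a - b\<bar> \<le> 2 * q"
  shows "f1 * a + f2 * b \<le> A * p + A / x ^ 3 * q"
proof -
  have "f1 * a + f2 * b = (f1 + f2) / 2 * (a + b) + (f1 - f2) / 2 * (a - b)"
    by (simp add: field_simps)
  also have "(f1 + f2) / 2 * (a + b) \<le> A * p"
  proof (rule order.trans[OF abs_ge_self])
    have "\<bar>(f1 + f2) / 2\<bar> \<le> A" using f by simp
    then show "\<bar>(f1 + f2) / 2 * (a + b)\<bar> \<le> A * p"
      unfolding abs_mult using assms(6) f(1,3) by (intro mult_mono) auto
  qed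
  also have "(f1 - f2) / 2 * (a - b) \<le> (A / x ^ 3 / 2) * (2 * q)"
  proof (rule order.trans[OF abs_ge_self])
    have "\<bar>(f1 - f2) / 2\<bar> \<le> A / x ^ 3 / 2" using f(5) by simp
    then show "\<bar>(f1 - f2) / 2 * (a - b)\<bar> \<le> (A / x ^ 3 / 2) * (2 * q)"
      unfolding abs_mult using assms(7) f(1,3) x_pos by (intro mult_mono) auto
  qed
  finally show ?thesis by simp
qed

text \<open>The first-order change of the weight cancels up to its second difference, except where
  it meets \<open>f1 - f2\<close>; both contributions have relative size x^(-6).\<close>

lemma weighted_sum_le:
  assumes f: "0 \<le> f1" "0 \<le> f2" "f1 \<le> A" "f2 \<le> A" "\<bar>f1 - f2\<bar> \<le> A / x ^ 3"
  shows "f1 * (1 + W1) + f2 * (1 + W2) \<le> (f1 + f2) * (1 + W) + 2 * c * A * W / x ^ 6"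
proof -
  have "f1 * (W1 - W) + f2 * (W2 - W) \<le> A * (c * W / x ^ 6) + A / x ^ 3 * (c * W / x ^ 3)"
  proof (rule sum_diff_bound[OF f])
    show "\<bar>W1 - W + (W2 - W)\<bar> \<le> c * W / x ^ 6" using W_second by (simp add: algebra_simps)
    show "\<bar>W1 - W - (W2 - W)\<bar> \<le> 2 * (c * W / x ^ 3)" using W1 W2 by linarith
  qed
  also have "A / x ^ 3 * (c * W / x ^ 3) = A * (c * W / x ^ 6)" by simp
  finally show ?thesis by (simp add: algebra_simps)
qed

text \<open>The error is measured by W / (1 + W) rather than by W, because W contains a growing term
  and is not small everywhere; the gain in the divided inequalities has the same form.\<close>

lemma weighted_quotient_ge:
  assumes f: "0 \<le> f1" "0 \<le> f2" "f1 \<le> A" "f2 \<le> A" "\<bar>f1 - f2\<bar> \<le> A / x ^ 3"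
  shows "(1 + W) * (f1 / (1 + W1) + f2 / (1 + W2)) \<ge> f1 + f2 - 12 * c\<^sup>2 * A * (W / (1 + W)) / x ^ 6"
proof -
  define V where "V = 1 + W"
  define q1 q2 where "q1 = (W1 - W) / (1 + W1)" and "q2 = (W2 - W) / (1 + W2)"
  have V: "V > 0" "W \<le> V" using W_pos by (simp_all add: V_def)
  have V12: "1 + W1 \<ge> V / 2" "1 + W2 \<ge> V / 2" using V_half by (simp_all add: V_def)
  then have V12p: "1 + W1 > 0" "1 + W2 > 0" using V by linarith+
  define z where "z = c * W / x ^ 3"
  have z: "z \<ge> 0" using c_ge W_pos x_pos by (simp add: z_def)
  have q: "\<bar>q1\<bar> \<le> z / (V / 2)" "\<bar>q2\<bar> \<le> z / (V / 2)"
    unfolding q1_def q2_def abs_divide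
    by (intro frac_le; use V12 V W1[folded z_def] W2[folded z_def] z in linarith)+
  \<comment> \<open>One term with the second difference and one product of two first differences, so
    that no single first difference is left.\<close>
  have "q1 + q2 = (W1 + W2 - 2 * W) / (1 + W1) + (W2 - W) * (W1 - W2) / ((1 + W1) * (1 + W2))"
    using V12p by (simp add: q1_def q2_def divide_simps) (simp add: algebra_simps)
  also have "\<bar>\<dots>\<bar> \<le> (c * W / x ^ 6) / (V / 2) + (z * (2 * z)) / ((V / 2) * (V / 2))"
  proof (rule order.trans[OF abs_triangle_ineq], rule add_mono)
    show "\<bar>(W1 + W2 - 2 * W) / (1 + W1)\<bar> \<le> (c * W / x ^ 6) / (V / 2)"
      unfolding abs_divide using V12 V W_second c_ge W_pos by (intro frac_le) auto
    have "\<bar>W1 - W2\<bar> \<le> 2 * z" using W1 W2 unfolding z_def by linarith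
    then have "\<bar>(W2 - W) * (W1 - W2)\<bar> \<le> z * (2 * z)"
      unfolding abs_mult using W2 z by (intro mult_mono) (auto simp: z_def)
    moreover have "(V / 2) * (V / 2) \<le> \<bar>(1 + W1) * (1 + W2)\<bar>"
      unfolding abs_mult using V12 V by (intro mult_mono) auto
    ultimately show "\<bar>(W2 - W) * (W1 - W2) / ((1 + W1) * (1 + W2))\<bar> \<le> (z * (2 * z)) / ((V / 2) * (V
        / 2))"
      unfolding abs_divide using V z by (intro frac_le) auto
  qed
  also have "(z * (2 * z)) / ((V / 2) * (V / 2)) = 8 * c\<^sup>2 * (W / V) * (W / V) / x ^ 6"
    by (simp add: z_def power2_eq_square mult_ac)
  also have "\<dots> \<le> 8 * c\<^sup>2 * (W / V) * 1 / x ^ 6"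
    using V W_pos by (intro divide_right_mono mult_left_mono) auto
  also have "(c * W / x ^ 6) / (V / 2) = 2 * c * (W / V) / x ^ 6"
    by (simp add: mult_ac)
  finally have qq: "\<bar>q1 + q2\<bar> \<le> (2 * c + 8 * c\<^sup>2) * (W / V) / x ^ 6"
    by (simp add: algebra_simps add_divide_distrib)
  have "f1 * q1 + f2 * q2 \<le> A * ((2 * c + 8 * c\<^sup>2) * (W / V) / x ^ 6) + A / x ^ 3 * (z / (V / 2))"
    by (rule sum_diff_bound[OF f qq]) (use q in linarith)
  also have "A / x ^ 3 * (z / (V / 2)) = A * (2 * c * (W / V) / x ^ 6)"
    by (simp add: z_def mult_ac)
  finally have "f1 * q1 + f2 * q2 \<le> A * (4 * c + 8 * c\<^sup>2) * ((W / V) / x ^ 6)"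
    by (simp add: algebra_simps add_divide_distrib)
  also have "\<dots> \<le> A * (12 * c\<^sup>2) * ((W / V) / x ^ 6)"
  proof (intro mult_right_mono mult_left_mono)
    show "4 * c + 8 * c\<^sup>2 \<le> 12 * c\<^sup>2" using c_le_sq by simp
  qed (use f(1,3) V W_pos x_pos in auto)
  finally have fq: "f1 * q1 + f2 * q2 \<le> 12 * c\<^sup>2 * A * (W / V) / x ^ 6" by (simp add: algebra_simps)
  have "V / (1 + W1) = 1 - q1" "V / (1 + W2) = 1 - q2"
    using V12p by (simp_all add: q1_def q2_def V_def field_simps)
  moreover have "V * (f1 / (1 + W1) + f2 / (1 + W2)) = f1 * (V / (1 + W1)) + f2 * (V / (1 + W2))"
    by (simp add: distrib_left mult.commute)
  ultimately have "V * (f1 / (1 + W1) + f2 / (1 + W2)) = f1 * (1 - q1) + f2 * (1 - q2)"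
    by (simp only:)
  then show ?thesis using fq unfolding V_def by (simp add: algebra_simps)
qed

end

text \<open>With u = x^3: \<open>x_sq\<close> lets the gain x^(-4) absorb the variation x^(-6) of
  the weight, \<open>W_ge\<close> lets the gain absorb the residual x^(-11), and \<open>x_7\<close>
  keeps the lower bound for W at most 1, so that W / (1 + W) has half of it as a lower bound. The
  last two assumptions keep the \<alpha> term subordinate and \<open>s\<close> above
  \<open>G\<close>.\<close>

locale barrier_point = slow_weight +
  fixes G \<alpha> :: real
  assumes G_pos: "G > 0"
    and x_sq: "x\<^sup>2 \<ge> 24 * c ^ 6 / G\<^sup>2" and x_7: "x ^ 7 \<ge> 4 * c ^ 4 / G\<^sup>2"
    and W_ge: "W \<ge> 4 * c ^ 4 / G\<^sup>2 / x ^ 7"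
    and x_large: "x \<ge> 2 * \<bar>\<alpha>\<bar> * c" and x_sq': "x\<^sup>2 > c * G"
begin

lemma W_quot: "W / (1 + W) \<ge> 2 * c ^ 4 / G\<^sup>2 / x ^ 7"
proof -
  define y where "y = 4 * c ^ 4 / G\<^sup>2 / x ^ 7"
  have "y \<le> 1"
    unfolding y_def using x_7 x_pos by (simp only: divide_le_eq_1_pos zero_less_power)
  then have y: "0 < y" "y \<le> 1" "y \<le> W"
    using W_ge x_pos c_ge G_pos by (simp_all add: y_def)
  have "y / 2 \<le> y / (1 + y)" using y by (intro divide_left_mono) auto
  also have "\<dots> \<le> W / (1 + W)" using y by (simp add: divide_simps) (simp add: algebra_simps)
  finally show ?thesis by (simp add: y_def)
qed

lemma x_sq_ge:
  assumes "j \<le> 6" "b \<le> 24" "b \<ge> 0"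
  shows "b * c ^ j / x ^ (i + 2) \<le> G\<^sup>2 / x ^ i"
proof -
  have "b * c ^ j \<le> 24 * c ^ 6"
    using assms c_ge by (intro mult_mono power_increasing) auto
  also have "\<dots> \<le> G\<^sup>2 * x\<^sup>2"
    using x_sq G_pos by (simp add: pos_divide_le_eq mult.commute)
  finally have "b * c ^ j / x ^ (i + 2) \<le> (G\<^sup>2 * x\<^sup>2) / x ^ (i + 2)"
    using x_pos by (intro divide_right_mono) auto
  also have "\<dots> = G\<^sup>2 / x ^ i" using x_pos by (simp only: power_add) simp
  finally show ?thesis .
qed

text \<open>Dividing \<eta> by 1 + W raises the right-hand side by 2 G^2 W (1 + W) / e^2 beyond
  proportionality. One half of this gain pays for the residual c / x^9, the other for the variation
  of the weight.\<close>

lemma link_upper: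
  assumes f: "0 \<le> s1" "0 \<le> s2" "s1 \<le> c * x\<^sup>2" "s2 \<le> c * x\<^sup>2" "\<bar>s1 - s2\<bar> \<le> c / x"
    and e: "0 < e" "e \<le> c * x" and res: "s1 + s2 \<le> link_rhs G u e + c / x ^ 9"
  shows "s1 * (1 + W1) + s2 * (1 + W2) \<le> link_rhs G u (e / (1 + W))"
proof -
  let ?V = "1 + W"
  have dA: "c / x = c * x\<^sup>2 / x ^ 3" using x_pos by (simp add: power2_eq_square power3_eq_cube)
  have "s1 * (1 + W1) + s2 * (1 + W2) \<le> (s1 + s2) * ?V + 2 * c * (c * x\<^sup>2) * W / x ^ 6"
    by (rule weighted_sum_le) (use f dA in auto)
  also have "(s1 + s2) * ?V \<le> (link_rhs G u e + c / x ^ 9) * ?V"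
    using res W_pos by (intro mult_right_mono) auto
  also have "2 * c * (c * x\<^sup>2) * W / x ^ 6 = 2 * c\<^sup>2 / x ^ 4 * W"
    using x_pos by (simp add: field_simps eval_nat_numeral)
  finally have 1: "s1 * (1 + W1) + s2 * (1 + W2) \<le>
      link_rhs G u e * ?V + c / x ^ 9 * ?V + 2 * c\<^sup>2 / x ^ 4 * W" by (simp add: algebra_simps)
  have 2: "link_rhs G u (e / ?V) = link_rhs G u e * ?V + 2 * G\<^sup>2 / e\<^sup>2 * (W * ?V)"
  proof -
    have "link_rhs G u (e / ?V) = 2 * u / e * ?V + 2 * G\<^sup>2 / e\<^sup>2 * (?V * ?V)"
      by (simp add: link_rhs_def power2_eq_square)
    also have "?V * ?V = ?V + W * ?V" by (simp add: algebra_simps)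
    finally show ?thesis unfolding link_rhs_def by (simp only: distrib_left distrib_right)
  qed
  have "1 / (c * x)\<^sup>2 \<le> 1 / e\<^sup>2"
    using e x_pos c_ge by (intro divide_left_mono power_mono) auto
  then have "2 * G\<^sup>2 * (1 / (c * x)\<^sup>2) * (W * ?V) \<le> 2 * G\<^sup>2 * (1 / e\<^sup>2) * (W * ?V)"
    using W_pos by (intro mult_right_mono mult_left_mono) auto
  then have gap: "2 * (G\<^sup>2 / (c\<^sup>2 * x\<^sup>2)) * (W * ?V) \<le> 2 * G\<^sup>2 / e\<^sup>2 * (W * ?V)"
    by (simp only: power_mult_distrib times_divide_eq_right mult_1_right)
  have "c / x ^ 9 \<le> G\<^sup>2 / (c\<^sup>2 * x\<^sup>2) * (4 * c ^ 4 / G\<^sup>2 / x ^ 7)"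
  proof -
    have "G\<^sup>2 / (c\<^sup>2 * x\<^sup>2) * (4 * c ^ 4 / G\<^sup>2 / x ^ 7) = 4 * c\<^sup>2 / x ^ 9"
      using G_pos c_ge x_pos by (simp add: field_simps eval_nat_numeral)
    moreover have "c \<le> 4 * c\<^sup>2" using c_le_sq c_ge by simp
    ultimately show ?thesis using x_pos by (simp add: divide_right_mono)
  qed
  also have "\<dots> \<le> G\<^sup>2 / (c\<^sup>2 * x\<^sup>2) * W" using W_ge by (intro mult_left_mono) auto
  finally have 3: "c / x ^ 9 * ?V \<le> G\<^sup>2 / (c\<^sup>2 * x\<^sup>2) * (W * ?V)"
    unfolding mult.assoc[symmetric] using W_pos by (intro mult_right_mono) auto
  have "2 * c ^ 4 / x ^ (2 + 2) \<le> G\<^sup>2 / x ^ 2" by (rule x_sq_ge) auto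
  then have "2 * c ^ 4 / x ^ 4 / c\<^sup>2 \<le> G\<^sup>2 / x\<^sup>2 / c\<^sup>2"
    by (intro divide_right_mono) auto
  then have "2 * c\<^sup>2 / x ^ 4 \<le> G\<^sup>2 / (c\<^sup>2 * x\<^sup>2)"
    using c_ge x_pos by (simp add: field_simps eval_nat_numeral)
  then have "2 * c\<^sup>2 / x ^ 4 * W \<le> G\<^sup>2 / (c\<^sup>2 * x\<^sup>2) * (W * ?V)"
    using W_pos by (intro mult_mono) auto
  note 4 = this
  have "l \<le> r" if "l \<le> a + b + d" "r = a + g" "b \<le> p * w" "2 * p * w \<le> g" "d \<le> p * w"
    for l r a b d g p w :: real using that by simp
  from this[OF 1 2 3 gap 4] show ?thesis .
qed

text \<open>After multiplication by 1 + W the gain is 2 G^2 / e^2 times W / (1 + W), which again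
  covers residual and variation; the lower bound \<open>W_quot\<close> takes the place of
  \<open>W_ge\<close>.\<close>

lemma link_lower:
  assumes f: "0 \<le> s1" "0 \<le> s2" "s1 \<le> c * x\<^sup>2" "s2 \<le> c * x\<^sup>2" "\<bar>s1 - s2\<bar> \<le> c / x"
    and e: "0 < e" "e \<le> c * x" and res: "s1 + s2 \<ge> link_rhs G u e - c / x ^ 9"
  shows "link_rhs G u (e * (1 + W)) \<le> s1 / (1 + W1) + s2 / (1 + W2)"
proof -
  let ?V = "1 + W"
  let ?w = "W / ?V"
  have w: "?w > 0" "?w = 1 - 1 / ?V" using W_pos by (auto simp: field_simps)
  have dA: "c / x = c * x\<^sup>2 / x ^ 3" using x_pos by (simp add: power2_eq_square power3_eq_cube)
  have "s1 + s2 - 12 * c\<^sup>2 * (c * x\<^sup>2) * ?w / x ^ 6 \<le> ?V * (s1 / (1 + W1) + s2 / (1 + W2))"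
    by (rule weighted_quotient_ge) (use f dA in auto)
  moreover have eq12: "12 * c\<^sup>2 * (c * x\<^sup>2) * w / x ^ 6 = 12 * c ^ 3 / x ^ 4 * w" for w
    using x_pos by (simp add: field_simps eval_nat_numeral)
  ultimately have 1: "link_rhs G u e - c / x ^ 9 - 12 * c ^ 3 / x ^ 4 * ?w
      \<le> ?V * (s1 / (1 + W1) + s2 / (1 + W2))"
    using res unfolding eq12 by linarith
  have 2: "?V * link_rhs G u (e * ?V) = link_rhs G u e - 2 * G\<^sup>2 / e\<^sup>2 * ?w"
  proof -
    have "?V * link_rhs G u (e * ?V) = ?V * (2 * u / (e * ?V)) + ?V * (2 * G\<^sup>2 / (e * ?V)\<^sup>2)"
      by (simp only: link_rhs_def distrib_left)
    also have "?V * (2 * u / (e * ?V)) = 2 * u / e" using W_pos by simp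
    also have "?V * (2 * G\<^sup>2 / (e * ?V)\<^sup>2) = 2 * G\<^sup>2 / e\<^sup>2 * (1 / ?V)"
      using W_pos by (simp add: power2_eq_square)
    finally show ?thesis unfolding w(2) link_rhs_def by (simp only: right_diff_distrib mult_1_right)
  qed
  have "1 / (c * x)\<^sup>2 \<le> 1 / e\<^sup>2"
    using e x_pos c_ge by (intro divide_left_mono power_mono) auto
  then have "2 * G\<^sup>2 * (1 / (c * x)\<^sup>2) * ?w \<le> 2 * G\<^sup>2 * (1 / e\<^sup>2) * ?w"
    using w(1) by (intro mult_right_mono mult_left_mono) auto
  then have gap: "2 * (G\<^sup>2 / (c\<^sup>2 * x\<^sup>2)) * ?w \<le> 2 * G\<^sup>2 / e\<^sup>2 * ?w"
    by (simp only: power_mult_distrib times_divide_eq_right mult_1_right)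
  have "c / x ^ 9 \<le> G\<^sup>2 / (c\<^sup>2 * x\<^sup>2) * (2 * c ^ 4 / G\<^sup>2 / x ^ 7)"
  proof -
    have "G\<^sup>2 / (c\<^sup>2 * x\<^sup>2) * (2 * c ^ 4 / G\<^sup>2 / x ^ 7) = 2 * c\<^sup>2 / x ^ 9"
      using G_pos c_ge x_pos by (simp add: field_simps eval_nat_numeral)
    moreover have "c \<le> 2 * c\<^sup>2" using c_le_sq c_ge by simp
    ultimately show ?thesis using x_pos by (simp add: divide_right_mono)
  qed
  also have "\<dots> \<le> G\<^sup>2 / (c\<^sup>2 * x\<^sup>2) * ?w" using W_quot by (intro mult_left_mono) auto
  finally have 3: "c / x ^ 9 \<le> G\<^sup>2 / (c\<^sup>2 * x\<^sup>2) * ?w" .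
  have "12 * c ^ 5 / x ^ (2 + 2) \<le> G\<^sup>2 / x ^ 2" by (rule x_sq_ge) auto
  then have "12 * c ^ 5 / x ^ 4 / c\<^sup>2 \<le> G\<^sup>2 / x\<^sup>2 / c\<^sup>2"
    by (intro divide_right_mono) auto
  then have "12 * c ^ 3 / x ^ 4 \<le> G\<^sup>2 / (c\<^sup>2 * x\<^sup>2)"
    using c_ge x_pos by (simp add: field_simps eval_nat_numeral)
  then have "12 * c ^ 3 / x ^ 4 * ?w \<le> G\<^sup>2 / (c\<^sup>2 * x\<^sup>2) * ?w"
    using w(1) by (intro mult_right_mono) auto
  with 1 2 3 gap have "?V * link_rhs G u (e * ?V) \<le> ?V * (s1 / (1 + W1) + s2 / (1 + W2))"
    by linarith
  then show ?thesis using W_pos by (simp only: mult_le_cancel_left_pos)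
qed

text \<open>A quantitative form of the scaling gain: the bracket is at least x^3 s G, half of its
  main part, and the denominator is at most s^4. With \<open>s\<close> of size x^2 this is of order
  x^(-3), relative order x^(-4) against a right-hand side of order x.\<close>

lemma node_gap:
  assumes s: "x\<^sup>2 / c \<le> s" "s \<le> c * x\<^sup>2" and \<sigma>: "0 \<le> \<sigma>" "\<sigma> < s"
  shows "G\<^sup>2 / (c ^ 3 * x ^ 3) \<le> G * ((2 * x ^ 3 * s * (G + \<sigma>) - \<alpha> * G * (s\<^sup>2 + G * \<sigma>))
     / ((s\<^sup>2 - G\<^sup>2) * (s\<^sup>2 - \<sigma>\<^sup>2)))"
proof -
  let ?K = "2 * x ^ 3 * s * (G + \<sigma>) - \<alpha> * G * (s\<^sup>2 + G * \<sigma>)"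
  have "G < x\<^sup>2 / c" using x_sq' c_ge by (simp add: pos_less_divide_eq mult.commute)
  then have Gs: "G < s" and s_pos: "s > 0" using s G_pos by linarith+
  have sq: "G\<^sup>2 < s\<^sup>2" "\<sigma>\<^sup>2 < s\<^sup>2" using Gs \<sigma> G_pos by (auto intro!: power_strict_mono)
  have "2 * \<bar>\<alpha>\<bar> * s \<le> 2 * \<bar>\<alpha>\<bar> * (c * x\<^sup>2)" using s by (intro mult_left_mono) auto
  also have "\<dots> \<le> x * x\<^sup>2" using mult_right_mono[OF x_large, of "x\<^sup>2"] by (simp add: mult.assoc)
  finally have as: "2 * \<bar>\<alpha>\<bar> * s \<le> x ^ 3" by (simp add: eval_nat_numeral)
  have "G * \<sigma> \<le> s * s" using Gs \<sigma> G_pos by (intro mult_mono) auto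
  then have "\<alpha> * (G * (s\<^sup>2 + G * \<sigma>)) \<le> \<bar>\<alpha>\<bar> * (G * (2 * s\<^sup>2))"
    using G_pos \<sigma> by (intro mult_mono) (auto simp: power2_eq_square)
  also have "\<dots> = 2 * \<bar>\<alpha>\<bar> * s * (s * G)" by (simp add: power2_eq_square)
  also have "\<dots> \<le> x ^ 3 * (s * G)" using as s_pos G_pos by (intro mult_right_mono) auto
  finally have "\<alpha> * G * (s\<^sup>2 + G * \<sigma>) \<le> x ^ 3 * s * G" by (simp add: mult.assoc)
  moreover have "x ^ 3 * s * \<sigma> \<ge> 0" using x_pos s_pos \<sigma> by simp
  ultimately have K: "x ^ 3 * s * G \<le> ?K" by (simp add: algebra_simps)
  have "s ^ 3 \<le> (c * x\<^sup>2) ^ 3" using s s_pos by (intro power_mono) auto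
  then have "x ^ 3 * G / (c * x\<^sup>2) ^ 3 \<le> x ^ 3 * G / s ^ 3"
    using x_pos G_pos s_pos c_ge by (intro divide_left_mono) auto
  moreover have "x ^ 3 * G / (c * x\<^sup>2) ^ 3 = G / (c ^ 3 * x ^ 3)"
    using x_pos by (simp add: field_simps eval_nat_numeral)
  moreover have "x ^ 3 * G / s ^ 3 = x ^ 3 * s * G / (s\<^sup>2 * s\<^sup>2)"
    using s_pos by (simp add: field_simps eval_nat_numeral)
  moreover have "\<dots> \<le> ?K / ((s\<^sup>2 - G\<^sup>2) * (s\<^sup>2 - \<sigma>\<^sup>2))"
  proof (rule frac_le)
    show "(s\<^sup>2 - G\<^sup>2) * (s\<^sup>2 - \<sigma>\<^sup>2) \<le> s\<^sup>2 * s\<^sup>2" using sq by (intro mult_mono) auto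
    show "0 < (s\<^sup>2 - G\<^sup>2) * (s\<^sup>2 - \<sigma>\<^sup>2)" using sq by simp
    have "0 \<le> x ^ 3 * s * G" using x_pos s_pos G_pos by simp
    with K show "0 \<le> ?K" by linarith
  qed (rule K)
  ultimately have "G / (c ^ 3 * x ^ 3) \<le> ?K / ((s\<^sup>2 - G\<^sup>2) * (s\<^sup>2 - \<sigma>\<^sup>2))" by simp
  then have "G * (G / (c ^ 3 * x ^ 3)) \<le> G * (?K / ((s\<^sup>2 - G\<^sup>2) * (s\<^sup>2 - \<sigma>\<^sup>2)))"
    using G_pos by (intro mult_left_mono) auto
  then show ?thesis by (simp add: power2_eq_square)
qed

lemma node_upper:
  assumes f: "0 \<le> e1" "0 \<le> e2" "e1 \<le> c * x" "e2 \<le> c * x" "\<bar>e1 - e2\<bar> \<le> c / x\<^sup>2"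
    and s: "x\<^sup>2 / c \<le> s" "s \<le> c * x\<^sup>2" and res: "e1 + e2 \<ge> node_rhs G \<alpha> (x ^ 3) s - c / x ^ 10"
  shows "node_rhs G \<alpha> (x ^ 3) (s * (1 + W)) \<le> e1 / (1 + W1) + e2 / (1 + W2)"
proof -
  let ?V = "1 + W" and ?N = "node_rhs G \<alpha> (x ^ 3) s"
  let ?w = "W / ?V" and ?\<sigma> = "G / ?V"
  let ?q = "G\<^sup>2 / (c ^ 3 * x ^ 3)"
  have w: "?w > 0" using W_pos by simp
  have "x\<^sup>2 / c > G" using x_sq' c_ge by (simp add: pos_less_divide_eq mult.commute)
  then have Gs: "G < s" and s_pos: "s > 0" using s G_pos by linarith+
  have \<sigma>: "0 \<le> ?\<sigma>" "?\<sigma> \<le> G" using G_pos W_pos by (auto simp: divide_le_eq)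
  then have \<sigma>s: "?\<sigma> < s" using Gs by linarith
  have sq: "s\<^sup>2 \<noteq> G\<^sup>2" "s\<^sup>2 \<noteq> ?\<sigma>\<^sup>2"
    using power_strict_mono[of G s 2] power_strict_mono[of ?\<sigma> s 2] Gs \<sigma> \<sigma>s G_pos by auto
  have "?V * node_rhs G \<alpha> (x ^ 3) (s * ?V) =
      (2 * x ^ 3 * s - \<alpha> * G * ?\<sigma>) / (s\<^sup>2 - ?\<sigma>\<^sup>2)"
    using node_rhs_scale[of ?V G \<alpha> "x ^ 3" s] W_pos by (simp add: mult.commute)
  also have "\<dots> = ?N - (G - ?\<sigma>) * (2 * x ^ 3 * s * (G + ?\<sigma>) - \<alpha> * G * (s\<^sup>2 + G * ?\<sigma>))
     / ((s\<^sup>2 - G\<^sup>2) * (s\<^sup>2 - ?\<sigma>\<^sup>2))"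
    using node_rhs_gap_eq[OF sq, of \<alpha> "x ^ 3"] by linarith
  also have "G - ?\<sigma> = ?w * G" using W_pos by (simp add: field_simps)
  also have "?w * G * (2 * x ^ 3 * s * (G + ?\<sigma>) - \<alpha> * G * (s\<^sup>2 + G * ?\<sigma>))
     / ((s\<^sup>2 - G\<^sup>2) * (s\<^sup>2 - ?\<sigma>\<^sup>2)) = ?w * (G * ((2 * x ^ 3 * s * (G + ?\<sigma>) - \<alpha> * G * (s\<^sup>2 + G * ?\<sigma>))
     / ((s\<^sup>2 - G\<^sup>2) * (s\<^sup>2 - ?\<sigma>\<^sup>2))))"
    by (simp only: mult.assoc times_divide_eq_right)
  also have "?N - \<dots> \<le> ?N - ?w * ?q"
    using node_gap[OF s \<sigma>(1) \<sigma>s] w by (intro diff_left_mono mult_left_mono) auto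
  finally have 1: "?V * node_rhs G \<alpha> (x ^ 3) (s * ?V) \<le> ?N - ?w * ?q" .
  have dA: "c / x\<^sup>2 = c * x / x ^ 3" using x_pos by (simp add: power2_eq_square power3_eq_cube)
  have 2: "e1 + e2 - 12 * c\<^sup>2 * (c * x) * ?w / x ^ 6 \<le> ?V * (e1 / (1 + W1) + e2 / (1 + W2))"
    by (rule weighted_quotient_ge) (use f dA in auto)
  have eq12: "12 * c\<^sup>2 * (c * x) * w / x ^ 6 = w * (12 * c ^ 3 / x ^ 5)" for w
    using x_pos by (simp add: field_simps eval_nat_numeral)
  have "c / x ^ 10 = (2 * c ^ 4 / G\<^sup>2 / x ^ 7) * (?q / 2)"
    using G_pos c_ge x_pos by (simp add: field_simps eval_nat_numeral)
  also have "\<dots> \<le> ?w * (?q / 2)"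
    using W_quot x_pos c_ge by (intro mult_right_mono) auto
  finally have 3: "c / x ^ 10 \<le> ?w * (?q / 2)" .
  have "24 * c ^ 6 / x ^ (3 + 2) \<le> G\<^sup>2 / x ^ 3" by (rule x_sq_ge) auto
  then have "24 * c ^ 6 / x ^ 5 / (2 * c ^ 3) \<le> G\<^sup>2 / x ^ 3 / (2 * c ^ 3)"
    using c_ge by (intro divide_right_mono) auto
  then have "12 * c ^ 3 / x ^ 5 \<le> ?q / 2"
    using c_ge x_pos by (simp add: field_simps eval_nat_numeral)
  then have 4: "?w * (12 * c ^ 3 / x ^ 5) \<le> ?w * (?q / 2)"
    using w by (intro mult_left_mono) auto
  have "a \<le> r" if "a \<le> N - y * q" "b - d \<le> r" "b \<ge> N - z" "z \<le> y * (q / 2)" "d \<le> y * (q / 2)"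
    for a r N q b d y z :: real using that by simp
  from this[OF 1 2[unfolded eq12] res 3 4]
  have "?V * node_rhs G \<alpha> (x ^ 3) (s * ?V) \<le> ?V * (e1 / (1 + W1) + e2 / (1 + W2))" .
  then show ?thesis using W_pos by (simp only: mult_le_cancel_left_pos)
qed

text \<open>Lowering \<open>s\<close> by the factor 1 + W corresponds to \<sigma> = G (1 + W). The
  hypothesis \<open>above\<close> says precisely that \<sigma> < s, which keeps the rescaled
  denominator positive.\<close>

lemma node_lower:
  assumes f: "0 \<le> e1" "0 \<le> e2" "e1 \<le> c * x" "e2 \<le> c * x" "\<bar>e1 - e2\<bar> \<le> c / x\<^sup>2"
    and s: "x\<^sup>2 / c \<le> s" "s \<le> c * x\<^sup>2" and res: "e1 + e2 \<le> node_rhs G \<alpha> (x ^ 3) s + c / x ^ 10"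
    and above: "s / (1 + W) > G"
  shows "e1 * (1 + W1) + e2 * (1 + W2) \<le> node_rhs G \<alpha> (x ^ 3) (s / (1 + W))"
proof -
  let ?V = "1 + W" and ?N = "node_rhs G \<alpha> (x ^ 3) s"
  let ?\<sigma> = "G * ?V"
  let ?q = "G\<^sup>2 / (c ^ 3 * x ^ 3)"
  have V: "?V > 0" "W \<le> W * ?V" using W_pos by simp_all
  have "x\<^sup>2 / c > G" using x_sq' c_ge by (simp add: pos_less_divide_eq mult.commute)
  then have Gs: "G < s" and s_pos: "s > 0" using s G_pos by linarith+
  have \<sigma>: "0 \<le> ?\<sigma>" "?\<sigma> < s" using G_pos V above by (auto simp: pos_less_divide_eq)
  have sq: "s\<^sup>2 \<noteq> G\<^sup>2" "s\<^sup>2 \<noteq> ?\<sigma>\<^sup>2"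
    using power_strict_mono[of G s 2] power_strict_mono[of ?\<sigma> s 2] Gs \<sigma> G_pos by auto
  have "1 / ?V * node_rhs G \<alpha> (x ^ 3) (1 / ?V * s) =
      (2 * x ^ 3 * s - \<alpha> * G * (G / (1 / ?V))) / (s\<^sup>2 - (G / (1 / ?V))\<^sup>2)"
    by (rule node_rhs_scale) (use V in auto)
  then have "1 / ?V * node_rhs G \<alpha> (x ^ 3) (s / ?V) = (2 * x ^ 3 * s - \<alpha> * G * ?\<sigma>) / (s\<^sup>2 - ?\<sigma>\<^sup>2)"
    by simp
  then have "node_rhs G \<alpha> (x ^ 3) (s / ?V) = ?V * ((2 * x ^ 3 * s - \<alpha> * G * ?\<sigma>) / (s\<^sup>2 - ?\<sigma>\<^sup>2))"
    using V by (simp add: divide_eq_eq)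
  also have "(2 * x ^ 3 * s - \<alpha> * G * ?\<sigma>) / (s\<^sup>2 - ?\<sigma>\<^sup>2) =
     ?N - (G - ?\<sigma>) * (2 * x ^ 3 * s * (G + ?\<sigma>) - \<alpha> * G * (s\<^sup>2 + G * ?\<sigma>))
     / ((s\<^sup>2 - G\<^sup>2) * (s\<^sup>2 - ?\<sigma>\<^sup>2))"
    using node_rhs_gap_eq[OF sq, of \<alpha> "x ^ 3"] by linarith
  also have "G - ?\<sigma> = - W * G" by (simp add: algebra_simps)
  also have "?N - - W * G * (2 * x ^ 3 * s * (G + ?\<sigma>) - \<alpha> * G * (s\<^sup>2 + G * ?\<sigma>))
     / ((s\<^sup>2 - G\<^sup>2) * (s\<^sup>2 - ?\<sigma>\<^sup>2)) = ?N + W * (G * ((2 * x ^ 3 * s * (G + ?\<sigma>) - \<alpha> * G * (s\<^sup>2 + G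
         * ?\<sigma>))
     / ((s\<^sup>2 - G\<^sup>2) * (s\<^sup>2 - ?\<sigma>\<^sup>2))))"
    by (simp only: mult.assoc times_divide_eq_right mult_minus_left minus_divide_left[symmetric]
        diff_minus_eq_add)
  finally have eq: "node_rhs G \<alpha> (x ^ 3) (s / ?V) = ?V * (?N + W * (G * ((2 * x ^ 3 * s * (G + ?\<sigma>)
      - \<alpha> * G * (s\<^sup>2 + G * ?\<sigma>))
     / ((s\<^sup>2 - G\<^sup>2) * (s\<^sup>2 - ?\<sigma>\<^sup>2)))))" .
  have "?V * (?N + W * ?q) \<le> node_rhs G \<alpha> (x ^ 3) (s / ?V)"
    unfolding eq using node_gap[OF s \<sigma>] W_pos V by (intro mult_left_mono add_left_mono) auto
  moreover have "?V * (n + W * q) = n * ?V + (W * ?V) * q" for n q by (simp add: algebra_simps)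
  ultimately have 1: "?N * ?V + (W * ?V) * ?q \<le> node_rhs G \<alpha> (x ^ 3) (s / ?V)"
    by (simp only:)
  have dA: "c / x\<^sup>2 = c * x / x ^ 3" using x_pos by (simp add: power2_eq_square power3_eq_cube)
  have "e1 * (1 + W1) + e2 * (1 + W2) \<le> (e1 + e2) * ?V + 2 * c * (c * x) * W / x ^ 6"
    by (rule weighted_sum_le) (use f dA in auto)
  also have "(e1 + e2) * ?V \<le> (?N + c / x ^ 10) * ?V"
    using res V by (intro mult_right_mono) auto
  also have "2 * c * (c * x) * W / x ^ 6 = W * (2 * c\<^sup>2 / x ^ 5)"
    using x_pos by (simp add: field_simps eval_nat_numeral)
  finally have 2: "e1 * (1 + W1) + e2 * (1 + W2) \<le> ?N * ?V + c / x ^ 10 * ?V + W * (2 * c\<^sup>2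
      / x ^ 5)"
    by (simp only: distrib_right)
  have "c / x ^ 10 \<le> (4 * c ^ 4 / G\<^sup>2 / x ^ 7) * (?q / 2)"
  proof -
    have "(4 * c ^ 4 / G\<^sup>2 / x ^ 7) * (?q / 2) = 2 * c / x ^ 10"
      using G_pos c_ge x_pos by (simp add: field_simps eval_nat_numeral)
    then show ?thesis using c_ge x_pos by (simp add: divide_right_mono)
  qed
  also have "\<dots> \<le> W * (?q / 2)"
    using W_ge x_pos c_ge by (intro mult_right_mono) auto
  finally have "c / x ^ 10 * ?V \<le> W * (?q / 2) * ?V" using V by (intro mult_right_mono) auto
  then have 3: "c / x ^ 10 * ?V \<le> (W * ?V) * (?q / 2)" by (simp only: mult_ac)
  have "4 * c ^ 5 / x ^ (3 + 2) \<le> G\<^sup>2 / x ^ 3" by (rule x_sq_ge) auto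
  then have "4 * c ^ 5 / x ^ 5 / (2 * c ^ 3) \<le> G\<^sup>2 / x ^ 3 / (2 * c ^ 3)"
    using c_ge by (intro divide_right_mono) auto
  then have "2 * c\<^sup>2 / x ^ 5 \<le> ?q / 2"
    using c_ge x_pos by (simp add: field_simps eval_nat_numeral)
  then have 4: "W * (2 * c\<^sup>2 / x ^ 5) \<le> (W * ?V) * (?q / 2)"
    using W_pos V c_ge x_pos by (intro mult_mono) auto
  have "l \<le> r" if "a + y * q \<le> r" "l \<le> a + b + d" "b \<le> y * (q / 2)" "d \<le> y * (q / 2)"
    for l r a b d y q :: real using that by simp
  from this[OF 1 2 3 4] show ?thesis .
qed

end

section \<open>The formal solution\<close>

text \<open>Coefficients of the formal solution of the discrete system in the variable \<open>u\<^sup>-\<^sup>1\<^sup>/\<^sup>3/6\<close>, with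
  \<open>v = \<alpha>/3\<close> and \<open>k = G\<^sup>2\<close>; these scalings make them integral. At each order the system
  fixes only the sum of the two coefficients, and their difference is fixed four orders later. Hence
  the coefficients of \<open>S\<close> from order 7 on are free for a residual of order 11, and are chosen to be 0.\<close>

definition S_poly :: "real \<Rightarrow> real \<Rightarrow> real poly" where
  "S_poly v k = [:1,
     -(3 * v),
     0,
     -(v) + 9 * v^3,
     -(3 * v^2) + 27 * v^4 + 864 * k,
     -(3 * v) + 27 * v^3 - 3888 * v * k,
     -(22 * v^2) + 234 * v^4 - 324 * v^6 + 720 * k + 3888 * v^2 * k:]"

definition eta_poly :: "real \<Rightarrow> real \<Rightarrow> real poly" where
  "eta_poly v k = [:1,
     3 * v,
     9 * v^2,
     v + 18 * v^3,
     9 * v^2 + 432 * k,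
     3 * v + 18 * v^3 - 162 * v^5 - 1296 * v * k,
     41 * v^2 - 225 * v^4 - 567 * v^6 + 576 * k - 3888 * v^2 * k,
     228 * v^3 - 1674 * v^5 - 1215 * v^7 - 2160 * v * k + 3888 * v^3 * k,
     6 * v^2 + 927 * v^4 - 8181 * v^6 + 729 * v^8 - 20736 * v^2 * k + 81648 * v^4 * k - 933120
         * k^2,
     117 * v^3 + 2079 * v^5 - 27945 * v^7 + 17496 * v^9 - 1440 * v * k - 84240 * v^3 * k + 384912
         * v^5 * k + 5038848 * v * k^2,
     9 * v^2 + 873 * v^4 - 2349 * v^6 - 58320 * v^8 + 78732 * v^10 - 22896 * v^2 * k - 104976 * v^4
         * k + 804816 * v^6 * k - 6594048 * k^2 + 1679616 * v^2 * k^2:]"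

text \<open>Half of \<open>f (u + G/2) + f (u - G/2)\<close> up to fourth differences, on the level of coefficients.\<close>

definition second_diff_poly :: "real \<Rightarrow> real \<Rightarrow> real poly \<Rightarrow> real poly" where
  "second_diff_poly k m p =
     p + (\<Sum>j\<le>degree p. monom (648 * k * (m - real j) * (m - real j - 3) * coeff p j) (j + 6))"

lemma coeff_second_diff_poly:
  "coeff (second_diff_poly k m p) i = coeff p i +
     (if i < 6 then 0 else 648 * k * (m - real (i - 6)) * (m - real (i - 6) - 3) * coeff p (i - 6))"
proof -
  have "(\<Sum>j\<le>degree p. coeff (monom (648 * k * (m - real j) * (m - real j - 3) * coeff p j) (j
      + 6)) i) =
      (\<Sum>j\<le>degree p. if j = i - 6 \<and> 6 \<le> i then 648 * k * (m - real j) * (m - real j - 3)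
          * coeff p j else 0)"
    by (intro sum.cong) (auto simp: coeff_monom)
  also have "\<dots> = (if i < 6 then 0 else 648 * k * (m - real (i - 6)) * (m - real (i - 6) - 3)
      * coeff p (i - 6))"
    by (cases "i < 6") (auto simp: coeff_eq_0 not_less)
  finally show ?thesis by (simp add: second_diff_poly_def coeff_sum)
qed

lemma less_11_cases:
  assumes "(j::nat) < 11"
  shows "j \<in> {0, 1, 2, 3, 4, 5, 6, 7, 8, 9, 10}"
  using assms by (simp add: eval_nat_numeral less_Suc_eq)

lemma coeff_mult_low:
  fixes p q :: "real poly"
  shows
  "coeff (p * q) 0 = coeff p 0 * coeff q 0"
  "coeff (p * q) 1 = coeff p 0 * coeff q 1 + coeff p 1 * coeff q 0"
  "coeff (p * q) 2 = coeff p 0 * coeff q 2 + coeff p 1 * coeff q 1 + coeff p 2 * coeff q 0"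
  "coeff (p * q) 3 = coeff p 0 * coeff q 3 + coeff p 1 * coeff q 2 + coeff p 2 * coeff q 1
      + coeff p 3 * coeff q 0"
  "coeff (p * q) 4 = coeff p 0 * coeff q 4 + coeff p 1 * coeff q 3 + coeff p 2 * coeff q 2
      + coeff p 3 * coeff q 1 + coeff p 4 * coeff q 0"
  "coeff (p * q) 5 = coeff p 0 * coeff q 5 + coeff p 1 * coeff q 4 + coeff p 2 * coeff q 3
      + coeff p 3 * coeff q 2 + coeff p 4 * coeff q 1 + coeff p 5 * coeff q 0"
  "coeff (p * q) 6 = coeff p 0 * coeff q 6 + coeff p 1 * coeff q 5 + coeff p 2 * coeff q 4
      + coeff p 3 * coeff q 3 + coeff p 4 * coeff q 2 + coeff p 5 * coeff q 1 + coeff p 6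
      * coeff q 0"
  "coeff (p * q) 7 = coeff p 0 * coeff q 7 + coeff p 1 * coeff q 6 + coeff p 2 * coeff q 5
      + coeff p 3 * coeff q 4 + coeff p 4 * coeff q 3 + coeff p 5 * coeff q 2 + coeff p 6
      * coeff q 1 + coeff p 7 * coeff q 0"
  "coeff (p * q) 8 = coeff p 0 * coeff q 8 + coeff p 1 * coeff q 7 + coeff p 2 * coeff q 6
      + coeff p 3 * coeff q 5 + coeff p 4 * coeff q 4 + coeff p 5 * coeff q 3 + coeff p 6
      * coeff q 2 + coeff p 7 * coeff q 1 + coeff p 8 * coeff q 0"
  "coeff (p * q) 9 = coeff p 0 * coeff q 9 + coeff p 1 * coeff q 8 + coeff p 2 * coeff q 7
      + coeff p 3 * coeff q 6 + coeff p 4 * coeff q 5 + coeff p 5 * coeff q 4 + coeff p 6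
      * coeff q 3 + coeff p 7 * coeff q 2 + coeff p 8 * coeff q 1 + coeff p 9 * coeff q 0"
  "coeff (p * q) 10 = coeff p 0 * coeff q 10 + coeff p 1 * coeff q 9 + coeff p 2 * coeff q 8
      + coeff p 3 * coeff q 7 + coeff p 4 * coeff q 6 + coeff p 5 * coeff q 5 + coeff p 6
      * coeff q 4 + coeff p 7 * coeff q 3 + coeff p 8 * coeff q 2 + coeff p 9 * coeff q 1
      + coeff p 10 * coeff q 0"
  unfolding coeff_mult by (simp_all add: eval_nat_numeral sum.atMost_Suc)

lemma S_poly_coeffs:
  "coeff (S_poly v k) 0 = 1"
  "coeff (S_poly v k) 1 = -(3 * v)"
  "coeff (S_poly v k) 2 = 0"
  "coeff (S_poly v k) 3 = -(v) + 9 * v^3"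
  "coeff (S_poly v k) 4 = -(3 * v^2) + 27 * v^4 + 864 * k"
  "coeff (S_poly v k) 5 = -(3 * v) + 27 * v^3 - 3888 * v * k"
  "coeff (S_poly v k) 6 = -(22 * v^2) + 234 * v^4 - 324 * v^6 + 720 * k + 3888 * v^2 * k"
  "coeff (S_poly v k) 7 = 0"
  "coeff (S_poly v k) 8 = 0"
  "coeff (S_poly v k) 9 = 0"
  "coeff (S_poly v k) 10 = 0"
  unfolding S_poly_def by (simp_all add: eval_nat_numeral)

lemma eta_poly_coeffs:
  "coeff (eta_poly v k) 0 = 1"
  "coeff (eta_poly v k) 1 = 3 * v"
  "coeff (eta_poly v k) 2 = 9 * v^2"
  "coeff (eta_poly v k) 3 = v + 18 * v^3"
  "coeff (eta_poly v k) 4 = 9 * v^2 + 432 * k"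
  "coeff (eta_poly v k) 5 = 3 * v + 18 * v^3 - 162 * v^5 - 1296 * v * k"
  "coeff (eta_poly v k) 6 = 41 * v^2 - 225 * v^4 - 567 * v^6 + 576 * k - 3888 * v^2 * k"
  "coeff (eta_poly v k) 7 = 228 * v^3 - 1674 * v^5 - 1215 * v^7 - 2160 * v * k + 3888 * v^3 * k"
  "coeff (eta_poly v k) 8 = 6 * v^2 + 927 * v^4 - 8181 * v^6 + 729 * v^8 - 20736 * v^2 * k + 81648
      * v^4 * k - 933120 * k^2"
  "coeff (eta_poly v k) 9 = 117 * v^3 + 2079 * v^5 - 27945 * v^7 + 17496 * v^9 - 1440 * v * k
      - 84240 * v^3 * k + 384912 * v^5 * k + 5038848 * v * k^2"
  "coeff (eta_poly v k) 10 = 9 * v^2 + 873 * v^4 - 2349 * v^6 - 58320 * v^8 + 78732 * v^10 - 22896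
      * v^2 * k - 104976 * v^4 * k + 804816 * v^6 * k - 6594048 * k^2 + 1679616 * v^2 * k^2"
  unfolding eta_poly_def by (simp_all add: eval_nat_numeral)

lemma S_tilde_coeffs:
  "coeff (second_diff_poly k 2 (S_poly v k)) 0 = 1"
  "coeff (second_diff_poly k 2 (S_poly v k)) 1 = -(3 * v)"
  "coeff (second_diff_poly k 2 (S_poly v k)) 2 = 0"
  "coeff (second_diff_poly k 2 (S_poly v k)) 3 = -(v) + 9 * v^3"
  "coeff (second_diff_poly k 2 (S_poly v k)) 4 = -(3 * v^2) + 27 * v^4 + 864 * k"
  "coeff (second_diff_poly k 2 (S_poly v k)) 5 = -(3 * v) + 27 * v^3 - 3888 * v * k"
  "coeff (second_diff_poly k 2 (S_poly v k)) 6 = -(22 * v^2) + 234 * v^4 - 324 * v^6 - 576 * k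
      + 3888 * v^2 * k"
  "coeff (second_diff_poly k 2 (S_poly v k)) 7 = 3888 * v * k"
  "coeff (second_diff_poly k 2 (S_poly v k)) 8 = 0"
  "coeff (second_diff_poly k 2 (S_poly v k)) 9 = -(2592 * v * k) + 23328 * v^3 * k"
  "coeff (second_diff_poly k 2 (S_poly v k)) 10 = -(19440 * v^2 * k) + 174960 * v^4 * k + 5598720
      * k^2"
  unfolding coeff_second_diff_poly
  by (simp_all add: S_poly_coeffs S_poly_coeffs(2)[unfolded One_nat_def] algebra_simps
      power2_eq_square del: One_nat_def)

lemma eta_tilde_coeffs:
  "coeff (second_diff_poly k 1 (eta_poly v k)) 0 = 1"
  "coeff (second_diff_poly k 1 (eta_poly v k)) 1 = 3 * v"
  "coeff (second_diff_poly k 1 (eta_poly v k)) 2 = 9 * v^2"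
  "coeff (second_diff_poly k 1 (eta_poly v k)) 3 = v + 18 * v^3"
  "coeff (second_diff_poly k 1 (eta_poly v k)) 4 = 9 * v^2 + 432 * k"
  "coeff (second_diff_poly k 1 (eta_poly v k)) 5 = 3 * v + 18 * v^3 - 162 * v^5 - 1296 * v * k"
  "coeff (second_diff_poly k 1 (eta_poly v k)) 6 = 41 * v^2 - 225 * v^4 - 567 * v^6 - 720 * k - 3888
      * v^2 * k"
  "coeff (second_diff_poly k 1 (eta_poly v k)) 7 = 228 * v^3 - 1674 * v^5 - 1215 * v^7 - 2160 * v
      * k + 3888 * v^3 * k"
  "coeff (second_diff_poly k 1 (eta_poly v k)) 8 = 6 * v^2 + 927 * v^4 - 8181 * v^6 + 729 * v^8
      + 2592 * v^2 * k + 81648 * v^4 * k - 933120 * k^2"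
  "coeff (second_diff_poly k 1 (eta_poly v k)) 9 = 117 * v^3 + 2079 * v^5 - 27945 * v^7 + 17496
      * v^9 + 5040 * v * k + 32400 * v^3 * k + 384912 * v^5 * k + 5038848 * v * k^2"
  "coeff (second_diff_poly k 1 (eta_poly v k)) 10 = 9 * v^2 + 873 * v^4 - 2349 * v^6 - 58320 * v^8
      + 78732 * v^10 + 82080 * v^2 * k - 104976 * v^4 * k + 804816 * v^6 * k - 1555200 * k^2
      + 1679616 * v^2 * k^2"
  unfolding coeff_second_diff_poly
  by (simp add: eta_poly_coeffs eta_poly_coeffs(2)[unfolded One_nat_def] del: One_nat_def;
      algebra?)+

lemma eta_square_coeffs:
  "coeff (eta_poly v k * eta_poly v k) 0 = 1"
  "coeff (eta_poly v k * eta_poly v k) 1 = 6 * v"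
  "coeff (eta_poly v k * eta_poly v k) 2 = 27 * v^2"
  "coeff (eta_poly v k * eta_poly v k) 3 = 2 * v + 90 * v^3"
  "coeff (eta_poly v k * eta_poly v k) 4 = 24 * v^2 + 189 * v^4 + 864 * k"
  "coeff (eta_poly v k * eta_poly v k) 5 = 6 * v + 108 * v^3"
  "coeff (eta_poly v k * eta_poly v k) 6 = 101 * v^2 - 144 * v^4 - 1782 * v^6 + 1152 * k - 7776
      * v^2 * k"
  "coeff (eta_poly v k * eta_poly v k) 7 = 774 * v^3 - 4050 * v^5 - 8748 * v^7 - 23328 * v^3 * k"
  "coeff (eta_poly v k * eta_poly v k) 8 = 18 * v^2 + 4185 * v^4 - 30132 * v^6 - 21870 * v^8 - 38880
      * v^2 * k + 69984 * v^4 * k - 1679616 * k^2"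
  "coeff (eta_poly v k * eta_poly v k) 9 = 406 * v^3 + 15174 * v^5 - 147258 * v^7 - 2916 * v^9 + 864
      * v * k - 326592 * v^3 * k + 1049760 * v^5 * k + 3359232 * v * k^2"
  "coeff (eta_poly v k * eta_poly v k) 10 = 27 * v^2 + 3858 * v^4 + 24624 * v^6 - 510300 * v^8
      + 258066 * v^10 - 20736 * v^2 * k - 1469664 * v^4 * k + 5458752 * v^6 * k - 12690432 * k^2
      + 15116544 * v^2 * k^2"
  unfolding coeff_mult_low eta_poly_coeffs by algebra+

lemma S_square_coeffs:
  "coeff (S_poly v k * S_poly v k - monom (1296 * k) 4) 0 = 1"
  "coeff (S_poly v k * S_poly v k - monom (1296 * k) 4) 1 = -(6 * v)"
  "coeff (S_poly v k * S_poly v k - monom (1296 * k) 4) 2 = 9 * v^2"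
  "coeff (S_poly v k * S_poly v k - monom (1296 * k) 4) 3 = -(2 * v) + 18 * v^3"
  "coeff (S_poly v k * S_poly v k - monom (1296 * k) 4) 4 = 432 * k"
  "coeff (S_poly v k * S_poly v k - monom (1296 * k) 4) 5 = -(6 * v) + 72 * v^3 - 162 * v^5 - 12960
      * v * k"
  "coeff (S_poly v k * S_poly v k - monom (1296 * k) 4) 6 = -(25 * v^2) + 288 * v^4 - 567 * v^6
      + 1440 * k + 31104 * v^2 * k"
  "coeff (S_poly v k * S_poly v k - monom (1296 * k) 4) 7 = 138 * v^3 - 1512 * v^5 + 2430 * v^7
      - 6048 * v * k - 7776 * v^3 * k"
  "coeff (S_poly v k * S_poly v k - monom (1296 * k) 4) 8 = 6 * v^2 - 99 * v^4 + 324 * v^6 + 729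
      * v^8 + 2592 * v^2 * k - 23328 * v^4 * k + 746496 * k^2"
  "coeff (S_poly v k * S_poly v k - monom (1296 * k) 4) 9 = 62 * v^3 - 1188 * v^5 + 6318 * v^7
      - 5832 * v^9 - 6624 * v * k + 75168 * v^3 * k - 139968 * v^5 * k - 6718464 * v * k^2"
  "coeff (S_poly v k * S_poly v k - monom (1296 * k) 4) 10 = 9 * v^2 - 30 * v^4 - 1863 * v^6 + 14580
      * v^8 - 17496 * v^10 - 19008 * v^2 * k + 209952 * v^4 * k - 349920 * v^6 * k + 1244160 * k^2
      + 21835008 * v^2 * k^2"
  unfolding coeff_diff coeff_mult_low S_poly_coeffs coeff_monom by (simp; algebra?)+

text \<open>The link equation cleared of denominators: with y = u^(-1/3) / 6 and leading powers
  removed it reads S \<eta>^2 = \<eta> + k u^(-4/3), where S is the half-sum over the shifts, and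
  u^(-4/3) = 1296 y^4.\<close>

lemma link_residual_coeffs:
  assumes "j < 11"
  shows "coeff (second_diff_poly k 2 (S_poly v k) * (eta_poly v k * eta_poly v k) - eta_poly v k
      - monom (1296 * k) 4) j = 0"
    (is "coeff ?p j = 0")
proof -
  define q where "q = eta_poly v k * eta_poly v k"
  note q_coeffs = eta_square_coeffs[of v k, folded q_def]
  have "coeff ?p 0 = 0" "coeff ?p 1 = 0" "coeff ?p 2 = 0" "coeff ?p 3 = 0" "coeff ?p 4
      = 0" "coeff ?p 5 = 0" "coeff ?p 6 = 0" "coeff ?p 7 = 0" "coeff ?p 8 = 0" "coeff ?p 9
      = 0" "coeff ?p 10 = 0"
    unfolding q_def[symmetric] coeff_diff coeff_monom coeff_mult_low S_tilde_coeffs q_coeffs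
        eta_poly_coeffs
    by (simp; algebra?)+
  with less_11_cases[OF assms] show ?thesis by (elim insertE emptyE) (simp_all only:)
qed

text \<open>The node equation in the same variable; the constant 11664 is 6^5 * 3/2, from \<alpha> k
  u^(-5/3) / 2 with \<alpha> = 3 v.\<close>

lemma node_residual_coeffs:
  assumes "j < 11"
  shows "coeff (second_diff_poly k 1 (eta_poly v k) * (S_poly v k * S_poly v k - monom (1296 * k) 4)
     - S_poly v k + monom (11664 * v * k) 5) j = 0" (is "coeff ?p j = 0")
proof -
  define q where "q = S_poly v k * S_poly v k - monom (1296 * k) 4"
  note q_coeffs = S_square_coeffs[of v k, folded q_def]
  have "coeff ?p 0 = 0" "coeff ?p 1 = 0" "coeff ?p 2 = 0" "coeff ?p 3 = 0" "coeff ?p 4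
      = 0" "coeff ?p 5 = 0" "coeff ?p 6 = 0" "coeff ?p 7 = 0" "coeff ?p 8 = 0" "coeff ?p 9
      = 0" "coeff ?p 10 = 0"
    unfolding q_def[symmetric] coeff_diff coeff_add coeff_monom coeff_mult_low eta_tilde_coeffs
        q_coeffs S_poly_coeffs
    by (simp; algebra?)+
  with less_11_cases[OF assms] show ?thesis by (elim insertE emptyE) (simp_all only:)
qed

section \<open>Laurent polynomials in the cube root\<close>

text \<open>\<open>D m\<close> is the m-th derivative; the Lagrange remainder is uniform because 1 +
  t stays between 1/2 and 3/2.\<close>

lemma powr_one_plus_taylor:
  fixes q :: real
  obtains K where "\<And>h. \<bar>h\<bar> \<le> 1 / 2 \<Longrightarrow>
    \<bar>(1 + h) powr q - (1 + q * h + q * (q - 1) / 2 * h ^ 2 + q * (q - 1) * (q - 2) / 6 * h ^ 3)\<bar> \<le> K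
        * h ^ 4"
proof -
  define D where "D = (\<lambda>m (h::real). (\<Prod>i<m. q - real i) * (1 + h) powr (q - real m))"
  define K where "K = \<bar>\<Prod>i<4. q - real i\<bar> * (2 powr \<bar>q - 4\<bar>) / 24"
  have "\<bar>(1 + h) powr q - (1 + q * h + q * (q - 1) / 2 * h ^ 2 + q * (q - 1) * (q - 2) / 6 * h ^ 3)\<bar>
      \<le> K * h ^ 4"
    if h: "\<bar>h\<bar> \<le> 1 / 2" for h
  proof (cases "h = 0")
    case False
    have "\<exists>t. (if h < 0 then h < t \<and> t < 0 else 0 < t \<and> t < h) \<and>
        (1 + h) powr q = (\<Sum>m<4. D m 0 / fact m * (h - 0) ^ m) + D 4 t / fact 4 * (h - 0) ^ 4"
    proof (rule Taylor[where a = "-1/2" and b = "1/2"])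
      show "D 0 = (\<lambda>h. (1 + h) powr q)" by (simp add: D_def)
      show "\<forall>m t. m < 4 \<and> - 1 / 2 \<le> t \<and> t \<le> 1 / 2 \<longrightarrow> (D m has_real_derivative D (Suc m) t) (at t)"
      proof (intro allI impI)
        fix m :: nat and t :: real assume t: "m < 4 \<and> - 1 / 2 \<le> t \<and> t \<le> 1 / 2"
        have "(D m has_real_derivative (\<Prod>i<m. q - real i) * ((q - real m) * (1 + t) powr (q - real m
            - 1))) (at t)"
          unfolding D_def using t by (auto intro!: derivative_eq_intros)
        then show "(D m has_real_derivative D (Suc m) t) (at t)"
          by (simp add: D_def mult_ac diff_diff_eq add.commute)
      qed
    qed (use h False in auto)
    then obtain t where "if h < 0 then h < t \<and> t < 0 else 0 < t \<and> t < h"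
      and eq: "(1 + h) powr q = (\<Sum>m<4. D m 0 / fact m * h ^ m) + D 4 t / fact 4 * h ^ 4"
      by auto
    then have t: "\<bar>t\<bar> \<le> 1 / 2" using h by (auto split: if_splits)
    have "(1 + t) powr (q - 4) \<le> 2 powr \<bar>q - 4\<bar>"
    proof (cases "q \<ge> 4")
      case True
      then show ?thesis using t by (auto intro!: powr_mono2)
    next
      case False
      have "(1 + t) powr (q - 4) \<le> (1 / 2) powr (q - 4)"
        using False t by (intro powr_mono2') auto
      also have "\<dots> = 2 powr (4 - q)" by (simp add: powr_divide powr_minus_divide[symmetric])
      finally show ?thesis using False by simp
    qed
    then have "\<bar>D 4 t\<bar> \<le> \<bar>\<Prod>i<4. q - real i\<bar> * 2 powr \<bar>q - 4\<bar>"
      unfolding D_def abs_mult by (intro mult_left_mono) auto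
    then have "\<bar>D 4 t / fact 4 * h ^ 4\<bar> \<le> K * h ^ 4"
      unfolding abs_mult K_def by (intro mult_mono) (auto simp: fact_numeral)
    moreover have "(\<Sum>m<4. D m 0 / fact m * h ^ m) =
        1 + q * h + q * (q - 1) / 2 * h ^ 2 + q * (q - 1) * (q - 2) / 6 * h ^ 3"
      by (simp add: D_def eval_nat_numeral)
    ultimately show ?thesis using eq by simp
  qed simp
  then show ?thesis using that by blast
qed

text \<open>Scaling by u reduces to expansions at d / u and - d / u. In the sum the odd terms
  cancel, so the error is of fourth order; in the difference the even terms cancel, and the cubic
  term is counted as error.\<close>

lemma powr_shift_bounds:
  fixes q d :: real
  shows "(\<lambda>u. (u + d) powr q + (u - d) powr q - 2 * u powr q - d\<^sup>2 * q * (q - 1) * u powr (q - 2))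
           \<in> O(\<lambda>u. u powr (q - 4))"
    and "(\<lambda>u. (u + d) powr q - (u - d) powr q - 2 * d * q * u powr (q - 1)) \<in> O(\<lambda>u. u powr (q - 3))"
proof -
  obtain K where K: "\<And>h. \<bar>h\<bar> \<le> 1 / 2 \<Longrightarrow>
    \<bar>(1 + h) powr q - (1 + q * h + q * (q - 1) / 2 * h ^ 2 + q * (q - 1) * (q - 2) / 6 * h ^ 3)\<bar> \<le> K
        * h ^ 4"
    using powr_one_plus_taylor by blast
  have ev: "eventually (\<lambda>u::real. u > 0 \<and> 2 * \<bar>d\<bar> \<le> u) at_top"
    by (intro eventually_conj eventually_gt_at_top eventually_ge_at_top)
  define E where "E = (\<lambda>h. (1 + h) powr q
    - (1 + q * h + q * (q - 1) / 2 * h ^ 2 + q * (q - 1) * (q - 2) / 6 * h ^ 3))"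
  have E: "\<bar>E h\<bar> \<le> K * h ^ 4" "\<bar>E (- h)\<bar> \<le> K * h ^ 4" if "\<bar>h\<bar> \<le> 1 / 2" for h
    using K[of h] K[of "- h"] that by (simp_all add: E_def)
  have E2: "(1 + h) powr q + (1 + - h) powr q - 2 - q * (q - 1) * h ^ 2 = E h + E (- h)" for h
    by (simp add: E_def)
  have E1: "(1 + h) powr q - (1 + - h) powr q - 2 * q * h - q * (q - 1) * (q - 2) / 3 * h ^ 3 = E h
      - E (- h)" for h
    by (simp add: E_def field_simps)
  let ?T2 = "\<lambda>h. (1 + h) powr q + (1 + - h) powr q - 2 - q * (q - 1) * h ^ 2"
  let ?T1 = "\<lambda>h. (1 + h) powr q - (1 + - h) powr q - 2 * q * h"
  have scale: "(u + d) powr q = u powr q * (1 + d / u) powr q"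
    "(u - d) powr q = u powr q * (1 + - (d / u)) powr q"
    if "u > 0" "2 * \<bar>d\<bar> \<le> u" for u
  proof -
    have h: "\<bar>d / u\<bar> \<le> 1 / 2" using that by (simp add: abs_divide field_simps)
    have "u + d = u * (1 + d / u)" "u - d = u * (1 + - (d / u))"
      using that by (simp_all add: field_simps)
    then show "(u + d) powr q = u powr q * (1 + d / u) powr q"
      "(u - d) powr q = u powr q * (1 + - (d / u)) powr q"
      using that h by (simp_all add: powr_mult)
  qed
  show "(\<lambda>u. (u + d) powr q + (u - d) powr q - 2 * u powr q - d\<^sup>2 * q * (q - 1) * u powr (q - 2))
           \<in> O(\<lambda>u. u powr (q - 4))"
  proof (rule bigoI[of _ "2 * K * d ^ 4"], use ev in eventually_elim)
    case (elim u)
    have h: "\<bar>d / u\<bar> \<le> 1 / 2" using elim by (simp add: abs_divide field_simps)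
    have T: "\<bar>?T2 (d / u)\<bar> \<le> 2 * K * (d / u) ^ 4"
      unfolding E2 using E[OF h] by linarith
    have "u powr (q - 2) = u powr q / u\<^sup>2" "u powr (q - 4) = u powr q / u ^ 4"
      using elim by (simp_all add: powr_diff powr_numeral)
    then have "(u + d) powr q + (u - d) powr q - 2 * u powr q - d\<^sup>2 * q * (q - 1) * u powr (q - 2) =
        u powr q * ?T2 (d / u)"
      using scale[of u] elim by (simp add: algebra_simps power_divide add_divide_distrib
          diff_divide_distrib)
    also have "norm \<dots> \<le> u powr q * (2 * K * (d / u) ^ 4)"
      using T by (simp add: abs_mult mult_left_mono)
    also have "\<dots> = 2 * K * d ^ 4 * norm (u powr (q - 4))"
      using \<open>u powr (q - 4) = u powr q / u ^ 4\<close> by (simp add: power_divide)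
    finally show ?case .
  qed
  show "(\<lambda>u. (u + d) powr q - (u - d) powr q - 2 * d * q * u powr (q - 1)) \<in> O(\<lambda>u. u powr (q - 3))"
  proof (rule bigoI[of _ "(\<bar>K\<bar> + \<bar>q * (q - 1) * (q - 2) / 3\<bar>)
      * \<bar>d\<bar> ^ 3"], use ev in eventually_elim)
    case (elim u)
    let ?h = "d / u"
    have h: "\<bar>?h\<bar> \<le> 1 / 2" using elim by (simp add: abs_divide field_simps)
    have "\<bar>?T1 ?h - q * (q - 1) * (q - 2) / 3 * ?h ^ 3\<bar> \<le> 2 * (K * ?h ^ 4)"
      unfolding E1 using E[OF h] by linarith
    also have "2 * (K * ?h ^ 4) = K * (2 * \<bar>?h\<bar>) * \<bar>?h\<bar> ^ 3"
    proof -
      have "?h ^ 4 = \<bar>?h\<bar> ^ 4" by (rule power_even_abs[symmetric]) simp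
      then show ?thesis by (simp add: eval_nat_numeral)
    qed
    also have "\<dots> \<le> \<bar>K\<bar> * 1 * \<bar>?h\<bar> ^ 3"
    proof (intro mult_right_mono)
      have "K * (2 * \<bar>?h\<bar>) \<le> \<bar>K\<bar> * (2 * \<bar>?h\<bar>)" by (intro mult_right_mono) auto
      also have "\<dots> \<le> \<bar>K\<bar> * 1"
      proof (rule mult_left_mono)
        show "2 * \<bar>?h\<bar> \<le> 1" using h by linarith
      qed simp
      finally show "K * (2 * \<bar>?h\<bar>) \<le> \<bar>K\<bar> * 1" .
    qed auto
    finally have "\<bar>?T1 ?h\<bar> \<le> \<bar>K\<bar> * \<bar>?h\<bar> ^ 3 + \<bar>q * (q - 1) * (q - 2) / 3 * ?h ^ 3\<bar>" by simp
    also have "\<bar>q * (q - 1) * (q - 2) / 3 * ?h ^ 3\<bar> = \<bar>q * (q - 1) * (q - 2) / 3\<bar> * \<bar>?h\<bar> ^ 3"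
      by (simp add: abs_mult power_abs)
    finally have T: "\<bar>?T1 ?h\<bar> \<le> (\<bar>K\<bar> + \<bar>q * (q - 1) * (q - 2) / 3\<bar>) * \<bar>?h\<bar> ^ 3"
      by (simp add: distrib_right)
    have pw: "u powr (q - 1) = u powr q / u" "u powr (q - 3) = u powr q / u ^ 3"
      using elim by (simp_all add: powr_diff powr_numeral)
    then have "(u + d) powr q - (u - d) powr q - 2 * d * q * u powr (q - 1) = u powr q * ?T1 ?h"
      using scale[of u] elim by (simp add: algebra_simps)
    also have "norm \<dots> \<le> u powr q * ((\<bar>K\<bar> + \<bar>q * (q - 1) * (q - 2) / 3\<bar>) * \<bar>?h\<bar> ^ 3)"
      unfolding real_norm_def abs_mult by (intro mult_mono T) auto
    also have "\<dots> = (\<bar>K\<bar> + \<bar>q * (q - 1) * (q - 2) / 3\<bar>) * \<bar>d\<bar> ^ 3 * norm (u powr (q - 3))"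
      using pw elim by (simp add: abs_divide power_divide)
    finally show ?case .
  qed
qed

definition laur :: "real \<Rightarrow> real poly \<Rightarrow> real \<Rightarrow> real" where
  "laur m p u = u powr (m / 3) * poly p (u powr (- 1 / 3) / 6)"

lemma laur_sum:
  assumes "u > 0"
  shows "laur m p u = (\<Sum>j\<le>degree p. coeff p j / 6 ^ j * u powr ((m - real j) / 3))"
proof -
  have "(u powr (- 1 / 3)) ^ j = u powr (- real j / 3)" for j
    using assms by (simp add: powr_realpow[symmetric] powr_powr)
  then have "u powr (m / 3) * (coeff p j * (u powr (- 1 / 3) / 6) ^ j) =
      coeff p j / 6 ^ j * u powr ((m - real j) / 3)" for j
    by (simp add: power_divide diff_divide_distrib powr_add[symmetric])
  then show ?thesis by (simp add: laur_def poly_altdef sum_distrib_left)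
qed

text \<open>The correction is (G/2)^2 / 2 times the second derivative. For the power (m - j) / 3
  this gives k (m - j) (m - j - 3) / 72, and the factor u^(-2) is 6^6 times the sixth power of the
  variable; 648 = 6^6 / 72.\<close>

lemma laur_second_diff_poly:
  assumes "u > 0"
  shows "laur m (second_diff_poly k m p) u = laur m p u +
     (\<Sum>j\<le>degree p. k * (m - real j) * (m - real j - 3) / 72 * (coeff p j / 6 ^ j) * u powr ((m
         - real j) / 3 - 2))"
proof -
  have "(u powr (- 1 / 3)) ^ (j + 6) = u powr (- real j / 3 - 2)" for j
  proof -
    have "(u powr (- 1 / 3)) ^ (j + 6) = u powr (- 1 / 3 * real (j + 6))"
      using assms by (simp add: powr_realpow[symmetric] powr_powr)
    also have "- 1 / 3 * real (j + 6) = - real j / 3 - 2" by (simp add: field_simps)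
    finally show ?thesis .
  qed
  then have "u powr (m / 3) * (648 * k * (m - real j) * (m - real j - 3) * coeff p j * (u powr (- 1
      / 3) / 6) ^ (j + 6)) =
      k * (m - real j) * (m - real j - 3) / 72 * (coeff p j / 6 ^ j) * u powr ((m - real j) / 3
          - 2)" for j
    by (simp add: power_divide power_add[of 6] diff_divide_distrib powr_add[symmetric]) (simp add:
        algebra_simps)
  then show ?thesis
    by (simp add: laur_def second_diff_poly_def poly_sum poly_monom distrib_left sum_distrib_left)
qed

lemma powr_bigo_powr: "a \<le> b \<Longrightarrow> (\<lambda>u::real. u powr a) \<in> O(\<lambda>u. u powr b)"
  by (intro bigoI[of _ 1] eventually_mono[OF eventually_ge_at_top[of 1]]) (auto intro: powr_mono)

lemma laur_shift_add:
  fixes G :: real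
  shows "(\<lambda>u. laur m p (u + G / 2) + laur m p (u - G / 2) - 2
      * laur m (second_diff_poly (G\<^sup>2) m p) u)
    \<in> O(\<lambda>u. u powr (m / 3 - 4))"
proof -
  let ?q = "\<lambda>j. (m - real j) / 3"
  let ?e = "\<lambda>j u. (u + G / 2) powr ?q j + (u - G / 2) powr ?q j - 2 * u powr ?q j
    - (G / 2)\<^sup>2 * ?q j * (?q j - 1) * u powr (?q j - 2)"
  have "(\<lambda>u. \<Sum>j\<le>degree p. coeff p j / 6 ^ j * ?e j u) \<in> O(\<lambda>u. u powr (m / 3 - 4))"
  proof (rule big_sum_in_bigo)
    fix j
    have "?e j \<in> O(\<lambda>u. u powr (?q j - 4))" by (rule powr_shift_bounds)
    also have "(\<lambda>u. u powr (?q j - 4)) \<in> O(\<lambda>u. u powr (m / 3 - 4))"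
      by (rule powr_bigo_powr) (simp add: diff_divide_distrib)
    finally show "(\<lambda>u. coeff p j / 6 ^ j * ?e j u) \<in> O(\<lambda>u. u powr (m / 3 - 4))"
      by (cases "coeff p j = 0") auto
  qed
  moreover have "eventually (\<lambda>u. (\<Sum>j\<le>degree p. coeff p j / 6 ^ j * ?e j u) =
      laur m p (u + G / 2) + laur m p (u - G / 2) - 2 * laur m (second_diff_poly (G\<^sup>2) m p) u)
          at_top"
    using eventually_gt_at_top[of "\<bar>G / 2\<bar>"]
  proof eventually_elim
    case (elim u)
    then have pos: "u > 0" "u + G / 2 > 0" "u - G / 2 > 0" by auto
    have t: "2 * (G\<^sup>2 * (m - real j) * (m - real j - 3) / 72 * (coeff p j / 6 ^ j) * z) =
       coeff p j / 6 ^ j * ((G / 2)\<^sup>2 * ?q j * (?q j - 1) * z)" for j z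
      by (simp add: field_simps power2_eq_square)
    show ?case
      unfolding laur_second_diff_poly[OF pos(1)]
      unfolding laur_sum[OF pos(1), of m p] laur_sum[OF pos(2)] laur_sum[OF pos(3)]
        distrib_left sum_distrib_left t
      by (simp add: sum.distrib sum_subtractf right_diff_distrib distrib_left mult_ac)
  qed
  ultimately show ?thesis by (subst (asm) landau_o.big.in_cong) auto
qed

lemma tendsto_laur_arg: "((\<lambda>u::real. u powr (- 1 / 3) / 6) \<longlongrightarrow> 0) at_top"
  by real_asymp

lemma tendsto_poly_laur_arg:
  "((\<lambda>u::real. poly p (u powr (- 1 / 3) / 6)) \<longlongrightarrow> coeff p 0) at_top"
  using isCont_tendsto_compose[OF poly_isCont tendsto_laur_arg, of p] by (simp add: poly_0_coeff_0)

lemma laur_bigo_vanish: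
  assumes "\<And>j. j < N \<Longrightarrow> coeff p j = 0"
  shows "laur m p \<in> O(\<lambda>u. u powr ((m - real N) / 3))"
proof -
  let ?y = "\<lambda>u::real. u powr (- 1 / 3) / 6"
  have "p = monom 1 N * poly_shift N p"
    using assms by (intro poly_eqI) (auto simp: coeff_monom_mult coeff_poly_shift not_le)
  then have poly: "poly p z = z ^ N * poly (poly_shift N p) z" for z
    by (metis mult_1 poly_monom poly_mult)
  have "(\<lambda>u. poly (poly_shift N p) (?y u)) \<in> O(\<lambda>_. 1)"
    by (rule bigoI_tendsto[where c = "coeff (poly_shift N p) 0"])
       (use tendsto_poly_laur_arg in auto)
  then have "(\<lambda>u. u powr ((m - real N) / 3) / 6 ^ N * poly (poly_shift N p) (?y u))
      \<in> O(\<lambda>u. u powr ((m - real N) / 3) * 1)"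
    by (intro landau_o.big.mult) auto
  moreover have "eventually (\<lambda>u. u powr ((m - real N) / 3) / 6 ^ N * poly (poly_shift N p) (?y u)
      = laur m p u) at_top"
    using eventually_gt_at_top[of 0]
  proof eventually_elim
    case (elim u)
    have "(u powr (- 1 / 3)) ^ N = u powr (- real N / 3)"
      using elim by (simp add: powr_realpow[symmetric] powr_powr)
    then show ?case
      by (simp add: laur_def poly power_divide diff_divide_distrib powr_add[symmetric])
  qed
  ultimately show ?thesis by (subst (asm) landau_o.big.in_cong) auto
qed

lemma laur_bigo: "laur m p \<in> O(\<lambda>u. u powr (m / 3))"
  using laur_bigo_vanish[of 0 p m] by simp

lemma laur_between:
  assumes "coeff p 0 = 1"
  shows "eventually (\<lambda>u. u powr (m / 3) / 2 \<le> laur m p u \<and> laur m p u \<le> 2 * u powr (m / 3)) at_top"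
proof -
  have "eventually (\<lambda>u. poly p (u powr (- 1 / 3) / 6) > 1 / 2) at_top"
    by (rule order_tendstoD(1)[OF tendsto_poly_laur_arg]) (use assms in simp)
  moreover have "eventually (\<lambda>u. poly p (u powr (- 1 / 3) / 6) < 2) at_top"
    by (rule order_tendstoD(2)[OF tendsto_poly_laur_arg]) (use assms in simp)
  ultimately show ?thesis
  proof eventually_elim
    case (elim u)
    have "u powr (m / 3) * (1 / 2) \<le> laur m p u"
      unfolding laur_def by (rule mult_left_mono) (use elim in auto)
    moreover have "laur m p u \<le> u powr (m / 3) * 2"
      unfolding laur_def by (rule mult_left_mono) (use elim in auto)
    ultimately show ?case by simp
  qed
qed

text \<open>The coefficients of the derivative: \<open>laur (m - 3) (diff_poly m p)\<close> is the
  derivative of \<open>laur m p\<close>, since differentiation lowers the exponent by 1, that is, m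
  by 3.\<close>

definition diff_poly :: "real \<Rightarrow> real poly \<Rightarrow> real poly" where
  "diff_poly m p = smult (1 / 3) (smult m p - pCons 0 (pderiv p))"

lemma coeff_diff_poly: "coeff (diff_poly m p) j = (m - real j) / 3 * coeff p j"
  by (cases j) (simp_all add: diff_poly_def coeff_pderiv field_simps)

lemma laur_diff_poly:
  assumes "u > 0"
  shows "laur (m - 3) (diff_poly m p) u =
     (\<Sum>j\<le>degree p. (m - real j) / 3 * (coeff p j / 6 ^ j) * u powr ((m - real j) / 3 - 1))"
proof -
  have "(u powr (- 1 / 3)) ^ j = u powr (- real j / 3)" for j
    using assms by (simp add: powr_realpow[symmetric] powr_powr)
  moreover have "(m - 3) / 3 + - real j / 3 = (m - real j) / 3 - 1" for j by (simp add: field_simps)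
  ultimately have *: "u powr ((m - 3) / 3) * (u powr (- 1 / 3)) ^ j = u powr ((m - real j) / 3
      - 1)" for j
    by (simp only: powr_add[symmetric])
  have "degree (diff_poly m p) \<le> degree p"
    by (rule degree_le) (simp add: coeff_diff_poly coeff_eq_0)
  then have "poly (diff_poly m p) z = (\<Sum>j\<le>degree p. coeff (diff_poly m p) j * z ^ j)" for z
    unfolding poly_altdef by (intro sum.mono_neutral_left) (auto simp: coeff_eq_0)
  then have "laur (m - 3) (diff_poly m p) u =
      (\<Sum>j\<le>degree p. coeff (diff_poly m p) j / 6 ^ j * (u powr ((m - 3) / 3) * (u powr (- 1
          / 3)) ^ j))"
    by (simp add: laur_def sum_distrib_left power_divide mult_ac)
  then show ?thesis by (simp only: * coeff_diff_poly times_divide_eq_right)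
qed

lemma laur_shift_diff:
  fixes G :: real
  shows "(\<lambda>u. laur m p (u + G / 2) - laur m p (u - G / 2) - G * laur (m - 3) (diff_poly m p) u)
    \<in> O(\<lambda>u. u powr (m / 3 - 3))"
proof -
  let ?q = "\<lambda>j. (m - real j) / 3"
  let ?e = "\<lambda>j u. (u + G / 2) powr ?q j - (u - G / 2) powr ?q j - 2 * (G / 2) * ?q j * u powr (?q j
      - 1)"
  have "(\<lambda>u. \<Sum>j\<le>degree p. coeff p j / 6 ^ j * ?e j u) \<in> O(\<lambda>u. u powr (m / 3 - 3))"
  proof (rule big_sum_in_bigo)
    fix j
    have "?e j \<in> O(\<lambda>u. u powr (?q j - 3))" by (rule powr_shift_bounds)
    also have "(\<lambda>u. u powr (?q j - 3)) \<in> O(\<lambda>u. u powr (m / 3 - 3))"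
      by (rule powr_bigo_powr) (simp add: diff_divide_distrib)
    finally show "(\<lambda>u. coeff p j / 6 ^ j * ?e j u) \<in> O(\<lambda>u. u powr (m / 3 - 3))"
      by (cases "coeff p j = 0") auto
  qed
  moreover have "eventually (\<lambda>u. (\<Sum>j\<le>degree p. coeff p j / 6 ^ j * ?e j u) =
      laur m p (u + G / 2) - laur m p (u - G / 2) - G * laur (m - 3) (diff_poly m p) u) at_top"
    using eventually_gt_at_top[of "\<bar>G / 2\<bar>"]
  proof eventually_elim
    case (elim u)
    then have pos: "u > 0" "u + G / 2 > 0" "u - G / 2 > 0" by auto
    show ?case
      unfolding laur_diff_poly[OF pos(1)] laur_sum[OF pos(2)] laur_sum[OF pos(3)] sum_distrib_left
        sum_subtractf[symmetric]
      by (intro sum.cong refl) (simp add: field_simps)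
  qed
  ultimately show ?thesis by (subst (asm) landau_o.big.in_cong) auto
qed

lemma laur_shift_diff_bigo:
  "(\<lambda>u. laur m p (u + G / 2) - laur m p (u - G / 2)) \<in> O(\<lambda>u. u powr (m / 3 - 1))"
proof -
  have "(\<lambda>u. laur m p (u + G / 2) - laur m p (u - G / 2) - G * laur (m - 3) (diff_poly m p) u)
    \<in> O(\<lambda>u. u powr (m / 3 - 1))"
    by (rule landau_o.big.trans[OF laur_shift_diff powr_bigo_powr]) simp
  moreover have "(\<lambda>u. G * laur (m - 3) (diff_poly m p) u) \<in> O(\<lambda>u. u powr (m / 3 - 1))"
    using laur_bigo[of "m - 3" "diff_poly m p"] by (cases "G = 0") (auto simp: diff_divide_distrib)
  ultimately have "(\<lambda>u. (laur m p (u + G / 2) - laur m p (u - G / 2) - G * laur (m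
      - 3) (diff_poly m p) u)
      + G * laur (m - 3) (diff_poly m p) u) \<in> O(\<lambda>u. u powr (m / 3 - 1))"
    by (rule sum_in_bigo)
  then show ?thesis by simp
qed

lemma laur_shift_add_bigo:
  "(\<lambda>u. laur m p (u + G / 2) + laur m p (u - G / 2)) \<in> O(\<lambda>u. u powr (m / 3))"
proof -
  let ?s = "\<lambda>u. laur m (second_diff_poly (G\<^sup>2) m p) u"
  have "(\<lambda>u. laur m p (u + G / 2) + laur m p (u - G / 2) - 2 * ?s u) \<in> O(\<lambda>u. u powr (m / 3))"
    by (rule landau_o.big.trans[OF laur_shift_add powr_bigo_powr]) simp
  moreover have "(\<lambda>u. 2 * ?s u) \<in> O(\<lambda>u. u powr (m / 3))"
    using laur_bigo by simp
  ultimately have "(\<lambda>u. (laur m p (u + G / 2) + laur m p (u - G / 2) - 2 * ?s u) + 2 * ?s u)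
      \<in> O(\<lambda>u. u powr (m / 3))" by (rule sum_in_bigo)
  then show ?thesis by simp
qed

section \<open>Residuals of the truncated formal solution\<close>

definition S_approx :: "real \<Rightarrow> real \<Rightarrow> real \<Rightarrow> real" where
  "S_approx G \<alpha> = laur 2 (S_poly (\<alpha> / 3) (G\<^sup>2))"

definition \<eta>_approx :: "real \<Rightarrow> real \<Rightarrow> real \<Rightarrow> real" where
  "\<eta>_approx G \<alpha> = laur 1 (eta_poly (\<alpha> / 3) (G\<^sup>2))"

lemma powr_third_power: "u > 0 \<Longrightarrow> (u powr (1 / 3)) ^ n = u powr (real n / 3)" for u :: real
  by (simp add: powr_realpow[symmetric] powr_powr)

lemma eventually_poly_pos:
  assumes "coeff p 0 > 0"
  shows "eventually (\<lambda>u::real. poly p (u powr (- 1 / 3) / 6) > 0) at_top"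
  by (rule order_tendstoD(1)[OF tendsto_poly_laur_arg assms])

lemma bigo_one_over_poly:
  assumes "coeff p 0 \<noteq> 0"
  shows "(\<lambda>u::real. 1 / poly p (u powr (- 1 / 3) / 6)) \<in> O[at_top](\<lambda>_. 1)"
proof -
  have "((\<lambda>u::real. 1 / poly p (u powr (- 1 / 3) / 6)) \<longlongrightarrow> 1 / coeff p 0) at_top"
    by (rule tendsto_divide[OF tendsto_const tendsto_poly_laur_arg assms])
  then show ?thesis by (intro bigoI_tendsto[where c = "1 / coeff p 0"]) auto
qed

text \<open>The first eleven coefficients of the cleared equation vanish, so with m = 2 the residual
  has order (2 - 11) / 3 = -3. Dropping the fourth differences costs only u^(-10/3).\<close>

lemma link_residual:
  "(\<lambda>u. S_approx G \<alpha> (u + G / 2) + S_approx G \<alpha> (u - G / 2) - link_rhs G u (\<eta>_approx G \<alpha> u))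
      \<in> O(\<lambda>u. u powr (- 3))"
proof -
  let ?k = "G\<^sup>2" and ?v = "\<alpha> / 3"
  let ?A = "S_poly ?v ?k" and ?B = "eta_poly ?v ?k"
  let ?At = "second_diff_poly ?k 2 ?A"
  let ?R = "?At * (?B * ?B) - ?B - monom (1296 * ?k) 4"
  let ?y = "\<lambda>u::real. u powr (- 1 / 3) / 6"
  have 1: "(\<lambda>u. S_approx G \<alpha> (u + G / 2) + S_approx G \<alpha> (u - G / 2) - 2 * laur 2 ?At u)
      \<in> O(\<lambda>u. u powr (- 3))"
    unfolding S_approx_def by (rule landau_o.big.trans[OF laur_shift_add powr_bigo_powr]) simp
  have B0: "coeff ?B 0 = 1" by (rule eta_poly_coeffs(1))
  have "(\<lambda>u. 2 * laur 2 ?R u * (1 / poly (?B * ?B) (?y u))) \<in> O(\<lambda>u. u powr ((2 - real 11) / 3) * 1)"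
  proof (rule landau_o.big.mult)
    have "laur 2 ?R \<in> O(\<lambda>u. u powr ((2 - real 11) / 3))"
      by (rule laur_bigo_vanish) (rule link_residual_coeffs)
    then show "(\<lambda>u. 2 * laur 2 ?R u) \<in> O(\<lambda>u. u powr ((2 - real 11) / 3))" by simp
    show "(\<lambda>u. 1 / poly (?B * ?B) (?y u)) \<in> O(\<lambda>_. 1)"
      by (rule bigo_one_over_poly) (use B0 in \<open>simp add: coeff_mult\<close>)
  qed
  then have "(\<lambda>u. 2 * laur 2 ?R u * (1 / poly (?B * ?B) (?y u))) \<in> O(\<lambda>u. u powr (- 3))" by simp
  moreover have "eventually (\<lambda>u. 2 * laur 2 ?R u * (1 / poly (?B * ?B) (?y u)) =
      2 * laur 2 ?At u - link_rhs G u (\<eta>_approx G \<alpha> u)) at_top"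
    using eventually_gt_at_top[of 0] eventually_poly_pos[of ?B, unfolded B0, OF zero_less_one]
  proof eventually_elim
    case (elim u)
    define x where "x = u powr (1 / 3)"
    have x: "x > 0" "u = x ^ 3" "u powr (2 / 3) = x\<^sup>2" "u powr (- 1 / 3) = 1 / x"
      using elim by (simp_all add: x_def powr_third_power powr_minus_divide[symmetric])
    define b where "b = poly ?B (1 / x / 6)"
    have b: "b > 0" using elim(2)[unfolded x(4)] by (simp only: b_def)
    have "\<eta>_approx G \<alpha> u = x * b" 
      unfolding \<eta>_approx_def laur_def b_def x(4) x_def[symmetric] ..
    then have "link_rhs G u (\<eta>_approx G \<alpha> u) = 2 * x\<^sup>2 / b + 2 * ?k / (x\<^sup>2 * b\<^sup>2)"
      using x(1) by (simp add: link_rhs_def x(2) power_mult_distrib eval_nat_numeral)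
    moreover have "2 * laur 2 ?R u * (1 / poly (?B * ?B) (?y u)) =
      2 * (x\<^sup>2 * (poly ?At (1 / x / 6) * (b * b) - b - 1296 * ?k * (1 / x / 6) ^ 4)) / (b * b)"
      unfolding laur_def x(3,4) b_def by (simp add: poly_monom)
    moreover have "laur 2 ?At u = x\<^sup>2 * poly ?At (1 / x / 6)" unfolding laur_def x(3,4) ..
    moreover have "2 * (z * (a * (b * b) - b - c)) / (b * b) = 2 * (z * a) - (2 * z / b + 2 * z * c
        / (b * b))"
      for z a c using b by (simp add: field_simps)
    moreover have "2 * x\<^sup>2 * (1296 * ?k * (1 / x / 6) ^ 4) / (b * b) = 2 * ?k / (x\<^sup>2 * b\<^sup>2)"
      using x(1) b by (simp add: power_divide power2_eq_square eval_nat_numeral)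
    ultimately show ?case by simp
  qed
  ultimately have "(\<lambda>u. 2 * laur 2 ?At u - link_rhs G u (\<eta>_approx G \<alpha> u)) \<in> O(\<lambda>u. u powr (- 3))"
    by (subst (asm) landau_o.big.in_cong) auto
  from sum_in_bigo(1)[OF 1 this] show ?thesis by (simp add: add_diff_eq)
qed

text \<open>Here m = 1, so the residual has order (1 - 11) / 3, and the fourth differences cost
  u^(-11/3). Both residuals have relative size u^(-11/3).\<close>

lemma node_residual:
  "(\<lambda>u. \<eta>_approx G \<alpha> (u + G / 2) + \<eta>_approx G \<alpha> (u - G / 2) - node_rhs G \<alpha> u (S_approx G \<alpha> u))
      \<in> O(\<lambda>u. u powr (- 10 / 3))"
proof -
  let ?k = "G\<^sup>2" and ?v = "\<alpha> / 3"
  let ?A = "S_poly ?v ?k" and ?B = "eta_poly ?v ?k"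
  let ?Bt = "second_diff_poly ?k 1 ?B"
  let ?Q = "?A * ?A - monom (1296 * ?k) 4"
  let ?R = "?Bt * ?Q - ?A + monom (11664 * ?v * ?k) 5"
  let ?y = "\<lambda>u::real. u powr (- 1 / 3) / 6"
  have 1: "(\<lambda>u. \<eta>_approx G \<alpha> (u + G / 2) + \<eta>_approx G \<alpha> (u - G / 2) - 2 * laur 1 ?Bt u)
      \<in> O(\<lambda>u. u powr (- 10 / 3))"
    unfolding \<eta>_approx_def by (rule landau_o.big.trans[OF laur_shift_add powr_bigo_powr]) simp
  have Q0: "coeff ?Q 0 = 1" by (rule S_square_coeffs(1))
  have "(\<lambda>u. 2 * laur 1 ?R u * (1 / poly ?Q (?y u))) \<in> O(\<lambda>u. u powr ((1 - real 11) / 3) * 1)"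
  proof (rule landau_o.big.mult)
    have "laur 1 ?R \<in> O(\<lambda>u. u powr ((1 - real 11) / 3))"
      by (rule laur_bigo_vanish) (rule node_residual_coeffs)
    then show "(\<lambda>u. 2 * laur 1 ?R u) \<in> O(\<lambda>u. u powr ((1 - real 11) / 3))" by simp
    show "(\<lambda>u. 1 / poly ?Q (?y u)) \<in> O(\<lambda>_. 1)"
      by (rule bigo_one_over_poly) (use Q0 in simp)
  qed
  then have "(\<lambda>u. 2 * laur 1 ?R u * (1 / poly ?Q (?y u))) \<in> O(\<lambda>u. u powr (- 10 / 3))" by simp
  moreover have "eventually (\<lambda>u. 2 * laur 1 ?R u * (1 / poly ?Q (?y u)) =
      2 * laur 1 ?Bt u - node_rhs G \<alpha> u (S_approx G \<alpha> u)) at_top"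
    using eventually_gt_at_top[of 0] eventually_poly_pos[of ?Q, unfolded Q0, OF zero_less_one]
  proof eventually_elim
    case (elim u)
    define x where "x = u powr (1 / 3)"
    have x: "x > 0" "u = x ^ 3" "u powr (2 / 3) = x\<^sup>2" "u powr (- 1 / 3) = 1 / x"
      using elim by (simp_all add: x_def powr_third_power powr_minus_divide[symmetric])
    define a where "a = poly ?A (1 / x / 6)"
    define q where "q = a * a - 1296 * ?k * (1 / x / 6) ^ 4"
    have q: "q > 0" "poly ?Q (?y u) = q" using elim(2)[unfolded x(4)] unfolding q_def a_def x(4)
        by (simp_all add: poly_monom)
    have S: "S_approx G \<alpha> u = x\<^sup>2 * a" unfolding S_approx_def laur_def a_def x(3,4) ..
    have "(S_approx G \<alpha> u)\<^sup>2 - ?k = x ^ 4 * q"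
      using x(1) by (simp add: S q_def power_divide power_mult_distrib field_simps power2_eq_square
          eval_nat_numeral)
    moreover have "2 * u * S_approx G \<alpha> u - \<alpha> * ?k = 2 * x * x ^ 4 * (a - 11664 * ?v * ?k * (1 / x
        / 6) ^ 5)"
      unfolding S using x(1) by (simp add: x(2) power_divide field_simps eval_nat_numeral)
    ultimately have "node_rhs G \<alpha> u (S_approx G \<alpha> u) = 2 * x * (a - 11664 * ?v * ?k * (1 / x
        / 6) ^ 5) / q"
      using x(1) by (simp add: node_rhs_def)
    moreover have "2 * laur 1 ?R u * (1 / poly ?Q (?y u)) =
      2 * (x * (poly ?Bt (1 / x / 6) * q - a + 11664 * ?v * ?k * (1 / x / 6) ^ 5)) / q"
      
      unfolding q(2) unfolding laur_def x(4) x_def[symmetric] a_def q_def by (simp add: poly_monom)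
    moreover have "laur 1 ?Bt u = x * poly ?Bt (1 / x / 6)" 
      unfolding laur_def x(4) x_def[symmetric] ..
    moreover have "2 * (z * (b * q - a + c)) / q = 2 * (z * b) - 2 * z * (a - c) / q"
      for z b c using q by (simp add: field_simps)
    ultimately show ?case by simp
  qed
  ultimately have "(\<lambda>u. 2 * laur 1 ?Bt u - node_rhs G \<alpha> u (S_approx G \<alpha> u)) \<in> O(\<lambda>u. u powr (- 10
      / 3))"
    by (subst (asm) landau_o.big.in_cong) auto
  from sum_in_bigo(1)[OF 1 this] show ?thesis by (simp add: add_diff_eq)
qed

section \<open>Existence of barriers\<close>

text \<open>Stated for all large constants, finitely many such bounds can be intersected to obtain
  one common constant.\<close>

lemma bigo_eventually_bound:
  assumes "f \<in> O[at_top](g)"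
  shows "eventually (\<lambda>c. eventually (\<lambda>u. \<bar>f u\<bar> \<le> c * \<bar>g u\<bar>) at_top) (at_top :: real filter)"
proof -
  obtain C where C: "eventually (\<lambda>u. norm (f u) \<le> C * norm (g u)) at_top"
    using assms by (auto elim!: landau_o.bigE)
  show ?thesis
    using eventually_ge_at_top[of C]
  proof eventually_elim
    case (elim c)
    show ?case
      using C
    proof eventually_elim
      case (elim u)
      have "C * \<bar>g u\<bar> \<le> c * \<bar>g u\<bar>" using \<open>C \<le> c\<close> by (intro mult_right_mono) auto
      with elim show ?case by simp
    qed
  qed
qed

text \<open>The exponent \<open>-7/3\<close> is the relative accuracy of the formal solution; the linear term dominates the
  a priori bounds at infinity and is removed in the end by \<open>\<delta> \<rightarrow> 0\<close>.\<close>

definition barrier_weight :: "real \<Rightarrow> real \<Rightarrow> real \<Rightarrow> real" where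
  "barrier_weight D \<delta> u = D * u powr (- 7 / 3) + \<delta> * u"

definition slow_weight_at :: "real \<Rightarrow> real \<Rightarrow> (real \<Rightarrow> real) \<Rightarrow> real \<Rightarrow> bool" where
  "slow_weight_at c d W u \<longleftrightarrow> \<bar>W (u + d) - W u\<bar> \<le> c * W u / u \<and> \<bar>W (u - d) - W u\<bar> \<le> c * W u / u \<and>
     \<bar>W (u + d) + W (u - d) - 2 * W u\<bar> \<le> c * W u / u\<^sup>2"

text \<open>The constant must be uniform in D and \<delta>. Both parts of the weight satisfy the
  bounds separately and the bounds are linear in the weight; the linear part has increment \<delta>
  d and no second difference.\<close>

lemma barrier_weight_slow:
  fixes d :: real
  assumes "d \<ge> 0"
  shows "eventually (\<lambda>c. eventually (\<lambda>u. \<forall>D\<ge>0. \<forall>\<delta>\<ge>0. slow_weight_at c d (barrier_weight D \<delta>) u)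
      at_top) at_top"
proof -
  let ?p = "\<lambda>u::real. u powr (- 7 / 3)"
  let ?q = "- 7 / 3 :: real"
  have second: "(\<lambda>u. ?p (u + d) + ?p (u - d) - 2 * ?p u) \<in> O(\<lambda>u. u powr (?q - 2))"
  proof -
    have "(\<lambda>u. ?p (u + d) + ?p (u - d) - 2 * ?p u - d\<^sup>2 * ?q * (?q - 1) * u powr (?q - 2))
        \<in> O(\<lambda>u. u powr (?q - 2))"
      by (rule landau_o.big.trans[OF powr_shift_bounds(1) powr_bigo_powr]) simp
    moreover have "(\<lambda>u. d\<^sup>2 * ?q * (?q - 1) * u powr (?q - 2)) \<in> O(\<lambda>u. u powr (?q - 2))"
      by (cases "d = 0") auto
    ultimately have "(\<lambda>u. (?p (u + d) + ?p (u - d) - 2 * ?p u - d\<^sup>2 * ?q * (?q - 1) * u powr (?q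
        - 2))
       + d\<^sup>2 * ?q * (?q - 1) * u powr (?q - 2)) \<in> O(\<lambda>u. u powr (?q - 2))" by (rule sum_in_bigo)
    then show ?thesis by (simp only: diff_add_cancel)
  qed
  have diff: "(\<lambda>u. ?p (u + d) - ?p (u - d)) \<in> O(\<lambda>u. u powr (?q - 1))"
  proof -
    have "(\<lambda>u. ?p (u + d) - ?p (u - d) - 2 * d * ?q * u powr (?q - 1)) \<in> O(\<lambda>u. u powr (?q - 1))"
      by (rule landau_o.big.trans[OF powr_shift_bounds(2) powr_bigo_powr]) simp
    moreover have "(\<lambda>u. 2 * d * ?q * u powr (?q - 1)) \<in> O(\<lambda>u. u powr (?q - 1))"
      by (cases "d = 0") auto
    ultimately have "(\<lambda>u. (?p (u + d) - ?p (u - d) - 2 * d * ?q * u powr (?q - 1))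
       + 2 * d * ?q * u powr (?q - 1)) \<in> O(\<lambda>u. u powr (?q - 1))" by (rule sum_in_bigo)
    then show ?thesis by (simp only: diff_add_cancel)
  qed
  have second': "(\<lambda>u. ?p (u + d) + ?p (u - d) - 2 * ?p u) \<in> O(\<lambda>u. u powr (?q - 1))"
    by (rule landau_o.big.trans[OF second powr_bigo_powr]) simp
  have first: "(\<lambda>u. ?p (u + d) - ?p u) \<in> O(\<lambda>u. u powr (?q - 1))"
  proof -
    have "(\<lambda>u. (1 / 2) * ((?p (u + d) + ?p (u - d) - 2 * ?p u) + (?p (u + d) - ?p (u - d))))
        \<in> O(\<lambda>u. u powr (?q - 1))" (is "?f \<in> _")
      using sum_in_bigo(1)[OF second' diff] by simp
    moreover have "?f = (\<lambda>u. ?p (u + d) - ?p u)" by (intro ext) (simp add: field_simps)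
    ultimately show ?thesis by (simp only:)
  qed
  have first': "(\<lambda>u. ?p (u - d) - ?p u) \<in> O(\<lambda>u. u powr (?q - 1))"
  proof -
    have "(\<lambda>u. (1 / 2) * ((?p (u + d) + ?p (u - d) - 2 * ?p u) - (?p (u + d) - ?p (u - d))))
        \<in> O(\<lambda>u. u powr (?q - 1))" (is "?f \<in> _")
      using sum_in_bigo(2)[OF second' diff] by simp
    moreover have "?f = (\<lambda>u. ?p (u - d) - ?p u)" by (intro ext) (simp add: field_simps)
    ultimately show ?thesis by (simp only:)
  qed
  show ?thesis
    using bigo_eventually_bound[OF second] bigo_eventually_bound[OF first] bigo_eventually_bound[OF
        first']
      eventually_ge_at_top[of d] eventually_ge_at_top[of 0]
  proof eventually_elim
    case (elim c)
    show ?case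
      using elim(1-3) eventually_gt_at_top[of 0]
    proof eventually_elim
      case (elim u)
      have pw: "u powr (q - 1) = u powr q / u" "u powr (q - 2) = u powr q / u\<^sup>2" for q
        using elim(4) by (simp_all add: powr_diff powr_numeral)
      have b: "\<bar>?p (u + d) + ?p (u - d) - 2 * ?p u\<bar> \<le> c * (?p u / u\<^sup>2)"
        "\<bar>?p (u + d) - ?p u\<bar> \<le> c * (?p u / u)" "\<bar>?p (u - d) - ?p u\<bar> \<le> c * (?p u / u)"
        using elim unfolding pw by simp_all
      show ?case
        unfolding slow_weight_at_def
      proof (intro allI impI conjI)
        fix D \<delta> :: real assume D: "D \<ge> 0" and \<delta>: "\<delta> \<ge> 0"
        have lin: "\<delta> * d \<le> \<delta> * c" using \<delta> \<open>d \<le> c\<close> by (rule mult_left_mono[rotated])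
        have tri: "\<bar>D * a + e\<bar> \<le> c * (D * p + \<delta> * u) / u" if "\<bar>a\<bar> \<le> c * (p / u)" "\<bar>e\<bar> \<le> \<delta>
            * d" for a e p
        proof -
          have "\<bar>D * a + e\<bar> \<le> D * \<bar>a\<bar> + \<bar>e\<bar>"
            using D abs_triangle_ineq[of "D * a" e] by (simp add: abs_mult)
          also have "\<dots> \<le> D * (c * (p / u)) + \<delta> * c"
            using that lin D by (intro add_mono mult_left_mono) auto
          also have "\<dots> = c * (D * p + \<delta> * u) / u" using elim(4) by (simp add: field_simps)
          finally show ?thesis .
        qed
        show "\<bar>barrier_weight D \<delta> (u + d) - barrier_weight D \<delta> u\<bar> \<le> c * barrier_weight D \<delta> u / u"
          using tri[OF b(2), of "\<delta> * d"] assms \<delta> by (simp add: barrier_weight_def algebra_simps)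
        show "\<bar>barrier_weight D \<delta> (u - d) - barrier_weight D \<delta> u\<bar> \<le> c * barrier_weight D \<delta> u / u"
          using tri[OF b(3), of "- (\<delta> * d)"] assms \<delta> by (simp add: barrier_weight_def algebra_simps)
        have "barrier_weight D \<delta> (u + d) + barrier_weight D \<delta> (u - d) - 2 * barrier_weight D \<delta> u =
            D * (?p (u + d) + ?p (u - d) - 2 * ?p u)"
          by (simp add: barrier_weight_def algebra_simps)
        also have "\<bar>\<dots>\<bar> \<le> D * (c * (?p u / u\<^sup>2))"
          using mult_left_mono[OF b(1) D] D by (simp add: abs_mult)
        also have "\<dots> \<le> c * barrier_weight D \<delta> u / u\<^sup>2"
          using \<delta> elim(4) \<open>0 \<le> c\<close> by (simp add: barrier_weight_def field_simps)
        finally show "\<bar>barrier_weight D \<delta> (u + d) + barrier_weight D \<delta> (u - d) - 2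
            * barrier_weight D \<delta> u\<bar>
          \<le> c * barrier_weight D \<delta> u / u\<^sup>2" .
      qed
    qed
  qed
qed

lemma eventually_at_top_shift:
  fixes d :: real
  assumes "eventually P at_top"
  shows "eventually (\<lambda>u. P (u + d)) at_top"
proof -
  obtain N where "\<And>u. u \<ge> N \<Longrightarrow> P u" using assms by (auto simp: eventually_at_top_linorder)
  then show ?thesis by (auto simp: eventually_at_top_linorder intro!: exI[of _ "N - d"])
qed

lemma S_approx_between:
  "eventually (\<lambda>u. u powr (2 / 3) / 2 \<le> S_approx G \<alpha> u \<and> S_approx G \<alpha> u \<le> 2 * u powr (2
      / 3)) at_top"
  unfolding S_approx_def by (rule laur_between) (rule S_poly_coeffs(1))

lemma \<eta>_approx_between:
  "eventually (\<lambda>u. u powr (1 / 3) / 2 \<le> \<eta>_approx G \<alpha> u \<and> \<eta>_approx G \<alpha> u \<le> 2 * u powr (1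
      / 3)) at_top"
  unfolding \<eta>_approx_def by (rule laur_between) (rule eta_poly_coeffs(1))

lemma S_approx_pos: "eventually (\<lambda>u. S_approx G \<alpha> u > 0) at_top"
  using S_approx_between[of G \<alpha>] eventually_gt_at_top[of 0]
  by eventually_elim (smt (verit) divide_pos_pos powr_gt_zero)

lemma \<eta>_approx_pos: "eventually (\<lambda>u. \<eta>_approx G \<alpha> u > 0) at_top"
  using \<eta>_approx_between[of G \<alpha>] eventually_gt_at_top[of 0]
  by eventually_elim (smt (verit) divide_pos_pos powr_gt_zero)

text \<open>The hypotheses of both comparison lemmas: \<open>u\<close> is a link position in the
  first two inequalities and a node in the last two. The premise of the fourth matches that of
  \<open>lower_comparison\<close>.\<close>

definition barrier_at :: "real \<Rightarrow> real \<Rightarrow> (real \<Rightarrow> real) \<Rightarrow> real \<Rightarrow> bool" where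
  "barrier_at G \<alpha> W u \<longleftrightarrow>
     S_approx G \<alpha> (u + G / 2) * (1 + W (u + G / 2)) + S_approx G \<alpha> (u - G / 2) * (1 + W (u - G / 2))
         \<le> link_rhs G u (\<eta>_approx G \<alpha> u / (1 + W u)) \<and>
     link_rhs G u (\<eta>_approx G \<alpha> u * (1 + W u)) \<le> S_approx G \<alpha> (u + G / 2) / (1 + W (u + G / 2))
         + S_approx G \<alpha> (u - G / 2) / (1 + W (u - G / 2)) \<and>
     node_rhs G \<alpha> u (S_approx G \<alpha> u * (1 + W u)) \<le> \<eta>_approx G \<alpha> (u + G / 2) / (1 + W (u + G / 2))
         + \<eta>_approx G \<alpha> (u - G / 2) / (1 + W (u - G / 2)) \<and>
     (S_approx G \<alpha> u / (1 + W u) > G \<longrightarrow>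
       \<eta>_approx G \<alpha> (u + G / 2) * (1 + W (u + G / 2)) + \<eta>_approx G \<alpha> (u - G / 2) * (1 + W (u - G
           / 2)) \<le> node_rhs G \<alpha> u (S_approx G \<alpha> u / (1 + W u)))"

text \<open>The order of quantifiers matters: the threshold for u must not depend on D or \<delta>,
  because D is enlarged after the starting index has been fixed and \<delta> is sent to 0
  afterwards.\<close>

lemma eventually_barrier:
  fixes G \<alpha> :: real
  assumes G_pos: "G > 0"
  shows "eventually (\<lambda>D0. eventually (\<lambda>u. \<forall>D\<ge>D0. \<forall>\<delta>\<ge>0. barrier_at G \<alpha> (barrier_weight D \<delta>) u)
      at_top) at_top"
proof -
  let ?SA = "S_approx G \<alpha>" and ?EA = "\<eta>_approx G \<alpha>"
  let ?d = "G / 2"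
  have shift: "eventually (\<lambda>u. P (u + ?d) \<and> P (u - ?d)) at_top" if "eventually P at_top" for P ::
      "real \<Rightarrow> bool"
    using eventually_at_top_shift[OF that, of ?d] eventually_at_top_shift[OF that, of "- ?d"]
    by eventually_elim simp
  have b1: "(\<lambda>u. ?SA (u + ?d) - ?SA (u - ?d)) \<in> O(\<lambda>u. u powr (- 1 / 3))"
    using laur_shift_diff_bigo[of 2] unfolding S_approx_def by simp
  have b2: "(\<lambda>u. ?EA (u + ?d) - ?EA (u - ?d)) \<in> O(\<lambda>u. u powr (- 2 / 3))"
    using laur_shift_diff_bigo[of 1] unfolding \<eta>_approx_def by simp
  have b3: "(\<lambda>u. ?SA (u + ?d) + ?SA (u - ?d)) \<in> O(\<lambda>u. u powr (2 / 3))"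
    unfolding S_approx_def by (rule laur_shift_add_bigo)
  have b4: "(\<lambda>u. ?EA (u + ?d) + ?EA (u - ?d)) \<in> O(\<lambda>u. u powr (1 / 3))"
    unfolding \<eta>_approx_def by (rule laur_shift_add_bigo)
  note b5 = link_residual[of G \<alpha>] and b6 = node_residual[of G \<alpha>]
  let ?P = "\<lambda>c u. \<bar>?SA (u + ?d) - ?SA (u - ?d)\<bar> \<le> c * \<bar>u powr (- 1 / 3)\<bar>"
    and ?Q = "\<lambda>c u. \<bar>?EA (u + ?d) - ?EA (u - ?d)\<bar> \<le> c * \<bar>u powr (- 2 / 3)\<bar>"
    and ?P' = "\<lambda>c u. \<bar>?SA (u + ?d) + ?SA (u - ?d)\<bar> \<le> c * \<bar>u powr (2 / 3)\<bar>"
    and ?Q' = "\<lambda>c u. \<bar>?EA (u + ?d) + ?EA (u - ?d)\<bar> \<le> c * \<bar>u powr (1 / 3)\<bar>"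
    and ?R = "\<lambda>c u. \<bar>?SA (u + ?d) + ?SA (u - ?d) - link_rhs G u (?EA u)\<bar> \<le> c * \<bar>u powr (- 3)\<bar>"
    and ?R' = "\<lambda>c u. \<bar>?EA (u + ?d) + ?EA (u - ?d) - node_rhs G \<alpha> u (?SA u)\<bar> \<le> c * \<bar>u powr (- 10
        / 3)\<bar>"
    and ?W = "\<lambda>c u. \<forall>D\<ge>0. \<forall>\<delta>\<ge>0. slow_weight_at c ?d (barrier_weight D \<delta>) u"
  have "eventually (\<lambda>c. c \<ge> 2 \<and> eventually (?P c) at_top \<and> eventually (?Q c) at_top \<and>
      eventually (?P' c) at_top \<and> eventually (?Q' c) at_top \<and> eventually (?R c) at_top \<and>
      eventually (?R' c) at_top \<and> eventually (?W c) at_top) (at_top :: real filter)"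
    using G_pos by (intro eventually_conj eventually_ge_at_top bigo_eventually_bound b1 b2 b3 b4 b5
        b6
        barrier_weight_slow) auto
  from eventually_happens'[OF trivial_limit_at_top_linorder this]
  obtain c where c: "c \<ge> 2"
    and c1: "eventually (?P c) at_top" and c2: "eventually (?Q c) at_top"
    and c3: "eventually (?P' c) at_top" and c4: "eventually (?Q' c) at_top"
    and c5: "eventually (?R c) at_top" and c6: "eventually (?R' c) at_top"
    and c7: "eventually (?W c) at_top"
    by blast
  have large: "eventually (\<lambda>u::real. u powr (1 / 3) \<ge> K) at_top" for K
    by real_asymp
  \<comment> \<open>The sum of all lower bounds required by \<open>barrier_point\<close>; since x
    \<ge> 1, every positive power of x exceeds it together with x.\<close>
  define K where "K = 1 + 2 * c + 24 * c ^ 6 / G\<^sup>2 + 4 * c ^ 4 / G\<^sup>2 + 2 * \<bar>\<alpha>\<bar> * c + c * G + 1"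
  \<comment> \<open>The bound on \<open>D0\<close> makes the decaying part D / x^7 alone satisfy
    \<open>W_ge\<close>, for every \<delta> \<ge> 0.\<close>
  show ?thesis
    using eventually_ge_at_top[of "4 * c ^ 4 / G\<^sup>2"]
  proof eventually_elim
    case (elim D0)
    show ?case
      using c1 c2 c3 c4 c5 c6 c7 large[of K] eventually_gt_at_top[of 0]
        S_approx_between[of G \<alpha>] \<eta>_approx_between[of G \<alpha>]
        shift[OF S_approx_pos[of G \<alpha>]] shift[OF \<eta>_approx_pos[of G \<alpha>]]
    proof eventually_elim
      case (elim u)
      define x where "x = u powr (1 / 3)"
      have u: "u > 0" using elim by simp
      have x: "x > 0" "u = x ^ 3" using u by (simp_all add: x_def powr_third_power)
      have neg: "u powr (- (real n / 3)) = 1 / x ^ n" for n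
        using u by (simp add: x_def powr_third_power powr_minus_divide)
      have pw: "u powr (1 / 3) = x" "u powr (2 / 3) = x\<^sup>2" "u powr (- 1 / 3) = 1 / x" "u powr (- 2
          / 3) = 1 / x\<^sup>2"
        "u powr (- 3) = 1 / x ^ 9" "u powr (- 10 / 3) = 1 / x ^ 10" "u powr (- 7 / 3) = 1 / x ^ 7"
        using neg[of 1] neg[of 2] neg[of 9] neg[of 10] neg[of 7] powr_third_power[OF u, of 2]
        by (simp_all add: x_def)
      have "K \<ge> 1" using c G_pos by (simp add: K_def)
      have xK: "x \<ge> K" using elim(8) unfolding pw .
      then have x1: "x \<ge> 1" using \<open>K \<ge> 1\<close> by simp
      have xp: "x ^ n \<ge> K" if "n \<ge> 1" for n
        using xK x1 power_increasing[OF that x1] by simp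
      have nn: "c \<ge> 0" "24 * c ^ 6 / G\<^sup>2 \<ge> 0" "4 * c ^ 4 / G\<^sup>2 \<ge> 0" "\<bar>\<alpha>\<bar> * c \<ge> 0" "c * G > 0"
        using c G_pos by auto
      have pt: "barrier_point c x (barrier_weight D \<delta> u) (barrier_weight D \<delta> (u
          + ?d)) (barrier_weight D \<delta> (u - ?d)) G \<alpha>"
        if D: "D \<ge> D0" and \<delta>: "\<delta> \<ge> 0" for D \<delta>
      proof unfold_locales
        have D': "D \<ge> 4 * c ^ 4 / G\<^sup>2" using D \<open>4 * c ^ 4 / G\<^sup>2 \<le> D0\<close> by simp
        then have "D > 0" using c G_pos by (intro less_le_trans[OF _ D']) simp
        then show "0 < barrier_weight D \<delta> u" using u \<delta> by (simp add: barrier_weight_def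
            add_pos_nonneg)
        have "4 * c ^ 4 / G\<^sup>2 / x ^ 7 \<le> D / x ^ 7" using D' x by (intro divide_right_mono) auto
        also have "\<dots> \<le> barrier_weight D \<delta> u" using \<delta> u unfolding barrier_weight_def pw by simp
        finally show "4 * c ^ 4 / G\<^sup>2 / x ^ 7 \<le> barrier_weight D \<delta> u" .
        have W: "\<bar>barrier_weight D \<delta> (u + ?d) - barrier_weight D \<delta> u\<bar> \<le> c * barrier_weight D \<delta> u
            / u"
          "\<bar>barrier_weight D \<delta> (u - ?d) - barrier_weight D \<delta> u\<bar> \<le> c * barrier_weight D \<delta> u / u"
          "\<bar>barrier_weight D \<delta> (u + ?d) + barrier_weight D \<delta> (u - ?d) - 2 * barrier_weight D \<delta> u\<bar>
          \<le> c * barrier_weight D \<delta> u / u\<^sup>2"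
          using elim(7) \<open>D > 0\<close> \<delta> unfolding slow_weight_at_def by auto
        have "u\<^sup>2 = x ^ 6" unfolding x(2) by simp
        then show "\<bar>barrier_weight D \<delta> (u + ?d) - barrier_weight D \<delta> u\<bar> \<le> c * barrier_weight D \<delta> u
            / x ^ 3"
          "\<bar>barrier_weight D \<delta> (u - ?d) - barrier_weight D \<delta> u\<bar> \<le> c * barrier_weight D \<delta> u / x ^ 3"
          "\<bar>barrier_weight D \<delta> (u + ?d) + barrier_weight D \<delta> (u - ?d) - 2 * barrier_weight D \<delta> u\<bar>
          \<le> c * barrier_weight D \<delta> u / x ^ 6"
          using W x(2) by simp_all
        show "1 \<le> c" "0 < x" "0 < G" using c x G_pos by auto
        show "2 * c \<le> x ^ 3" "24 * c ^ 6 / G\<^sup>2 \<le> x\<^sup>2" "4 * c ^ 4 / G\<^sup>2 \<le> x ^ 7" "2 * \<bar>\<alpha>\<bar> * c \<le> x" "c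
            * G < x\<^sup>2"
          using xp[of 3] xp[of 2] xp[of 7] xK nn unfolding K_def by linarith+
      qed
      have S: "x\<^sup>2 / c \<le> ?SA u" "?SA u \<le> c * x\<^sup>2"
      proof -
        have "x\<^sup>2 / c \<le> x\<^sup>2 / 2" using c by (intro divide_left_mono) auto
        then show "x\<^sup>2 / c \<le> ?SA u" using elim(10) unfolding pw by linarith
        have "2 * x\<^sup>2 \<le> c * x\<^sup>2" using c by (intro mult_right_mono) auto
        then show "?SA u \<le> c * x\<^sup>2" using elim(10) unfolding pw by linarith
      qed
      have E: "0 < ?EA u" "?EA u \<le> c * x"
      proof -
        show "0 < ?EA u" using elim(11) x unfolding pw by linarith
        have "2 * x \<le> c * x" using c x by (intro mult_right_mono) auto
        then show "?EA u \<le> c * x" using elim(11) unfolding pw by linarith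
      qed
      have Sb: "0 \<le> ?SA (u + ?d)" "0 \<le> ?SA (u - ?d)" "?SA (u + ?d) \<le> c * x\<^sup>2" "?SA (u - ?d) \<le> c
          * x\<^sup>2"
        "\<bar>?SA (u + ?d) - ?SA (u - ?d)\<bar> \<le> c / x"
        using elim(1,3,12) x unfolding pw by auto
      have Eb: "0 \<le> ?EA (u + ?d)" "0 \<le> ?EA (u - ?d)" "?EA (u + ?d) \<le> c * x" "?EA (u - ?d) \<le> c * x"
        "\<bar>?EA (u + ?d) - ?EA (u - ?d)\<bar> \<le> c / x\<^sup>2"
        using elim(2,4,13) x unfolding pw by auto
      have "\<bar>?SA (u + ?d) + ?SA (u - ?d) - link_rhs G u (?EA u)\<bar> \<le> c / x ^ 9"
        using elim(5) x unfolding pw by simp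
      then have Sr: "?SA (u + ?d) + ?SA (u - ?d) \<le> link_rhs G u (?EA u) + c / x ^ 9"
        "?SA (u + ?d) + ?SA (u - ?d) \<ge> link_rhs G u (?EA u) - c / x ^ 9" by linarith+
      have "\<bar>?EA (u + ?d) + ?EA (u - ?d) - node_rhs G \<alpha> (x ^ 3) (?SA u)\<bar> \<le> c / x ^ 10"
        using elim(6) x unfolding pw by simp
      then have Er: "?EA (u + ?d) + ?EA (u - ?d) \<le> node_rhs G \<alpha> (x ^ 3) (?SA u) + c / x ^ 10"
        "?EA (u + ?d) + ?EA (u - ?d) \<ge> node_rhs G \<alpha> (x ^ 3) (?SA u) - c / x ^ 10" by linarith+
      show ?case
        unfolding barrier_at_def
      proof (intro allI impI, goal_cases)
        case (1 D \<delta>)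
        interpret barrier_point c x "barrier_weight D \<delta> u" "barrier_weight D \<delta> (u + ?d)"
          "barrier_weight D \<delta> (u - ?d)" G \<alpha>
          using 1 by (rule pt)
        show ?case
          using link_upper[OF Sb E Sr(1)] link_lower[OF Sb E Sr(2)]
            node_upper[OF Eb S Er(2)] node_lower[OF Eb S Er(1)] unfolding x(2)[symmetric] by blast
      qed
    qed
  qed
qed

section \<open>Asymptotics of the positive solution\<close>

context positive_discrete_system
begin

lemma U_Suc: "U (Suc n) = U n + G"
  by (simp add: U_def algebra_simps)

lemma U_at_top: "filterlim U at_top sequentially"
  unfolding U_def using G_pos by real_asymp

text \<open>These are the comparisons at the far end. The approximation grows like u^(2/3):
  multiplied by \<delta> u it exceeds the linear bound on \<open>S\<close>, while unmultiplied it
  stays below G \<delta> u, and S > G.\<close>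

lemma S_negligible:
  assumes "\<delta> > 0"
  shows "eventually (\<lambda>n. S n \<le> S_approx G \<alpha> (U n) * (\<delta> * U n)) sequentially"
    and "eventually (\<lambda>n. S_approx G \<alpha> (U n) \<le> S n * (\<delta> * U n)) sequentially"
proof -
  obtain C where C: "C > 0" "\<And>n. S (Suc n) \<le> C * (U (Suc n) + 1)" by (rule S_growth) blast
  have "eventually (\<lambda>u::real. 2 * C / \<delta> \<le> u powr (2 / 3) / 2) at_top" by real_asymp
  with S_approx_between[of G \<alpha>] have "eventually (\<lambda>u. 2 * C / \<delta> \<le> S_approx G \<alpha> u) at_top"
    by eventually_elim simp
  with eventually_ge_at_top[of 1] have "eventually (\<lambda>u. 1 \<le> u \<and> 2 * C / \<delta> \<le> S_approx G \<alpha> u) at_top"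
    by eventually_elim simp
  then have "eventually (\<lambda>n. 1 \<le> U n \<and> 2 * C / \<delta> \<le> S_approx G \<alpha> (U n)) sequentially"
    using U_at_top by (rule eventually_compose_filterlim)
  then show "eventually (\<lambda>n. S n \<le> S_approx G \<alpha> (U n) * (\<delta> * U n)) sequentially"
    using eventually_gt_at_top[of 0]
  proof eventually_elim
    case (elim n)
    have "S n \<le> C * (U n + 1)" using C(2)[of "n - 1"] elim by simp
    also have "\<dots> \<le> C * (2 * U n)" using elim C(1) by (intro mult_left_mono) auto
    also have "\<dots> = (2 * C / \<delta>) * (\<delta> * U n)" using assms by simp
    also have "\<dots> \<le> S_approx G \<alpha> (U n) * (\<delta> * U n)"
      using elim assms by (intro mult_right_mono) auto
    finally show ?case .
  qed
  have "eventually (\<lambda>u::real. 2 * u powr (2 / 3) \<le> G * \<delta> * u) at_top"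
    using G_pos assms by real_asymp
  with S_approx_between[of G \<alpha>] have "eventually (\<lambda>u. S_approx G \<alpha> u \<le> G * \<delta> * u) at_top"
    by eventually_elim simp
  then have "eventually (\<lambda>n. S_approx G \<alpha> (U n) \<le> G * \<delta> * U n) sequentially"
    using U_at_top by (rule eventually_compose_filterlim)
  then show "eventually (\<lambda>n. S_approx G \<alpha> (U n) \<le> S n * (\<delta> * U n)) sequentially"
  proof eventually_elim
    case (elim n)
    have "G * (\<delta> * U n) \<le> S n * (\<delta> * U n)"
      using S_gt[of n] U_pos[of n] assms by (intro mult_right_mono) auto
    with elim show ?case by (simp add: mult.assoc)
  qed
qed

lemma barrier_weight_pos: "D > 0 \<Longrightarrow> \<delta> \<ge> 0 \<Longrightarrow> u > 0 \<Longrightarrow> barrier_weight D \<delta> u > 0"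
  by (simp add: barrier_weight_def add_pos_nonneg)

lemma le_of_le_add_mult:
  fixes s a b :: real
  assumes "b > 0" "\<And>\<delta>. \<delta> > 0 \<Longrightarrow> s \<le> a + \<delta> * b"
  shows "s \<le> a"
proof (rule field_le_epsilon)
  fix e :: real assume "e > 0"
  then show "s \<le> a + e" using assms(2)[of "e / b"] assms(1) by simp
qed

text \<open>The starting index \<open>m\<close> comes from the threshold, \<open>D\<close> from the
  data at \<open>m\<close>, and the far end \<open>N\<close> from \<delta>. As \<open>D\<close> and
  \<open>m\<close> are independent of \<delta>, the limit can be taken at each fixed index.\<close>

lemma ratio_bounds:
  obtains D m where "D > 0"
    "\<And>n. n \<ge> m \<Longrightarrow> S n \<le> S_approx G \<alpha> (U n) * (1 + D * U n powr (- 7 / 3))"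
    "\<And>n. n \<ge> m \<Longrightarrow> S_approx G \<alpha> (U n) \<le> S n * (1 + D * U n powr (- 7 / 3))"
    "\<And>n. n \<ge> m \<Longrightarrow> \<eta> n \<le> \<eta>_approx G \<alpha> (U n + G / 2) * (1 + D * (U n + G / 2) powr (- 7 / 3))"
    "\<And>n. n \<ge> m \<Longrightarrow> \<eta>_approx G \<alpha> (U n + G / 2) \<le> \<eta> n * (1 + D * (U n + G / 2) powr (- 7 / 3))"
proof -
  let ?SA = "S_approx G \<alpha>" and ?EA = "\<eta>_approx G \<alpha>" and ?d = "G / 2"
  let ?P = "\<lambda>D0 u. \<forall>D\<ge>D0. \<forall>\<delta>\<ge>0. barrier_at G \<alpha> (barrier_weight D \<delta>) u"
  obtain D0 where D0: "eventually (?P D0) at_top"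
    using eventually_happens'[OF trivial_limit_at_top_linorder eventually_barrier[OF G_pos, of \<alpha>]]
        by blast
  have "eventually (\<lambda>u::real. 2 * (G + 1) < u powr (2 / 3)) at_top" by real_asymp
  with S_approx_between[of G \<alpha>] have SG: "eventually (\<lambda>u. G < ?SA u) at_top"
  proof eventually_elim
    case (elim u)
    then have "2 * (G + 1) < 2 * ?SA u" by simp
    then show ?case by simp
  qed
  from D0 SG \<eta>_approx_pos[of G \<alpha>]
  have "eventually (\<lambda>u. ?P D0 u \<and> G < ?SA u \<and> 0 < ?EA u) at_top" by eventually_elim blast
  then obtain u0 where u0: "\<And>u. u \<ge> u0 \<Longrightarrow> ?P D0 u" "\<And>u. u \<ge> u0 \<Longrightarrow> G < ?SA u" "\<And>u. u \<ge> u0 \<Longrightarrow> 0 < ?EA u"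
    unfolding eventually_at_top_linorder by blast
  have "eventually (\<lambda>n. U n \<ge> u0) sequentially"
    using U_at_top by (auto simp: filterlim_at_top)
  then obtain m where m: "\<And>n. n \<ge> m \<Longrightarrow> U n \<ge> u0" unfolding eventually_sequentially by blast
  define z where "z = U m powr (7 / 3)"
  have z: "z > 0" "U m powr (- 7 / 3) = 1 / z"
    using U_pos[of m] by (simp_all add: z_def powr_minus_divide)
  \<comment> \<open>At \<open>m\<close> the decaying part of the weight equals D / z; the last two
    entries make it dominate both ratios there, whatever \<delta> \<ge> 0 is.\<close>
  define D where "D = max (max 1 D0) (max (z * (S m / ?SA (U m))) (z * (?SA (U m) / S m)))"
  have D: "D \<ge> 1" "D \<ge> D0" "z * (S m / ?SA (U m)) \<le> D" "z * (?SA (U m) / S m) \<le> D"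
    unfolding D_def by linarith+
  have SA_pos: "?SA (U n) > 0" if "n \<ge> m" for n using u0(2)[OF m[OF that]] G_pos by simp
  have EA_pos: "?EA (U n + ?d) > 0" if "n \<ge> m" for n using u0(3)[of "U n + ?d"] m[OF that] G_pos
      by simp
  have W_pos: "barrier_weight D \<delta> (U n) > 0" "barrier_weight D \<delta> (U n + ?d) > 0" if "\<delta> \<ge> 0" for n \<delta>
    using barrier_weight_pos[of D \<delta>] D(1) U_pos[of n] G_pos that by auto
  have start: "S m \<le> ?SA (U m) * (1 + barrier_weight D \<delta> (U m))"
    "?SA (U m) \<le> S m * (1 + barrier_weight D \<delta> (U m))" if \<delta>: "\<delta> \<ge> 0" for \<delta>
  proof -
    have W: "D / z \<le> 1 + barrier_weight D \<delta> (U m)"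
      unfolding barrier_weight_def z(2) using mult_nonneg_nonneg[OF \<delta> less_imp_le[OF U_pos[of m]]]
          by simp
    have "S m / ?SA (U m) \<le> D / z" using D(3) z(1) by (simp add: pos_le_divide_eq mult.commute)
    then have "S m / ?SA (U m) \<le> 1 + barrier_weight D \<delta> (U m)" using W by linarith
    then show "S m \<le> ?SA (U m) * (1 + barrier_weight D \<delta> (U m))"
      using SA_pos[of m] by (simp add: pos_divide_le_eq mult.commute)
    have "?SA (U m) / S m \<le> D / z" using D(4) z(1) by (simp add: pos_le_divide_eq mult.commute)
    then have "?SA (U m) / S m \<le> 1 + barrier_weight D \<delta> (U m)" using W by linarith
    then show "?SA (U m) \<le> S m * (1 + barrier_weight D \<delta> (U m))"
      using S_pos[of m] by (simp add: pos_divide_le_eq mult.commute)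
  qed
  have shifts: "U n + ?d + G / 2 = U (Suc n)" "U n + ?d - G / 2 = U n"
    "U (Suc n) - G / 2 = U n + ?d" for n
    by (simp_all add: U_Suc)
  have main: "S n \<le> ?SA (U n) * (1 + barrier_weight D \<delta> (U n)) \<and>
      ?SA (U n) \<le> S n * (1 + barrier_weight D \<delta> (U n)) \<and>
      \<eta> n \<le> ?EA (U n + ?d) * (1 + barrier_weight D \<delta> (U n + ?d)) \<and>
      ?EA (U n + ?d) \<le> \<eta> n * (1 + barrier_weight D \<delta> (U n + ?d))"
    if n: "n \<ge> m" and \<delta>: "\<delta> > 0" for n \<delta>
  proof -
    let ?W = "barrier_weight D \<delta>"
    have "eventually (\<lambda>N. N > n \<and> S N \<le> ?SA (U N) * (\<delta> * U N) \<and> ?SA (U N) \<le> S N * (\<delta>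
        * U N)) sequentially"
      using S_negligible[OF \<delta>] eventually_gt_at_top[of n] by eventually_elim simp
    then obtain N where N: "N > n" "S N \<le> ?SA (U N) * (\<delta> * U N)" "?SA (U N) \<le> S N * (\<delta> * U N)"
      using eventually_happens'[OF sequentially_bot] by blast
    have WN: "\<delta> * U N \<le> 1 + ?W (U N)" using D(1) by (simp add: barrier_weight_def add_increasing)
    have endN: "S N \<le> ?SA (U N) * (1 + ?W (U N))" "?SA (U N) \<le> S N * (1 + ?W (U N))"
      using N n WN mult_left_mono[OF WN, of "?SA (U N)"] mult_left_mono[OF WN, of "S N"]
        SA_pos[of N] S_pos[of N] by linarith+
    have ineq: "?P D0 (U j + ?d)" "?P D0 (U (Suc j))" if "j \<ge> m" for j
      using u0(1)[of "U j + ?d"] u0(1)[of "U (Suc j)"] m[of j] m[of "Suc j"] that G_pos by simp_all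
    have \<delta>0: "\<delta> \<ge> 0" using \<delta> by simp
    note ineqs = ineq[rule_format, OF _ D(2) \<delta>0, unfolded barrier_at_def shifts]
    have "(\<forall>n\<in>{m..N}. S n \<le> ?SA (U n) * (1 + ?W (U n))) \<and> (\<forall>n\<in>{m..<N}. ?EA (U n + ?d) / (1 + ?W (U n
        + ?d)) \<le> \<eta> n)"
    proof (rule upper_comparison)
      fix j assume j: "m \<le> j" "j \<le> N"
      have "?SA (U j) * 1 \<le> ?SA (U j) * (1 + ?W (U j))"
        using SA_pos[OF j(1)] W_pos(1)[OF \<delta>0, of j] by (intro mult_left_mono) auto
      then show "G < ?SA (U j) * (1 + ?W (U j))" using u0(2)[OF m[OF j(1)]] by linarith
    next
      fix j assume j: "m \<le> j" "j < N"
      show "0 < ?EA (U j + ?d) / (1 + ?W (U j + ?d))"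
        using EA_pos[OF j(1)] W_pos(2)[OF \<delta>0, of j] by simp
      show "?SA (U (Suc j)) * (1 + ?W (U (Suc j))) + ?SA (U j) * (1 + ?W (U j))
        \<le> link_rhs G (U j + ?d) (?EA (U j + ?d) / (1 + ?W (U j + ?d)))"
        using ineqs(1)[OF j(1)] by blast
    next
      fix j assume j: "m \<le> j" "Suc j < N"
      show "node_rhs G \<alpha> (U (Suc j)) (?SA (U (Suc j)) * (1 + ?W (U (Suc j))))
        \<le> ?EA (U (Suc j) + ?d) / (1 + ?W (U (Suc j) + ?d)) + ?EA (U j + ?d) / (1 + ?W (U j + ?d))"
        using ineqs(2)[OF j(1)] by blast
    qed (use start(1)[OF \<delta>0] endN N n in auto)
    then have up: "S n \<le> ?SA (U n) * (1 + ?W (U n))" "?EA (U n + ?d) / (1 + ?W (U n + ?d)) \<le> \<eta> n"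
      using n N by auto
    have "(\<forall>n\<in>{m..N}. ?SA (U n) / (1 + ?W (U n)) \<le> S n) \<and> (\<forall>n\<in>{m..<N}. \<eta> n \<le> ?EA (U n + ?d) * (1
        + ?W (U n + ?d)))"
    proof (rule lower_comparison)
      fix j assume j: "m \<le> j" "j \<le> N"
      show "0 < ?SA (U j) / (1 + ?W (U j))"
        using SA_pos[OF j(1)] W_pos(1)[OF \<delta>0, of j] by simp
    next
      fix j assume j: "m \<le> j" "j < N"
      show "0 < ?EA (U j + ?d) * (1 + ?W (U j + ?d))"
        using EA_pos[OF j(1)] W_pos(2)[OF \<delta>0, of j] by simp
      show "link_rhs G (U j + ?d) (?EA (U j + ?d) * (1 + ?W (U j + ?d)))
        \<le> ?SA (U (Suc j)) / (1 + ?W (U (Suc j))) + ?SA (U j) / (1 + ?W (U j))"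
        using ineqs(1)[OF j(1)] by blast
    next
      fix j assume j: "m \<le> j" "Suc j < N" and "G < ?SA (U (Suc j)) / (1 + ?W (U (Suc j)))"
      then show "?EA (U (Suc j) + ?d) * (1 + ?W (U (Suc j) + ?d)) + ?EA (U j + ?d) * (1 + ?W (U j
          + ?d))
        \<le> node_rhs G \<alpha> (U (Suc j)) (?SA (U (Suc j)) / (1 + ?W (U (Suc j))))"
        using ineqs(2)[OF j(1)] by blast
    next
      show "?SA (U m) / (1 + ?W (U m)) \<le> S m"
        using start(2)[OF \<delta>0] W_pos(1)[OF \<delta>0, of m] by (simp add: pos_divide_le_eq)
      show "?SA (U N) / (1 + ?W (U N)) \<le> S N"
        using endN(2) W_pos(1)[OF \<delta>0, of N] by (simp add: pos_divide_le_eq)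
      show "m \<le> N" using N n by simp
    qed
    then have lo: "?SA (U n) / (1 + ?W (U n)) \<le> S n" "\<eta> n \<le> ?EA (U n + ?d) * (1 + ?W (U n + ?d))"
      using n N by auto
    show ?thesis
      using up lo W_pos[OF \<delta>0, of n] by (simp add: pos_divide_le_eq)
  qed
  show ?thesis
  proof (rule that[of D m])
    show "D > 0" using D(1) by simp
  next
    fix n assume n: "n \<ge> m"
    have U: "U n > 0" "U n + ?d > 0" using U_pos[of n] G_pos by simp_all
    have lim: "s \<le> a * (1 + D * u powr (- 7 / 3))"
      if "\<And>\<delta>. \<delta> > 0 \<Longrightarrow> s \<le> a * (1 + barrier_weight D \<delta> u)" "a > 0" "u > 0" for s a u
    proof (rule le_of_le_add_mult[of "a * u"])
      show "a * u > 0" using that by simp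
      fix \<delta> :: real assume "\<delta> > 0"
      then show "s \<le> a * (1 + D * u powr (- 7 / 3)) + \<delta> * (a * u)"
        using that(1)[of \<delta>] by (simp add: barrier_weight_def algebra_simps)
    qed
    show "S n \<le> ?SA (U n) * (1 + D * U n powr (- 7 / 3))"
      by (rule lim) (use main[OF n] SA_pos[OF n] U in auto)
    show "?SA (U n) \<le> S n * (1 + D * U n powr (- 7 / 3))"
      by (rule lim) (use main[OF n] S_pos[of n] U in auto)
    show "\<eta> n \<le> ?EA (U n + ?d) * (1 + D * (U n + ?d) powr (- 7 / 3))"
      by (rule lim) (use main[OF n] EA_pos[OF n] U in auto)
    show "?EA (U n + ?d) \<le> \<eta> n * (1 + D * (U n + ?d) powr (- 7 / 3))"
      by (rule lim) (use main[OF n] \<eta>_pos[of n] U in auto)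
  qed
qed

lemma approx_error_bigo:
  fixes f g :: "nat \<Rightarrow> real"
  assumes fg: "eventually (\<lambda>n. f n \<le> g n * (1 + D * V n powr (- 7 / 3)) \<and> g n \<le> f n * (1 + D
      * V n powr (- 7 / 3))) sequentially"
    and pos: "\<And>n. f n > 0" and V: "filterlim V at_top sequentially" and D: "D > 0"
    and g: "g \<in> O(\<lambda>n. V n powr a)"
  shows "(\<lambda>n. f n - g n) \<in> O(\<lambda>n. V n powr (a - 7 / 3))"
proof -
  let ?w = "\<lambda>n. D * V n powr (- 7 / 3)"
  have "eventually (\<lambda>u::real. D * u powr (- 7 / 3) \<le> 1) at_top" by real_asymp
  then have small: "eventually (\<lambda>n. ?w n \<le> 1) sequentially"
    using V by (rule eventually_compose_filterlim)
  have "(\<lambda>n. f n - g n) \<in> O(\<lambda>n. g n * V n powr (- 7 / 3))"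
  proof (rule bigoI[of _ "2 * D"], use fg small in eventually_elim)
    case (elim n)
    have w: "?w n \<ge> 0" using D by simp
    \<comment> \<open>A nonpositive \<open>g n\<close> would make the upper bound for the positive
      \<open>f n\<close> nonpositive.\<close>
    have g0: "g n > 0"
    proof (rule ccontr)
      assume "\<not> 0 < g n"
      then have "g n * (1 + ?w n) \<le> 0" using w by (simp add: mult_nonpos_nonneg)
      then show False using elim pos[of n] by linarith
    qed
    have "g n * (1 + ?w n) \<le> g n * 2" using elim g0 by (intro mult_left_mono) auto
    moreover have "f n \<le> g n * (1 + ?w n)" using elim by blast
    ultimately have "f n \<le> 2 * g n" by linarith
    then have "f n * ?w n \<le> 2 * g n * ?w n" using w by (intro mult_right_mono) auto
    moreover have "g n * ?w n \<ge> 0" using g0 w by simp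
    ultimately have "\<bar>f n - g n\<bar> \<le> 2 * (g n * ?w n)"
      using elim by (auto simp: abs_le_iff distrib_left)
    then show ?case using g0 D by (simp add: mult_ac)
  qed
  also have "(\<lambda>n. g n * V n powr (- 7 / 3)) \<in> O(\<lambda>n. V n powr a * V n powr (- 7 / 3))"
    by (intro landau_o.big.mult g) auto
  also have "(\<lambda>n. V n powr a * V n powr (- 7 / 3)) = (\<lambda>n. V n powr (a - 7 / 3))"
    by (simp add: powr_add[symmetric])
  finally show ?thesis .
qed

lemma S_asymp: "(\<lambda>n. S n - S_approx G \<alpha> (U n)) \<in> O(\<lambda>n. U n powr (- 5 / 3))"
  and \<eta>_asymp: "(\<lambda>n. \<eta> n - \<eta>_approx G \<alpha> (U n + G / 2)) \<in> O(\<lambda>n. U n powr (- 2))"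
proof -
  obtain D m where D: "D > 0"
    "\<And>n. n \<ge> m \<Longrightarrow> S n \<le> S_approx G \<alpha> (U n) * (1 + D * U n powr (- 7 / 3))"
    "\<And>n. n \<ge> m \<Longrightarrow> S_approx G \<alpha> (U n) \<le> S n * (1 + D * U n powr (- 7 / 3))"
    "\<And>n. n \<ge> m \<Longrightarrow> \<eta> n \<le> \<eta>_approx G \<alpha> (U n + G / 2) * (1 + D * (U n + G / 2) powr (- 7 / 3))"
    "\<And>n. n \<ge> m \<Longrightarrow> \<eta>_approx G \<alpha> (U n + G / 2) \<le> \<eta> n * (1 + D * (U n + G / 2) powr (- 7 / 3))"
    by (rule ratio_bounds) blast
  have "(\<lambda>n. S n - S_approx G \<alpha> (U n)) \<in> O(\<lambda>n. U n powr (2 / 3 - 7 / 3))"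
  proof (rule approx_error_bigo[OF _ S_pos U_at_top D(1)])
    show "(\<lambda>n. S_approx G \<alpha> (U n)) \<in> O(\<lambda>n. U n powr (2 / 3))"
      unfolding S_approx_def by (rule landau_o.big.compose[OF laur_bigo U_at_top])
  qed (use D(2,3) in \<open>auto simp: eventually_sequentially\<close>)
  then show "(\<lambda>n. S n - S_approx G \<alpha> (U n)) \<in> O(\<lambda>n. U n powr (- 5 / 3))" by simp
  have lim: "filterlim (\<lambda>n. U n + G / 2) at_top sequentially"
    unfolding U_def using G_pos by real_asymp
  have "(\<lambda>n. \<eta> n - \<eta>_approx G \<alpha> (U n + G / 2)) \<in> O(\<lambda>n. (U n + G / 2) powr (1 / 3 - 7 / 3))"
  proof (rule approx_error_bigo[OF _ \<eta>_pos lim D(1)])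
    show "(\<lambda>n. \<eta>_approx G \<alpha> (U n + G / 2)) \<in> O(\<lambda>n. (U n + G / 2) powr (1 / 3))"
      unfolding \<eta>_approx_def by (rule landau_o.big.compose[OF laur_bigo lim])
  qed (use D(4,5) in \<open>auto simp: eventually_sequentially\<close>)
  also have "(\<lambda>n. (U n + G / 2) powr (1 / 3 - 7 / 3)) \<in> O(\<lambda>n. U n powr (- 2))"
    using U_pos G_pos by (intro bigoI[of _ 1] always_eventually allI) (auto intro!: powr_mono2')
  finally show "(\<lambda>n. \<eta> n - \<eta>_approx G \<alpha> (U n + G / 2)) \<in> O(\<lambda>n. U n powr (- 2))" .
qed

end

section \<open>The subleading coefficient\<close>

text \<open>Expansion of the subleading coefficient minus 2 G - u^2 / k, with u = G (n + \<alpha> /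
  2), in the variable u^(-1/3) / 6. Orders 0 to 5 run from u^(2/3) to u^(-1), leaving an error
  u^(-4/3).\<close>

definition subleading_poly :: "real \<Rightarrow> real \<Rightarrow> real poly" where
  "subleading_poly v k = [:-3, 18 * v, 1 + 27 * v^2, 54 * v^3 - 6 * v, 81 * v^4 - 9 * v^2 - 1296
      * k,
     54 * v^3 - 6 * v + 7776 * v * k:]"

text \<open>The expansion multiplied by \<open>Q\<close>, which represents S^2 - k. With y =
  u^(-1/3) / 6, the constants encode \<alpha> u^(-1/3) = 18 v y, \<alpha>^2 k u^(-2) / 4 = 104976
  v^2 k y^6 and u^(-2/3) / 4 = 9 y^2.\<close>

lemma subleading_residual_coeffs:
  fixes v k :: real
  defines "Q \<equiv> S_poly v k * S_poly v k - monom (1296 * k) 4" and "C \<equiv> diff_poly 1 (eta_poly v k)"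
  assumes "j < 6"
  shows "coeff (subleading_poly v k * Q + smult 2 (S_poly v k * Q) + 1 - pCons 0 (smult (18
      * v) (S_poly v k))
     + monom (104976 * v\<^sup>2 * k) 6 - monom 9 2 * ((Q * C) * (Q * C))) j = 0" (is "coeff ?p j = 0")
proof -
  note Q_coeffs = S_square_coeffs[of v k, folded Q_def]
  \<comment> \<open>Order 3 suffices for \<open>C\<close> and its products, because the factor
    \<open>monom 9 2\<close> shifts them by two places.\<close>
  have C_coeffs: "coeff C 0 = 1 / 3" "coeff C 1 = 0" "coeff C 2 = - 3 * v^2" "coeff C 3 = - 2 / 3
      * (v + 18 * v^3)"
    unfolding C_def coeff_diff_poly eta_poly_coeffs by simp_all
  define QC where "QC = Q * C"
  have QC_coeffs: "coeff QC 0 = 1 / 3" "coeff QC 1 = - 2 * v" "coeff QC 2 = 0"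
    "coeff QC 3 = - 4 / 3 * v + 12 * v ^ 3"
    unfolding QC_def coeff_mult_low Q_coeffs C_coeffs by (simp_all add: field_simps power2_eq_square
        power3_eq_cube)
  define QC2 where "QC2 = QC * QC"
  have QC2_coeffs: "coeff QC2 0 = 1 / 9" "coeff QC2 1 = - 4 / 3 * v" "coeff QC2 2 = 4 * v^2"
    "coeff QC2 3 = - 8 / 9 * v + 8 * v ^ 3"
    unfolding QC2_def coeff_mult_low QC_coeffs by (simp_all add: field_simps power2_eq_square
        power3_eq_cube)
  have p_coeffs: "coeff (subleading_poly v k) 0 = - 3" "coeff (subleading_poly v k) 1 = 18
      * v" "coeff (subleading_poly v k) 2 = 1 + 27 * v^2"
    "coeff (subleading_poly v k) 3 = 54 * v^3 - 6 * v" "coeff (subleading_poly v k) 4 = 81 * v^4 - 9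
        * v^2 - 1296 * k"
    "coeff (subleading_poly v k) 5 = 54 * v^3 - 6 * v + 7776 * v * k"
    unfolding subleading_poly_def by (simp_all add: eval_nat_numeral)
  have shift: "coeff (monom 9 2 * QC2) 0 = 0" "coeff (monom 9 2 * QC2) 1 = 0" "coeff (monom 9 2
      * QC2) 2 = 9 * coeff QC2 0"
    "coeff (monom 9 2 * QC2) 3 = 9 * coeff QC2 1" "coeff (monom 9 2 * QC2) 4 = 9 * coeff QC2 2"
    "coeff (monom 9 2 * QC2) 5 = 9 * coeff QC2 3"
    by (simp_all add: coeff_monom_mult)
  have shift': "coeff (pCons 0 p) 0 = 0" "coeff (pCons 0 p) 1 = coeff p 0" "coeff (pCons 0 p) 2
      = coeff p 1"
    "coeff (pCons 0 p) 3 = coeff p 2" "coeff (pCons 0 p) 4 = coeff p 3" "coeff (pCons 0 p) 5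
        = coeff p 4" for p :: "real poly"
    by (simp_all add: eval_nat_numeral)
  have "coeff ?p 0 = 0" "coeff ?p 1 = 0" "coeff ?p 2 = 0" "coeff ?p 3 = 0" "coeff ?p 4
      = 0" "coeff ?p 5 = 0"
    unfolding QC_def[symmetric] QC2_def[symmetric] coeff_diff coeff_add shift shift' coeff_smult
        coeff_monom QC2_coeffs
      coeff_mult_low p_coeffs S_poly_coeffs Q_coeffs
    by (simp; algebra?)+
  moreover have "j \<in> {0, 1, 2, 3, 4, 5}" using assms(3) by auto
  ultimately show ?thesis by (elim insertE emptyE) (simp_all only:)
qed

text \<open>For k = G^2, the square of \<open>node_rhs\<close> times (s^2 - k) / (4 k) equals u^2 /
  k plus this term; the large part u^2 / k is thereby separated and independent of s.\<close>

definition node_remainder :: "real \<Rightarrow> real \<Rightarrow> real \<Rightarrow> real \<Rightarrow> real" where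
  "node_remainder \<alpha> k u s = (u\<^sup>2 - u * \<alpha> * s + \<alpha>\<^sup>2 * k / 4) / (s\<^sup>2 - k)"

text \<open>The increment of the approximation to \<eta> is replaced by G times its derivative,
  which is again of Laurent form; the rest is an algebraic identity with denominator
  \<open>Q\<close>.\<close>

lemma explicit_expansion:
  fixes G \<alpha> :: real
  assumes G_pos: "G > 0"
  defines "s \<equiv> S_approx G \<alpha>" and "e \<equiv> \<eta>_approx G \<alpha>" and "k \<equiv> G\<^sup>2"
  shows "(\<lambda>u. - 2 * s u - node_remainder \<alpha> k u (s u) + ((s u)\<^sup>2 - k) * (e (u + G / 2) - e (u - G
      / 2))\<^sup>2 / (4 * k)
    - laur 2 (subleading_poly (\<alpha> / 3) k) u) \<in> O(\<lambda>u. u powr (- 4 / 3))"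
proof -
  let ?v = "\<alpha> / 3"
  let ?A = "S_poly ?v k" and ?B = "eta_poly ?v k"
  define Q where "Q = ?A * ?A - monom (1296 * k) 4"
  define C where "C = diff_poly 1 ?B"
  define R where "R = subleading_poly ?v k * Q + smult 2 (?A * Q) + 1 - pCons 0 (smult (18 * ?v) ?A)
     + monom (104976 * ?v\<^sup>2 * k) 6 - monom 9 2 * ((Q * C) * (Q * C))"
  let ?y = "\<lambda>u::real. u powr (- 1 / 3) / 6"
  let ?de = "\<lambda>u. e (u + G / 2) - e (u - G / 2)"
  let ?c = "\<lambda>u. G * laur (- 2) C u"
  have k: "k > 0" using G_pos by (simp add: k_def)
  have Q0: "coeff Q 0 = 1" unfolding Q_def by (rule S_square_coeffs(1))
  have R: "laur 2 R \<in> O(\<lambda>u. u powr ((2 - real 6) / 3))"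
    unfolding R_def Q_def C_def by (rule laur_bigo_vanish) (rule subleading_residual_coeffs)
  have "(\<lambda>u. laur 2 R u * (1 / poly Q (?y u))) \<in> O(\<lambda>u. u powr ((2 - real 6) / 3) * 1)"
    by (intro landau_o.big.mult R bigo_one_over_poly) (use Q0 in simp)
  then have 1: "(\<lambda>u. laur 2 R u * (1 / poly Q (?y u))) \<in> O(\<lambda>u. u powr (- 4 / 3))" by simp
  have d1: "(\<lambda>u. ?de u - ?c u) \<in> O(\<lambda>u. u powr (- 8 / 3))"
    using laur_shift_diff[of 1 ?B G] unfolding e_def \<eta>_approx_def C_def k_def by simp
  have d2: "?c \<in> O(\<lambda>u. u powr (- 2 / 3))"
    using laur_bigo[of "- 2" C] G_pos by simp
  have d3: "?de \<in> O(\<lambda>u. u powr (- 2 / 3))"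
    using laur_shift_diff_bigo[of 1 ?B G] unfolding e_def \<eta>_approx_def k_def by simp
  have s_bigo: "s \<in> O(\<lambda>u. u powr (2 / 3))" unfolding s_def S_approx_def by (rule laur_bigo)
  have "(\<lambda>u. (s u)\<^sup>2) \<in> O(\<lambda>u. (u powr (2 / 3))\<^sup>2)" by (intro landau_o.big_power s_bigo)
  also have "(\<lambda>u. (u powr (2 / 3))\<^sup>2) = (\<lambda>u::real. u powr (4 / 3))"
    by (simp add: power2_eq_square powr_add[symmetric])
  finally have sk: "(\<lambda>u. (s u)\<^sup>2 - k) \<in> O(\<lambda>u. u powr (4 / 3))"
    by (rule sum_in_bigo) real_asymp
  \<comment> \<open>The difference of the two squares is factored; the orders 4/3, -8/3 and -2/3 add
    up to -2.\<close>
  then have "(\<lambda>u. ((s u)\<^sup>2 - k) * ((?de u - ?c u) * (?de u + ?c u)))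
      \<in> O(\<lambda>u. u powr (4 / 3) * (u powr (- 8 / 3) * u powr (- 2 / 3)))"
    by (intro landau_o.big.mult sk d1 sum_in_bigo(1)[OF d3 d2])
  also have "(\<lambda>u::real. u powr (4 / 3) * (u powr (- 8 / 3) * u powr (- 2 / 3)))
      = (\<lambda>u. u powr (- 2))"
    by (simp add: powr_add[symmetric])
  also have "(\<lambda>u::real. u powr (- 2)) \<in> O(\<lambda>u. u powr (- 4 / 3))" by (rule powr_bigo_powr) simp
  finally have 2: "(\<lambda>u. 1 / (4 * k) * (((s u)\<^sup>2 - k) * ((?de u - ?c u) * (?de u + ?c u))))
      \<in> O(\<lambda>u. u powr (- 4 / 3))"
    using k by simp
  have "eventually (\<lambda>u. 1 / (4 * k) * (((s u)\<^sup>2 - k) * ((?de u - ?c u) * (?de u + ?c u)))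
      - laur 2 R u * (1 / poly Q (?y u)) =
     - 2 * s u - node_remainder \<alpha> k u (s u) + ((s u)\<^sup>2 - k) * (?de u)\<^sup>2 / (4 * k)
         - laur 2 (subleading_poly ?v k) u) at_top"
    using eventually_gt_at_top[of 0] eventually_poly_pos[of Q, unfolded Q0, OF zero_less_one]
  proof eventually_elim
    case (elim u)
    define x where "x = u powr (1 / 3)"
    have x: "x > 0" "u = x ^ 3" "u powr (2 / 3) = x\<^sup>2" "u powr (- 1 / 3) = 1 / x" "u powr (- 2 / 3)
        = 1 / x\<^sup>2"
      using elim powr_third_power[of u 2] by (simp_all add: x_def powr_third_power
          powr_minus_divide)
    define a where "a = poly ?A (1 / x / 6)"
    define c where "c = poly C (1 / x / 6)"
    define pp where "pp = poly (subleading_poly ?v k) (1 / x / 6)"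
    define q where "q = poly Q (1 / x / 6)"
    have q: "q > 0" using elim(2)[unfolded x(4)] unfolding q_def .
    have qa: "q = a * a - 1296 * k * (1 / x / 6) ^ 4" unfolding q_def a_def Q_def
        by (simp add: poly_monom)
    have S: "s u = x\<^sup>2 * a" unfolding s_def S_approx_def laur_def a_def x(3,4) k_def ..
    have Sq: "(s u)\<^sup>2 - k = x ^ 4 * q"
      unfolding S qa using x(1) by (simp add: power_divide power_mult_distrib field_simps
          power2_eq_square eval_nat_numeral)
    have num: "u\<^sup>2 - u * \<alpha> * s u + \<alpha>\<^sup>2 * k / 4 =
      x ^ 6 * (1 - 18 * ?v * (1 / x / 6 * a) + 104976 * ?v\<^sup>2 * k * (1 / x / 6) ^ 6)"
      unfolding S using x(1) by (simp add: x(2) power_divide field_simps eval_nat_numeral)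
    have st: "node_remainder \<alpha> k u (s u) = x\<^sup>2 * (1 - 18 * ?v * (1 / x / 6 * a) + 104976 * ?v\<^sup>2 * k
        * (1 / x / 6) ^ 6) / q"
      unfolding node_remainder_def num Sq using x(1) by (simp add: eval_nat_numeral)
    have c: "?c u = G * (c / x\<^sup>2)" unfolding laur_def c_def x(4) using x(5) by simp
    have "((s u)\<^sup>2 - k) * (?c u)\<^sup>2 / (4 * k) = q * c\<^sup>2 / 4"
      unfolding Sq c using x(1) G_pos by (simp add: k_def power2_eq_square eval_nat_numeral)
    also have "\<dots> = x\<^sup>2 * (9 * (1 / x / 6)\<^sup>2 * (q * c * (q * c))) / q"
      using x(1) q by (simp add: power2_eq_square)
    finally have t3: "((s u)\<^sup>2 - k) * (?c u)\<^sup>2 / (4 * k) = x\<^sup>2 * (9 * (1 / x / 6)\<^sup>2 * (q * c * (q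
        * c))) / q" .
    have R: "laur 2 R u * (1 / poly Q (?y u)) = x\<^sup>2 * (pp * q + 2 * (a * q) + 1 - 1 / x / 6 * (18
        * ?v * a)
      + 104976 * ?v\<^sup>2 * k * (1 / x / 6) ^ 6 - 9 * (1 / x / 6)\<^sup>2 * (q * c * (q * c))) / q"
      unfolding laur_def x(3,4) R_def q_def a_def c_def pp_def by (simp add: poly_monom)
    have pl: "laur 2 (subleading_poly ?v k) u = x\<^sup>2 * pp" unfolding laur_def x(3,4) pp_def ..
    have gen: "z * (pp * q + 2 * (a * q) + 1 - y * (w * a) + m - b) / q =
        z * pp + 2 * (z * a) + z * (1 - w * (y * a) + m) / q - z * b / q" for z y w m b
      using q by (simp add: field_simps)
    have "1 / (4 * k) * (((s u)\<^sup>2 - k) * ((?de u - ?c u) * (?de u + ?c u))) =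
        ((s u)\<^sup>2 - k) * (?de u)\<^sup>2 / (4 * k) - ((s u)\<^sup>2 - k) * (?c u)\<^sup>2 / (4 * k)"
      using k by (simp add: field_simps power2_eq_square)
    then show ?case unfolding R gen t3 st pl by (simp add: S)
  qed
  moreover have "(\<lambda>u. 1 / (4 * k) * (((s u)\<^sup>2 - k) * ((?de u - ?c u) * (?de u + ?c u))) - laur 2 R u
      * (1 / poly Q (?y u)))
     \<in> O(\<lambda>u. u powr (- 4 / 3))" by (rule sum_in_bigo(2)[OF 2 1])
  ultimately show ?thesis by (subst (asm) landau_o.big.in_cong) auto
qed

text \<open>The factor w - s is exposed so that the error of \<open>S\<close> can be inserted
  directly. The middle factor has order u^(8/3) and the reciprocals u^(-8/3), so that the error is
  not amplified.\<close>

lemma node_remainder_diff: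
  assumes "s\<^sup>2 \<noteq> k" "w\<^sup>2 \<noteq> k"
  shows "node_remainder \<alpha> k u s - node_remainder \<alpha> k u w =
    (w - s) * ((u\<^sup>2 + \<alpha>\<^sup>2 * k / 4) * (w + s) - u * \<alpha> * (s * w + k)) * (1 / (s\<^sup>2 - k) * (1 / (w\<^sup>2
        - k)))"
proof -
  have ne: "s\<^sup>2 - k \<noteq> 0" "w\<^sup>2 - k \<noteq> 0" using assms by auto
  have "(u\<^sup>2 - u * \<alpha> * s + \<alpha>\<^sup>2 * k / 4) * (w\<^sup>2 - k) - (u\<^sup>2 - u * \<alpha> * w + \<alpha>\<^sup>2 * k / 4) * (s\<^sup>2 - k) =
    (w - s) * ((u\<^sup>2 + \<alpha>\<^sup>2 * k / 4) * (w + s) - u * \<alpha> * (s * w + k))"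
    by (simp add: field_simps power2_eq_square)
  then show ?thesis unfolding node_remainder_def diff_frac_eq[OF ne] by simp
qed

context positive_discrete_system
begin

text \<open>Written through the sum \<open>\<eta>\<^sub>n + \<eta>\<^sub>n\<^sub>-\<^sub>1\<close>, which the system gives exactly, and the small difference
  \<open>\<eta>\<^sub>n - \<eta>\<^sub>n\<^sub>-\<^sub>1\<close>, the subleading coefficient is insensitive to errors: a relative error \<open>u\<^sup>-\<^sup>7\<^sup>/\<^sup>3\<close> of
  the solution changes it only by \<open>O(u\<^sup>-\<^sup>4\<^sup>/\<^sup>3)\<close>, although \<open>\<beta>\<^sub>n\<close> itself has size \<open>u\<^sup>2\<close>.\<close>

lemma subleading_identity:
  fixes n :: nat
  defines "u \<equiv> U (Suc n)" and "s \<equiv> S (Suc n)" and "k \<equiv> G\<^sup>2"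
  shows "2 * G - 2 * s - (s\<^sup>2 - k) * \<eta> (Suc n) * \<eta> n / k =
    2 * G - 2 * s - u\<^sup>2 / k - node_remainder \<alpha> k u s + (s\<^sup>2 - k) * (\<eta> (Suc n) - \<eta> n)\<^sup>2 / (4 * k)"
proof -
  have k: "k > 0" and q: "s\<^sup>2 - k > 0" using G_pos S_sq_gt[of "Suc n"]
      by (simp_all add: k_def s_def)
  have add: "(\<eta> (Suc n) + \<eta> n) * (s\<^sup>2 - k) = 2 * u * s - \<alpha> * k"
    using \<eta>_add[of n] by (simp add: u_def s_def k_def)
  have "4 * ((s\<^sup>2 - k) * \<eta> (Suc n) * \<eta> n) = ((\<eta> (Suc n) + \<eta> n) * (s\<^sup>2 - k)) * (\<eta> (Suc n) + \<eta> n)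
      - (s\<^sup>2 - k) * (\<eta> (Suc n) - \<eta> n)\<^sup>2"
    by (simp add: algebra_simps power2_eq_square)
  also have "\<eta> (Suc n) + \<eta> n = (2 * u * s - \<alpha> * k) / (s\<^sup>2 - k)"
    using add q by (simp add: eq_divide_eq)
  also have "((2 * u * s - \<alpha> * k) / (s\<^sup>2 - k) * (s\<^sup>2 - k)) * ((2 * u * s - \<alpha> * k) / (s\<^sup>2 - k)) =
      4 * u\<^sup>2 + 4 * k * node_remainder \<alpha> k u s"
  proof -
    have "(2 * u * s - \<alpha> * k) * (2 * u * s - \<alpha> * k) = 4 * u\<^sup>2 * (s\<^sup>2 - k) + 4 * k * (u\<^sup>2 - u * \<alpha> * s
        + \<alpha>\<^sup>2 * k / 4)"
      by (simp add: algebra_simps power2_eq_square)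
    moreover have "(4 * u\<^sup>2 * z + 4 * k * y) / z = 4 * u\<^sup>2 + 4 * k * (y / z)" if "z > 0" for y z
      using that by (simp add: field_simps)
    moreover have "(A / z * z) * (A / z) = A * A / z" if "z > 0" for A z :: real using that by simp
    ultimately show ?thesis using q unfolding node_remainder_def by (simp only:)
  qed
  finally have *: "4 * ((s\<^sup>2 - k) * \<eta> (Suc n) * \<eta> n) =
      4 * u\<^sup>2 + 4 * k * node_remainder \<alpha> k u s - (s\<^sup>2 - k) * (\<eta> (Suc n) - \<eta> n)\<^sup>2" .
  have "(s\<^sup>2 - k) * \<eta> (Suc n) * \<eta> n / k = 4 * ((s\<^sup>2 - k) * \<eta> (Suc n) * \<eta> n) / (4 * k)"
    by simp
  also have "\<dots> =
      (4 * u\<^sup>2 + 4 * k * node_remainder \<alpha> k u s - (s\<^sup>2 - k) * (\<eta> (Suc n) - \<eta> n)\<^sup>2) / (4 * k)"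
    by (simp only: *)
  also have "\<dots> = u\<^sup>2 / k + node_remainder \<alpha> k u s - (s\<^sup>2 - k) * (\<eta> (Suc n) - \<eta> n)\<^sup>2 / (4 * k)"
    using k by (simp add: diff_divide_distrib add_divide_distrib)
  finally show ?thesis by simp
qed

lemma subleading_asymp:
  defines "k \<equiv> G\<^sup>2"
  shows "(\<lambda>n. (2 * G - 2 * S (Suc n) - ((S (Suc n))\<^sup>2 - k) * \<eta> (Suc n) * \<eta> n / k)
     - (2 * G - (U (Suc n))\<^sup>2 / k + laur 2 (subleading_poly (\<alpha> / 3) k) (U (Suc n))))
    \<in> O(\<lambda>n. U (Suc n) powr (- 4 / 3))"
proof -
  define u where "u = (\<lambda>n. U (Suc n))"
  define s where "s = (\<lambda>n. S (Suc n))"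
  define w where "w = (\<lambda>n. S_approx G \<alpha> (u n))"
  define d where "d = (\<lambda>n. \<eta> (Suc n) - \<eta> n)"
  define e where "e = (\<lambda>n. \<eta>_approx G \<alpha> (u n + G / 2) - \<eta>_approx G \<alpha> (u n - G / 2))"
  have k: "k > 0" using G_pos by (simp add: k_def)
  have u_pos: "u n > 0" for n by (simp add: u_def U_pos)
  have u_top: "filterlim u at_top sequentially"
    unfolding u_def by (rule filterlim_compose[OF U_at_top filterlim_Suc])
  have comb: "(\<lambda>n. u n powr a * u n powr b) = (\<lambda>n. u n powr (a + b))" for a b
    by (simp add: powr_add)
  have pw: "(\<lambda>n. u n powr a) \<in> O(\<lambda>n. u n powr b)" if "a \<le> b" for a b
    by (rule landau_o.big.compose[OF powr_bigo_powr[OF that] u_top])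
  have const: "(\<lambda>n. c) \<in> O(\<lambda>n. u n powr b)" if "b \<ge> 0" for b c :: real
  proof -
    have "(\<lambda>n. c) \<in> O(\<lambda>n. u n powr 0)" using u_pos by (simp add: less_imp_neq[symmetric])
    also note pw[OF that]
    finally show ?thesis .
  qed
  have Ssw: "(\<lambda>n. s n - w n) \<in> O(\<lambda>n. u n powr (- 5 / 3))"
    unfolding s_def w_def u_def by (rule landau_o.big.compose[OF S_asymp filterlim_Suc])
  have w: "w \<in> O(\<lambda>n. u n powr (2 / 3))"
    unfolding w_def S_approx_def by (rule landau_o.big.compose[OF laur_bigo u_top])
  have sw: "(\<lambda>n. s n - w n) \<in> O(\<lambda>n. u n powr (2 / 3))"
    by (rule landau_o.big.trans[OF Ssw pw]) simp
  have s: "s \<in> O(\<lambda>n. u n powr (2 / 3))"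
    using sum_in_bigo(1)[OF sw w] by simp
  have low: "eventually (\<lambda>n. w n \<ge> u n powr (2 / 3) / 2) sequentially"
    unfolding w_def using eventually_compose_filterlim[OF S_approx_between[of G \<alpha>] u_top]
    by eventually_elim simp
  have "(\<lambda>n. s n - w n) \<in> o(\<lambda>n. u n powr (2 / 3))"
  proof (rule landau_o.big_small_trans[OF Ssw])
    have "(\<lambda>u::real. u powr (- 5 / 3)) \<in> o(\<lambda>u. u powr (2 / 3))" by real_asymp
    then show "(\<lambda>n. u n powr (- 5 / 3)) \<in> o(\<lambda>n. u n powr (2 / 3))"
      by (rule landau_o.small.compose[OF _ u_top])
  qed
  then have "eventually (\<lambda>n. norm (s n - w n) \<le> 1 / 4 * norm (u n powr (2 / 3))) sequentially"
    by (rule landau_o.smallD) simp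
  with low have low': "eventually (\<lambda>n. s n \<ge> u n powr (2 / 3) / 4) sequentially"
  proof eventually_elim
    case (elim n)
    then have "w n - s n \<le> u n powr (2 / 3) / 4" 
      using abs_ge_minus_self[of "s n - w n"] by simp
    with elim(1) show ?case by (simp add: field_simps)
  qed
  have inv: "(\<lambda>n. 1 / ((z n)\<^sup>2 - k)) \<in> O(\<lambda>n. u n powr (- 4 / 3))"
    and inv_pos: "eventually (\<lambda>n. (z n)\<^sup>2 > k) sequentially"
    if z: "eventually (\<lambda>n. z n \<ge> u n powr (2 / 3) / 4) sequentially" for z
  proof -
    have "eventually (\<lambda>v::real. 2 * k < (v powr (2 / 3) / 4)\<^sup>2) at_top" using k by real_asymp
    then have "eventually (\<lambda>n. 2 * k < (u n powr (2 / 3) / 4)\<^sup>2) sequentially"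
      using u_top by (rule eventually_compose_filterlim)
    with z have lower: "eventually (\<lambda>n. (z n)\<^sup>2 > k \<and> 1 / ((z n)\<^sup>2 - k) \<le> 32 * u n powr (- 4
        / 3)) sequentially"
    proof eventually_elim
      case (elim n)
      have "(u n powr (2 / 3) / 4)\<^sup>2 \<le> (z n)\<^sup>2" using elim by (intro power_mono) auto
      moreover have sq: "(u n powr (2 / 3) / 4)\<^sup>2 = u n powr (4 / 3) / 16"
        by (simp add: power2_eq_square powr_add[symmetric])
      ultimately have zk: "u n powr (4 / 3) / 32 \<le> (z n)\<^sup>2 - k" "(z n)\<^sup>2 > k" using elim k by auto
      have "1 / ((z n)\<^sup>2 - k) \<le> 1 / (u n powr (4 / 3) / 32)"
        using zk u_pos[of n] by (intro divide_left_mono) (auto simp: less_imp_neq[symmetric])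
      also have "\<dots> = 32 * u n powr (- 4 / 3)" by (simp add: powr_minus_divide)
      finally show ?case using zk by simp
    qed
    then show "(\<lambda>n. 1 / ((z n)\<^sup>2 - k)) \<in> O(\<lambda>n. u n powr (- 4 / 3))"
      by (intro bigoI[of _ 32]) (auto elim!: eventually_mono)
    from lower show "eventually (\<lambda>n. (z n)\<^sup>2 > k) sequentially" by eventually_elim simp
  qed
  have low4: "eventually (\<lambda>n. w n \<ge> u n powr (2 / 3) / 4) sequentially"
    using low
  proof eventually_elim
    case (elim n)
    have "u n powr (2 / 3) / 4 \<le> u n powr (2 / 3) / 2" by simp
    then show ?case using elim by (rule order.trans)
  qed
  have prod: "(\<lambda>n. f n * g n) \<in> O(\<lambda>n. u n powr c)"
    if "f \<in> O(\<lambda>n. u n powr a)" "g \<in> O(\<lambda>n. u n powr b)" "a + b \<le> c" for f g a b c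
  proof -
    have "(\<lambda>n. f n * g n) \<in> O(\<lambda>n. u n powr (a + b))"
      using landau_o.big.mult[OF that(1,2)] unfolding comb .
    also note pw[OF that(3)]
    finally show ?thesis .
  qed
  have u1: "u \<in> O(\<lambda>n. u n powr 1)" using u_pos by (simp add: less_imp_le)
  have ws: "(\<lambda>n. w n + s n) \<in> O(\<lambda>n. u n powr (2 / 3))" using sum_in_bigo(1)[OF w s] .
  have u2: "(\<lambda>n. (u n)\<^sup>2 + \<alpha>\<^sup>2 * k / 4) \<in> O(\<lambda>n. u n powr 2)"
    unfolding power2_eq_square[of "u _"] by (intro sum_in_bigo(1) prod[OF u1 u1] const) auto
  have B: "(\<lambda>n. ((u n)\<^sup>2 + \<alpha>\<^sup>2 * k / 4) * (w n + s n) - u n * \<alpha> * (s n * w n + k))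
      \<in> O(\<lambda>n. u n powr (8 / 3))"
  proof (rule sum_in_bigo(2))
    show "(\<lambda>n. ((u n)\<^sup>2 + \<alpha>\<^sup>2 * k / 4) * (w n + s n)) \<in> O(\<lambda>n. u n powr (8 / 3))"
      by (rule prod[OF u2 ws]) simp
    have "(\<lambda>n. u n * \<alpha>) \<in> O(\<lambda>n. u n powr 1)" by (rule prod[OF u1 const[of 0]]) simp_all
    moreover have "(\<lambda>n. s n * w n + k) \<in> O(\<lambda>n. u n powr (4 / 3))"
      by (intro sum_in_bigo(1) prod[OF s w] const) auto
    ultimately show "(\<lambda>n. u n * \<alpha> * (s n * w n + k)) \<in> O(\<lambda>n. u n powr (8 / 3))"
      by (rule prod) simp
  qed
  have ws': "(\<lambda>n. w n - s n) \<in> O(\<lambda>n. u n powr (- 5 / 3))"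
    using Ssw by (subst landau_o.big.uminus_in_iff[symmetric]) simp
  have "(\<lambda>n. (w n - s n) * (((u n)\<^sup>2 + \<alpha>\<^sup>2 * k / 4) * (w n + s n) - u n * \<alpha> * (s n * w n + k))
      * (1 / ((s n)\<^sup>2 - k) * (1 / ((w n)\<^sup>2 - k)))) \<in> O(\<lambda>n. u n powr (- 5 / 3))"
    by (rule prod[OF prod[OF ws' B order_refl] prod[OF inv[OF low'] inv[OF low4] order_refl]]) simp
  moreover have "eventually (\<lambda>n. (w n - s n) * (((u n)\<^sup>2 + \<alpha>\<^sup>2 * k / 4) * (w n + s n) - u n * \<alpha>
      * (s n * w n + k))
      * (1 / ((s n)\<^sup>2 - k) * (1 / ((w n)\<^sup>2 - k))) = node_remainder \<alpha> k (u n) (s n)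
          - node_remainder \<alpha> k (u n) (w n)) sequentially"
    using inv_pos[OF low'] inv_pos[OF low4] by eventually_elim (rule node_remainder_diff[symmetric],
        auto)
  ultimately have T2: "(\<lambda>n. node_remainder \<alpha> k (u n) (s n) - node_remainder \<alpha> k (u n) (w n))
      \<in> O(\<lambda>n. u n powr (- 5 / 3))"
    by (subst (asm) landau_o.big.in_cong) auto
  have e: "e \<in> O(\<lambda>n. u n powr (- 2 / 3))"
    using landau_o.big.compose[OF laur_shift_diff_bigo[of 1 "eta_poly (\<alpha> / 3) (G\<^sup>2)" G] u_top]
    unfolding e_def \<eta>_approx_def by simp
  have de: "(\<lambda>n. d n - e n) \<in> O(\<lambda>n. u n powr (- 2))"
  proof -
    have 1: "(\<lambda>n. \<eta> (Suc n) - \<eta>_approx G \<alpha> (u n + G / 2)) \<in> O(\<lambda>n. u n powr (- 2))"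
      unfolding u_def by (rule landau_o.big.compose[OF \<eta>_asymp filterlim_Suc])
    have "(\<lambda>n. U n powr (- 2)) \<in> O(\<lambda>n. u n powr (- 2))"
      unfolding u_def U_def using G_pos by real_asymp
    with \<eta>_asymp have "(\<lambda>n. \<eta> n - \<eta>_approx G \<alpha> (U n + G / 2)) \<in> O(\<lambda>n. u n powr (- 2))"
      by (rule landau_o.big.trans)
    moreover have "U n + G / 2 = u n - G / 2" for n by (simp add: u_def U_Suc)
    ultimately have 2: "(\<lambda>n. \<eta> n - \<eta>_approx G \<alpha> (u n - G / 2)) \<in> O(\<lambda>n. u n powr (- 2))"
      by simp
    from sum_in_bigo(2)[OF 1 2] show ?thesis by (simp add: d_def e_def algebra_simps)
  qed
  have "(\<lambda>n. d n - e n) \<in> O(\<lambda>n. u n powr (- 2 / 3))"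
    by (rule landau_o.big.trans[OF de pw]) simp
  from sum_in_bigo(1)[OF this e] have d: "d \<in> O(\<lambda>n. u n powr (- 2 / 3))" by simp
  have "(\<lambda>n. ((s n - w n) * (w n + s n)) * (d n * d n)) \<in> O(\<lambda>n. u n powr (- 4 / 3))"
    by (rule prod[OF prod[OF Ssw ws order_refl] prod[OF d d order_refl]]) simp
  \<comment> \<open>The critical term: the error u^(-2) of \<eta> meets factors of order u^(4/3) and
    u^(-2/3), which uses up the whole allowance.\<close>
  moreover have "(\<lambda>n. (w n * w n - k) * ((d n - e n) * (d n + e n))) \<in> O(\<lambda>n. u n powr (- 4 / 3))"
  proof (rule prod[OF _ prod[OF de sum_in_bigo(1)[OF d e] order_refl]])
    show "(\<lambda>n. w n * w n - k) \<in> O(\<lambda>n. u n powr (4 / 3))"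
      by (intro sum_in_bigo(2) prod[OF w w] const) auto
  qed simp
  ultimately have "(\<lambda>n. ((s n - w n) * (w n + s n)) * (d n * d n) + (w n * w n - k) * ((d n - e n)
      * (d n + e n)))
      \<in> O(\<lambda>n. u n powr (- 4 / 3))" by (rule sum_in_bigo)
  also have "(\<lambda>n. ((s n - w n) * (w n + s n)) * (d n * d n) + (w n * w n - k) * ((d n - e n) * (d n
      + e n))) =
     (\<lambda>n. ((s n)\<^sup>2 - k) * (d n)\<^sup>2 - ((w n)\<^sup>2 - k) * (e n)\<^sup>2)"
    by (intro ext) (simp add: algebra_simps power2_eq_square)
  finally have "(\<lambda>n. 1 / (4 * k) * (((s n)\<^sup>2 - k) * (d n)\<^sup>2 - ((w n)\<^sup>2 - k) * (e n)\<^sup>2))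
      \<in> O(\<lambda>n. u n powr (- 4 / 3))"
    using k by simp
  then have T3: "(\<lambda>n. ((s n)\<^sup>2 - k) * (d n)\<^sup>2 / (4 * k) - ((w n)\<^sup>2 - k) * (e n)\<^sup>2 / (4 * k))
      \<in> O(\<lambda>n. u n powr (- 4 / 3))"
    by (simp add: diff_divide_distrib)
  have T1: "(\<lambda>n. 2 * (s n - w n)) \<in> O(\<lambda>n. u n powr (- 4 / 3))"
  proof -
    have "(\<lambda>n. s n - w n) \<in> O(\<lambda>n. u n powr (- 4 / 3))"
      by (rule landau_o.big.trans[OF Ssw pw]) simp
    then show ?thesis by (subst landau_o.big.cmult_in_iff) simp_all
  qed
  have T2': "(\<lambda>n. node_remainder \<alpha> k (u n) (s n) - node_remainder \<alpha> k (u n) (w n))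
      \<in> O(\<lambda>n. u n powr (- 4 / 3))"
    by (rule landau_o.big.trans[OF T2 pw]) simp
  have T0: "(\<lambda>n. - 2 * w n - node_remainder \<alpha> k (u n) (w n) + ((w n)\<^sup>2 - k) * (e n)\<^sup>2 / (4 * k)
    - laur 2 (subleading_poly (\<alpha> / 3) k) (u n)) \<in> O(\<lambda>n. u n powr (- 4 / 3))"
    using landau_o.big.compose[OF explicit_expansion[OF G_pos, of \<alpha>] u_top]
    unfolding w_def e_def k_def .
  from sum_in_bigo(1)[OF sum_in_bigo(2)[OF sum_in_bigo(2)[OF T0 T1] T2'] T3]
  have "(\<lambda>n. - 2 * s n - node_remainder \<alpha> k (u n) (s n) + ((s n)\<^sup>2 - k) * (d n)\<^sup>2 / (4 * k)
      - laur 2 (subleading_poly (\<alpha> / 3) k) (u n)) \<in> O(\<lambda>n. u n powr (- 4 / 3))"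
    by (simp add: algebra_simps)
  moreover have "(2 * G - 2 * S (Suc n) - ((S (Suc n))\<^sup>2 - k) * \<eta> (Suc n) * \<eta> n / k)
     - (2 * G - (U (Suc n))\<^sup>2 / k + laur 2 (subleading_poly (\<alpha> / 3) k) (U (Suc n))) =
     - 2 * s n - node_remainder \<alpha> k (u n) (s n) + ((s n)\<^sup>2 - k) * (d n)\<^sup>2 / (4 * k)
      - laur 2 (subleading_poly (\<alpha> / 3) k) (u n)" for n
    using subleading_identity[of n] by (simp add: u_def s_def d_def k_def)
  ultimately show ?thesis unfolding u_def by (simp only:)
qed

end

section \<open>Re-expansion in powers of n\<close>

lemma powr_shift_expansions:
  fixes h :: real
  shows "(\<lambda>z. (z + h) powr (2 / 3) - z powr (2 / 3) - 2 / 3 * h * z powr (- 1 / 3))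
      \<in> O(\<lambda>z. z powr (- 4 / 3))"
    and "(\<lambda>z. (z + h) powr (1 / 3) - z powr (1 / 3) - 1 / 3 * h * z powr (- 2 / 3))
        \<in> O(\<lambda>z. z powr (- 4 / 3))"
    and "(\<lambda>z. (z + h) powr (- 1 / 3) - z powr (- 1 / 3)) \<in> O(\<lambda>z. z powr (- 4 / 3))"
    and "(\<lambda>z. (z + h) powr (- 2 / 3) - z powr (- 2 / 3)) \<in> O(\<lambda>z. z powr (- 4 / 3))"
    and "(\<lambda>z. 1 / (z + h) - 1 / z) \<in> O(\<lambda>z. z powr (- 4 / 3))"
  by real_asymp+

lemma laur_subleading_poly:
  assumes "u > 0"
  shows "laur 2 (subleading_poly v k) u = - 3 * u powr (2 / 3) + 3 * v * u powr (1 / 3) + (1 + 27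
      * v\<^sup>2) / 36
    + (9 * v ^ 3 - v) / 36 * u powr (- 1 / 3) + (9 * v ^ 4 - v\<^sup>2 - 144 * k) / 144 * u powr (- 2 / 3)
    + (9 * v ^ 3 - v + 1296 * v * k) / 1296 * (1 / u)"
proof -
  define x where "x = u powr (1 / 3)"
  have x: "x > 0" "u = x ^ 3" "u powr (2 / 3) = x\<^sup>2" "u powr (- 1 / 3) = 1 / x" "u powr (- 2 / 3)
      = 1 / x\<^sup>2"
    using assms powr_third_power[of u 2] by (simp_all add: x_def powr_third_power powr_minus_divide)
  show ?thesis
    unfolding laur_def x(3,4,5) x_def[symmetric] unfolding x(2) subleading_poly_def
    using x(1) by (simp add: field_simps power2_eq_square power3_eq_cube eval_nat_numeral)
qed

text \<open>Only the powers 2/3 and 1/3 feel the shift \<alpha> / 2 above the error: their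
  first-order terms give - \<alpha> g^2 at order -1/3 and \<alpha>^2 g / 6 at order -2/3.\<close>

lemma laur_subleading_poly_expansion:
  fixes G \<alpha> :: real
  assumes G: "G > 0"
  defines "g \<equiv> G powr (1 / 3)" and "v \<equiv> \<alpha> / 3"
  shows "(\<lambda>z. laur 2 (subleading_poly v (G\<^sup>2)) (G * (z + \<alpha> / 2)) -
     (- 3 * g\<^sup>2 * z powr (2 / 3) + \<alpha> * g * z powr (1 / 3) + (1 + 27 * v\<^sup>2) / 36
      + ((9 * v ^ 3 - v) / (36 * g) - \<alpha> * g\<^sup>2) * z powr (- 1 / 3)
      + ((9 * v ^ 4 - v\<^sup>2 - 144 * G\<^sup>2) / (144 * g\<^sup>2) + \<alpha>\<^sup>2 * g / 6) * z powr (- 2 / 3)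
      + (9 * v ^ 3 - v + 1296 * v * G\<^sup>2) / (1296 * G) * (1 / z))) \<in> O(\<lambda>z. z powr (- 4 / 3))"
proof -
  let ?h = "\<alpha> / 2"
  note ex = powr_shift_expansions[of ?h]
  have g: "g > 0" "G powr (2 / 3) = g\<^sup>2" "G powr (- 1 / 3) = 1 / g" "G powr (- 2 / 3) = 1 / g\<^sup>2"
    using G powr_third_power[of G 2] by (simp_all add: g_def powr_minus_divide)
  let ?c1 = "- 3 * g\<^sup>2" and ?c2 = "\<alpha> * g" and ?c3 = "(9 * v ^ 3 - v) / (36 * g)"
    and ?c4 = "(9 * v ^ 4 - v\<^sup>2 - 144 * G\<^sup>2) / (144 * g\<^sup>2)"
    and ?c5 = "(9 * v ^ 3 - v + 1296 * v * G\<^sup>2) / (1296 * G)"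
  have cm: "(\<lambda>z. c * f z) \<in> O(\<lambda>z. z powr (- 4 / 3))" if "f \<in> O(\<lambda>z. z powr (- 4 / 3))"
    for c :: real and f :: "real \<Rightarrow> real"
    using that by (cases "c = 0") auto
  have "(\<lambda>z. ?c1 * ((z + ?h) powr (2 / 3) - z powr (2 / 3) - 2 / 3 * ?h * z powr (- 1 / 3))
      + ?c2 * ((z + ?h) powr (1 / 3) - z powr (1 / 3) - 1 / 3 * ?h * z powr (- 2 / 3))
      + ?c3 * ((z + ?h) powr (- 1 / 3) - z powr (- 1 / 3))
      + ?c4 * ((z + ?h) powr (- 2 / 3) - z powr (- 2 / 3))
      + ?c5 * (1 / (z + ?h) - 1 / z)) \<in> O(\<lambda>z. z powr (- 4 / 3))"
    by (intro sum_in_bigo(1) cm ex)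
  moreover have "eventually (\<lambda>z. ?c1 * ((z + ?h) powr (2 / 3) - z powr (2 / 3) - 2 / 3 * ?h
      * z powr (- 1 / 3))
      + ?c2 * ((z + ?h) powr (1 / 3) - z powr (1 / 3) - 1 / 3 * ?h * z powr (- 2 / 3))
      + ?c3 * ((z + ?h) powr (- 1 / 3) - z powr (- 1 / 3))
      + ?c4 * ((z + ?h) powr (- 2 / 3) - z powr (- 2 / 3))
      + ?c5 * (1 / (z + ?h) - 1 / z) =
     laur 2 (subleading_poly v (G\<^sup>2)) (G * (z + \<alpha> / 2)) -
     (- 3 * g\<^sup>2 * z powr (2 / 3) + \<alpha> * g * z powr (1 / 3) + (1 + 27 * v\<^sup>2) / 36
      + ((9 * v ^ 3 - v) / (36 * g) - \<alpha> * g\<^sup>2) * z powr (- 1 / 3)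
      + ((9 * v ^ 4 - v\<^sup>2 - 144 * G\<^sup>2) / (144 * g\<^sup>2) + \<alpha>\<^sup>2 * g / 6) * z powr (- 2 / 3)
      + (9 * v ^ 3 - v + 1296 * v * G\<^sup>2) / (1296 * G) * (1 / z))) at_top"
    using eventually_gt_at_top[of "\<bar>?h\<bar>"]
  proof eventually_elim
    case (elim z)
    then have pos: "z + ?h > 0" "z > 0" "G * (z + ?h) > 0" using G by auto
    have P: "(G * (z + ?h)) powr q = G powr q * (z + ?h) powr q" for q
      using pos G by (simp add: powr_mult)
    have L: "laur 2 (subleading_poly v (G\<^sup>2)) (G * (z + ?h)) = ?c1 * (z + ?h) powr (2 / 3) + ?c2
        * (z + ?h) powr (1 / 3)
      + (1 + 27 * v\<^sup>2) / 36 + ?c3 * (z + ?h) powr (- 1 / 3) + ?c4 * (z + ?h) powr (- 2 / 3) + ?c5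
          * (1 / (z + ?h))"
      unfolding laur_subleading_poly[OF pos(3)] P g g_def[symmetric] by (simp add: v_def)
    have gen: "c1 * (A - A0 - 2 / 3 * ?h * B0) + c2 * (D - D0 - 1 / 3 * ?h * E0) + c3 * (B - B0)
        + c4 * (E - E0) + c5 * (F - F0) =
      c1 * A + c2 * D + m + c3 * B + c4 * E + c5 * F -
      (c1 * A0 + c2 * D0 + m + (c3 + c1 * \<alpha> / 3) * B0 + (c4 + c2 * \<alpha> / 6) * E0 + c5 * F0)"
      for c1 c2 c3 c4 c5 A B D E F A0 B0 D0 E0 F0 m :: real
      by (simp add: field_simps)
    have co: "?c3 + ?c1 * \<alpha> / 3 = ?c3 - \<alpha> * g\<^sup>2" "?c4 + ?c2 * \<alpha> / 6 = ?c4 + \<alpha>\<^sup>2 * g / 6"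
      by (simp_all add: power2_eq_square)
    show ?case unfolding L unfolding co[symmetric] by (rule gen)
  qed
  ultimately show ?thesis by (subst (asm) landau_o.big.in_cong) auto
qed

lemma bigo_offset:
  fixes f g :: "nat \<Rightarrow> real"
  assumes "(\<lambda>n. f (Suc n)) \<in> O(\<lambda>n. g (Suc n))"
  shows "f \<in> O(g)"
proof -
  obtain c where "eventually (\<lambda>n. norm (f (Suc n)) \<le> c * norm (g (Suc n))) sequentially"
    using assms by (auto elim!: landau_o.bigE)
  then have "eventually (\<lambda>n. norm (f n) \<le> c * norm (g n)) sequentially"
    by (subst (asm) eventually_sequentially_Suc)
  then show ?thesis by (rule bigoI)
qed

theorem theorem4p2:
  fixes \<alpha> t \<kappa> :: real and P :: "nat \<Rightarrow> real poly"
  assumes "\<alpha> > -1"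
    and "\<kappa> = root 3 2"
    and "t > 0"
    and "monic_orthogonal_polys t \<alpha> P"
  shows "(\<lambda>n. subleading_coeff P n -
           (- ((real n)^2) - \<alpha> * real n
            - 3 * t powr (2/3) * real n powr (2/3) / (2 * \<kappa>)
            + \<alpha> * t powr (1/3) * real n powr (1/3) / \<kappa>^2
            - (6 * \<alpha>^2 - 18 * t - 1) / 36
            + \<alpha> * (\<alpha>^2 - 27 * t - 1) / (54 * \<kappa> * t powr (1/3) * real n powr (1/3))
            + (\<alpha>^4 + \<alpha>^2 * (54 * t - 1) - 81 * t^2)
                / (324 * \<kappa>^2 * t powr (2/3) * real n powr (2/3))
            + \<alpha> * (\<alpha>^2 + 81 * t^2 - 1) / (972 * t * real n)))
         \<in> O(\<lambda>n. real n powr (- 4/3))"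
proof -
  define G where "G = t / 4"
  define k where "k = G\<^sup>2"
  define g where "g = G powr (1 / 3)"
  have G: "G > 0" "t = 4 * G" and k: "k > 0" using assms(3) by (simp_all add: G_def k_def)
  let ?E = "\<lambda>n. - ((real n)^2) - \<alpha> * real n
            - 3 * t powr (2/3) * real n powr (2/3) / (2 * \<kappa>)
            + \<alpha> * t powr (1/3) * real n powr (1/3) / \<kappa>^2
            - (6 * \<alpha>^2 - 18 * t - 1) / 36
            + \<alpha> * (\<alpha>^2 - 27 * t - 1) / (54 * \<kappa> * t powr (1/3) * real n powr (1/3))
            + (\<alpha>^4 + \<alpha>^2 * (54 * t - 1) - 81 * t^2)
                / (324 * \<kappa>^2 * t powr (2/3) * real n powr (2/3))
            + \<alpha> * (\<alpha>^2 + 81 * t^2 - 1) / (972 * t * real n)"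
  let ?u = "\<lambda>z. G * (z + \<alpha> / 2)"
  let ?F = "\<lambda>z. 2 * G - (?u z)\<^sup>2 / k + laur 2 (subleading_poly (\<alpha> / 3) k) (?u z)"
  obtain S \<eta> where sys: "positive_discrete_system G \<alpha> (\<lambda>n. G * (real n + 1 + \<alpha> / 2)) S \<eta>"
    and p: "\<And>n. subleading_coeff P (Suc (Suc n)) = 2 * G - 2 * S (Suc n)
       - ((S (Suc n))\<^sup>2 - G\<^sup>2) * \<eta> (Suc n) * \<eta> n / G\<^sup>2"
    using monic_orthogonal_polys_imp_system[OF assms(4,3,1)] unfolding G_def by metis
  interpret positive_discrete_system G \<alpha> "\<lambda>n. G * (real n + 1 + \<alpha> / 2)" S \<eta> by (rule sys)
  \<comment> \<open>\<open>U (Suc n)\<close> belongs to the subleading coefficient of index n + 2,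
    so \<open>?u\<close> is evaluated at exactly that index; two offsets then remove the
    successors.\<close>
  have idx: "G * (real (Suc n) + 1 + \<alpha> / 2) = ?u (real (Suc (Suc n)))" for n
    by (simp add: algebra_simps)
  have "(\<lambda>n. subleading_coeff P (Suc (Suc n)) - ?F (real (Suc (Suc n))))
      \<in> O(\<lambda>n. ?u (real (Suc (Suc n))) powr (- 4 / 3))"
    using subleading_asymp unfolding p k_def idx .
  then have "(\<lambda>n. subleading_coeff P (Suc n) - ?F (real (Suc n)))
      \<in> O(\<lambda>n. ?u (real (Suc n)) powr (- 4 / 3))"
    by (rule bigo_offset)
  then have "(\<lambda>n. subleading_coeff P n - ?F (real n)) \<in> O(\<lambda>n. ?u (real n) powr (- 4 / 3))"
    by (rule bigo_offset)
  also have "(\<lambda>n. ?u (real n) powr (- 4 / 3)) \<in> O(\<lambda>n. real n powr (- 4 / 3))"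
    using G(1) by real_asymp
  finally have 1: "(\<lambda>n. subleading_coeff P n - ?F (real n)) \<in> O(\<lambda>n. real n powr (- 4 / 3))" .
  let ?L = "\<lambda>z. laur 2 (subleading_poly (\<alpha> / 3) (G\<^sup>2)) (G * (z + \<alpha> / 2)) -
     (- 3 * g\<^sup>2 * z powr (2 / 3) + \<alpha> * g * z powr (1 / 3) + (1 + 27 * (\<alpha> / 3)\<^sup>2) / 36
      + ((9 * (\<alpha> / 3) ^ 3 - \<alpha> / 3) / (36 * g) - \<alpha> * g\<^sup>2) * z powr (- 1 / 3)
      + ((9 * (\<alpha> / 3) ^ 4 - (\<alpha> / 3)\<^sup>2 - 144 * G\<^sup>2) / (144 * g\<^sup>2) + \<alpha>\<^sup>2 * g / 6) * z powr (- 2 / 3)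
      + (9 * (\<alpha> / 3) ^ 3 - \<alpha> / 3 + 1296 * (\<alpha> / 3) * G\<^sup>2) / (1296 * G) * (1 / z))"
  have telescope: "x - y + (y - z) = x - z" for x y z :: real by simp
  have "(\<lambda>n. ?L (real n)) \<in> O(\<lambda>n. real n powr (- 4 / 3))"
    unfolding g_def by (rule landau_o.big.compose[OF laur_subleading_poly_expansion[OF G(1)]
        filterlim_real_sequentially])
  moreover have "eventually (\<lambda>n. ?L (real n) = ?F (real n) - ?E n) sequentially"
    using eventually_gt_at_top[of 0]
  proof eventually_elim
    case (elim n)
    define a where "a = real n powr (1 / 3)"
    have n: "real n > 0" using elim by simp
    have a: "a > 0" "real n = a ^ 3" "real n powr (2 / 3) = a\<^sup>2"
      "real n powr (- 1 / 3) = 1 / a" "real n powr (- 2 / 3) = 1 / a\<^sup>2"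
      using n powr_third_power[OF n, of 2] by (simp_all add: a_def powr_third_power
          powr_minus_divide)
    have g: "g > 0" "G = g ^ 3" using G(1) by (simp_all add: g_def powr_third_power)
    have \<kappa>: "\<kappa> > 0" "\<kappa> ^ 3 = 2" by (simp_all add: assms(2))
    \<comment> \<open>Since \<kappa>^6 = 4 and t = 4 G, the cube root of t is \<kappa>^2 g; this is
      how \<kappa> enters the coefficients.\<close>
    have "(\<kappa>\<^sup>2 * g) ^ 3 = (\<kappa> ^ 3)\<^sup>2 * g ^ 3"
      by (simp add: power_mult_distrib flip: power_mult)
    then have "(\<kappa>\<^sup>2 * g) ^ 3 = t" unfolding \<kappa>(2) by (simp add: G(2) g(2))
    moreover have "(t powr (1 / 3)) ^ 3 = t" using assms(3) by (simp add: powr_third_power)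
    ultimately have "(t powr (1 / 3)) ^ 3 = (\<kappa>\<^sup>2 * g) ^ 3" by simp
    then have t1: "t powr (1 / 3) = \<kappa>\<^sup>2 * g"
      by (rule power_eq_imp_eq_base) (use g(1) \<kappa>(1) in auto)
    have "t powr (2 / 3) = (t powr (1 / 3))\<^sup>2" using powr_third_power[OF assms(3), of 2] by simp
    also have "\<dots> = \<kappa> ^ 3 * \<kappa> * g\<^sup>2" by (simp add: t1 power2_eq_square power3_eq_cube)
    finally have t2: "t powr (2 / 3) = 2 * \<kappa> * g\<^sup>2" using \<kappa>(2) by simp
    have e1: "3 * (2 * \<kappa> * g\<^sup>2) * a\<^sup>2 / (2 * \<kappa>) = 3 * g\<^sup>2 * a\<^sup>2" using \<kappa>(1) by simp
    have e2: "\<alpha> * (\<kappa>\<^sup>2 * g) * a / \<kappa>\<^sup>2 = \<alpha> * g * a" using \<kappa>(1) by simp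
    have "54 * \<kappa> * (\<kappa>\<^sup>2 * g) * a = 54 * \<kappa> ^ 3 * g * a" by (simp add: power2_eq_square
        power3_eq_cube)
    then have e3: "\<alpha> * (\<alpha>\<^sup>2 - 27 * t - 1) / (54 * \<kappa> * (\<kappa>\<^sup>2 * g) * a) =
      ((9 * (\<alpha> / 3) ^ 3 - \<alpha> / 3) / (36 * g) - \<alpha> * g\<^sup>2) * (1 / a)"
      unfolding \<kappa>(2) using g(1) a(1) by (simp add: G(2) g(2) field_simps power2_eq_square
          power3_eq_cube)
    have "324 * \<kappa>\<^sup>2 * (2 * \<kappa> * g\<^sup>2) * a\<^sup>2 = 648 * \<kappa> ^ 3 * g\<^sup>2 * a\<^sup>2"
        by (simp add: power2_eq_square power3_eq_cube)
    then have e4: "(\<alpha>^4 + \<alpha>\<^sup>2 * (54 * t - 1) - 81 * t\<^sup>2) / (324 * \<kappa>\<^sup>2 * (2 * \<kappa> * g\<^sup>2) * a\<^sup>2) =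
      ((9 * (\<alpha> / 3) ^ 4 - (\<alpha> / 3)\<^sup>2 - 144 * G\<^sup>2) / (144 * g\<^sup>2) + \<alpha>\<^sup>2 * g / 6) * (1 / a\<^sup>2)"
      unfolding \<kappa>(2) using g(1) a(1) by (simp add: G(2) g(2) field_simps eval_nat_numeral)
    have e5: "\<alpha> * (\<alpha>\<^sup>2 + 81 * t\<^sup>2 - 1) / (972 * t * real n) =
      (9 * (\<alpha> / 3) ^ 3 - \<alpha> / 3 + 1296 * (\<alpha> / 3) * G\<^sup>2) / (1296 * G) * (1 / real n)"
      using G(1) n by (simp add: G(2) field_simps eval_nat_numeral)
    \<comment> \<open>The centred square supplies the polynomial part of the expansion exactly; its
      constant \<alpha>^2 / 4 is absorbed in \<open>e6\<close>.\<close>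
    have e0: "(?u (real n))\<^sup>2 / k = (real n)\<^sup>2 + \<alpha> * real n + \<alpha>\<^sup>2 / 4"
      using G(1) by (simp add: k_def power_mult_distrib) (simp add: power2_eq_square field_simps)
    have e6: "2 * G - \<alpha>\<^sup>2 / 4 + (6 * \<alpha>\<^sup>2 - 18 * t - 1) / 36 = - ((1 + 27 * (\<alpha> / 3)\<^sup>2) / 36)"
      by (simp add: G(2) power_divide field_simps)
    have gen: "L - (- c1 + c2 + m + c3 + c4 + c5) = 2 * G - (q + r + s) + L - (- q - r - c1 + c2
        - m' + c3 + c4 + c5)"
      if "2 * G - s + m' = - m" for L c1 c2 m c3 c4 c5 q r s m' :: real
      using that by simp
    have neg: "- 3 * g\<^sup>2 * a\<^sup>2 = - (3 * g\<^sup>2 * a\<^sup>2)" by simp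
    show ?case
      unfolding t1 t2 a(3,4,5) a_def[symmetric] e0 e1 e2 e3 e4 e5 neg k_def[symmetric] using e6
          by (rule gen)
  qed
  ultimately have "(\<lambda>n. ?F (real n) - ?E n) \<in> O(\<lambda>n. real n powr (- 4 / 3))"
    by (subst (asm) landau_o.big.in_cong) auto
  from sum_in_bigo(1)[OF 1 this] show ?thesis unfolding telescope .
qed

end
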